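(* Let $\Omega\subset\mathbb{R}^n$ be a bounded domain with Lipschitz boundary, $T>0$, $\Omega_T=\Omega\times(0,T)$, $\Gamma=\partial\Omega\times(0,T)$, and let $p:\overline\Omega\to(1,\infty)$ be log-Hölder continuous with $1<p^-\le p(x)\le p^+<\infty$ for constants $p^-,p^+$. Let $m\ge1$, let $u_0\ge0$ on $\Omega$ with $\operatorname{supp}u_0\subsetneqq\Omega$, and let $u$ be a (non-negative) weak solution of $$\frac{\partial u}{\partial t}=u^m\,\mathrm{div}\left(|Du|^{p(x)-2}Du\right)\ \text{in }\Omega_T,\qquad u(x,t)=0\ \text{on }\Gamma,\qquad u(x,0)=u_0(x)\ \text{in }\Omega.$$ Then $\operatorname{supp}u(t)\subset\operatorname{supp}u_0$ for a.e. $t\in(0,T]$, where $u(t)=u(\cdot,t)$.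
   Context: Support: for $f:\Omega\to\mathbb{R}_+\cup\{0\}$ put $F=\{x\in\Omega: f(x)>0\}$ and $$\operatorname{supp}f:=\overline{\left\{x\in F:\ \lim_{r\to0}\frac{\mu(F\cap B_r(x))}{\mu(B_r(x))}>0\right\}},$$ where $B_r(x)=\{z:|z-x|\le r\}$ and $\mu$ is Lebesgue measure. $D$ denotes the weak gradient in the space variable $x$. Log-Hölder continuity of $p$: there is $C>0$ with $|p(x)-p(y)|\le C/\log(e+1/|x-y|)$ for all $x\ne y$ in $\overline\Omega$. $\|\cdot\|_{p(\cdot),\Omega}$ is the Luxemburg norm $\|f\|_{p(\cdot),\Omega}=\inf\{\alpha>0:\int_\Omega|f/\alpha|^{p(x)}dx\le 1\}$ (similarly on $\Omega_T$). $\mathcal V(\Omega)=\{u\in L^2(\Omega):|Du|^{p(x)}\in L^1(\Omega)\}$ with norm $\|u\|_{2,\Omega}+\|Du\|_{p(\cdot),\Omega}$. $\mathcal U(\Omega_T)=\{u:(0,T)\to\mathcal V(\Omega): u\in L^2(\Omega_T),\ |Du|^{p(x)}\in L^1(\Omega_T)\}$ with norm $\|u\|_{2,\Omega_T}+\|Du\|_{p(\cdot),\Omega_T}$; $\mathcal U'(\Omega_T)$ is its dual space. A function $u$ (only non-negative functions are considered) is a weak solution of the problem if: (1) $u\in\mathcal U(\Omega_T)\cap L^\infty(\Omega_T)$ and $\frac{\partial u}{\partial t}\in\mathcal U'(\Omega_T)\cap L^2(\Omega_T)$; (2) for every $\varphi\in C_0^1(\Omega_T)$, $$\iint_{\Omega_T}\frac{\partial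 u}{\partial t}\varphi\,dx\,dt+\iint_{\Omega_T}|Du|^{p(x)-2}Du\cdot D(u^m\varphi)\,dx\,dt=0;$$ (3) $u=0$ on $\Gamma$ and $u(x,0)=u_0(x)$ in $\Omega$ in the sense of trace. *)

theory Defs
  imports "HOL-Analysis.Analysis"
begin

definition lipschitz_boundary :: "'a::euclidean_space set \<Rightarrow> bool" where
  "lipschitz_boundary \<Omega> \<longleftrightarrow>
     (\<forall>z\<in>frontier \<Omega>. \<exists>\<nu> r L \<gamma>.
        norm \<nu> = 1 \<and> 0 < r \<and> L-lipschitz_on {y. y \<bullet> \<nu> = 0} \<gamma> \<and>
        \<Omega> \<inter> ball z r = {x \<in> ball z r. \<gamma> (x - (x \<bullet> \<nu>) *\<^sub>R \<nu>) < x \<bullet> \<nu>})"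

definition log_hoelder_on :: "'a::metric_space set \<Rightarrow> ('a \<Rightarrow> real) \<Rightarrow> bool" where
  "log_hoelder_on S p \<longleftrightarrow>
     (\<exists>C>0. \<forall>x\<in>S. \<forall>y\<in>S. x \<noteq> y \<longrightarrow> \<bar>p x - p y\<bar> \<le> C / ln (exp 1 + 1 / dist x y))"

definition msupp :: "'a::euclidean_space set \<Rightarrow> ('a \<Rightarrow> real) \<Rightarrow> 'a set" where
  "msupp \<Omega> f = (let F = {x \<in> \<Omega>. f x > 0} in
     closure {x \<in> F. \<exists>l>0. ((\<lambda>r. measure lebesgue (F \<inter> cball x r) / measure lebesgue (cball x r))
                              \<longlongrightarrow> l) (at_right 0)})"

abbreviation cylinder :: "'a::euclidean_space set \<Rightarrow> real \<Rightarrow> ('a \<times> real) set" where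
  "cylinder \<Omega> T \<equiv> \<Omega> \<times> {0<..<T}"


subsection \<open>Weak derivatives\<close>

definition C1_fun :: "('b::euclidean_space \<Rightarrow> real) \<Rightarrow> bool" where
  "C1_fun \<phi> \<longleftrightarrow> (\<forall>z. \<phi> differentiable at z) \<and>
     (\<forall>e. continuous_on UNIV (\<lambda>z. frechet_derivative \<phi> (at z) e))"

text \<open>Elements of \<open>C\<^sub>0\<^sup>1(Q)\<close> are identified with their extension by zero to the whole space.\<close>

definition C01 :: "'b::euclidean_space set \<Rightarrow> ('b \<Rightarrow> real) set" where
  "C01 Q = {\<phi>. C1_fun \<phi> \<and> compact (closure {z. \<phi> z \<noteq> 0}) \<and> closure {z. \<phi> z \<noteq> 0} \<subseteq> Q}"

definition locally_integrable :: "'b::euclidean_space set \<Rightarrow> ('b \<Rightarrow> real) \<Rightarrow> bool" where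
  "locally_integrable Q f \<longleftrightarrow> (\<forall>K. compact K \<and> K \<subseteq> Q \<longrightarrow> integrable (lebesgue_on K) f)"

text \<open>\<open>g\<close> is the weak derivative of \<open>f\<close> on the open set \<open>Q\<close> in the direction \<open>e\<close>.\<close>

definition has_weak_deriv ::
    "'b::euclidean_space set \<Rightarrow> 'b \<Rightarrow> ('b \<Rightarrow> real) \<Rightarrow> ('b \<Rightarrow> real) \<Rightarrow> bool" where
  "has_weak_deriv Q e f g \<longleftrightarrow> locally_integrable Q f \<and> locally_integrable Q g \<and>
     (\<forall>\<phi>\<in>C01 Q. (LINT z|lebesgue_on Q. f z * frechet_derivative \<phi> (at z) e)
                 = - (LINT z|lebesgue_on Q. g z * \<phi> z))"

definition has_weak_grad ::
    "'a::euclidean_space set \<Rightarrow> ('a \<Rightarrow> real) \<Rightarrow> ('a \<Rightarrow> 'a) \<Rightarrow> bool" where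
  "has_weak_grad \<Omega> v G \<longleftrightarrow> (\<forall>b\<in>Basis. has_weak_deriv \<Omega> b v (\<lambda>x. G x \<bullet> b))"

definition weak_grad :: "'a::euclidean_space set \<Rightarrow> ('a \<Rightarrow> real) \<Rightarrow> 'a \<Rightarrow> 'a" where
  "weak_grad \<Omega> v = (SOME G. has_weak_grad \<Omega> v G)"

text \<open>The weak gradient in the space variable only, for functions of \<open>(x, t)\<close>.
  It is determined up to a null set, as is \<^const>\<open>weak_grad\<close>.\<close>

definition has_space_grad ::
    "('a::euclidean_space \<times> real) set \<Rightarrow> ('a \<times> real \<Rightarrow> real) \<Rightarrow> ('a \<times> real \<Rightarrow> 'a) \<Rightarrow> bool" where
  "has_space_grad Q u G \<longleftrightarrow> (\<forall>b\<in>Basis. has_weak_deriv Q (b, 0) u (\<lambda>z. G z \<bullet> b))"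

definition space_grad ::
    "('a::euclidean_space \<times> real) set \<Rightarrow> ('a \<times> real \<Rightarrow> real) \<Rightarrow> 'a \<times> real \<Rightarrow> 'a" where
  "space_grad Q u = (SOME G. has_space_grad Q u G)"


subsection \<open>Function spaces\<close>

definition L2_fun :: "'b::euclidean_space set \<Rightarrow> ('b \<Rightarrow> real) \<Rightarrow> bool" where
  "L2_fun Q f \<longleftrightarrow> f \<in> borel_measurable (lebesgue_on Q) \<and> integrable (lebesgue_on Q) (\<lambda>z. (f z)\<^sup>2)"

definition Linf_fun :: "'b::euclidean_space set \<Rightarrow> ('b \<Rightarrow> real) \<Rightarrow> bool" where
  "Linf_fun Q f \<longleftrightarrow> f \<in> borel_measurable (lebesgue_on Q) \<and>
     (\<exists>M. AE z in lebesgue_on Q. \<bar>f z\<bar> \<le> M)"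

definition luxemburg_norm ::
    "'b::euclidean_space set \<Rightarrow> ('b \<Rightarrow> real) \<Rightarrow> ('b \<Rightarrow> 'c::real_normed_vector) \<Rightarrow> real" where
  "luxemburg_norm Q q f =
     Inf {\<alpha>. 0 < \<alpha> \<and> (\<integral>\<^sup>+z. ennreal (norm (f z /\<^sub>R \<alpha>) powr q z) \<partial>lebesgue_on Q) \<le> 1}"

definition V_space :: "'a::euclidean_space set \<Rightarrow> ('a \<Rightarrow> real) \<Rightarrow> ('a \<Rightarrow> real) set" where
  "V_space \<Omega> p = {v. L2_fun \<Omega> v \<and> (\<exists>G. has_weak_grad \<Omega> v G) \<and>
     integrable (lebesgue_on \<Omega>) (\<lambda>x. norm (weak_grad \<Omega> v x) powr p x)}"

text \<open>As elements of \<open>L\<^sup>2\<close> of the cylinder are classes modulo null sets, the time slices are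
  constrained for almost every time only.\<close>

definition U_space ::
    "'a::euclidean_space set \<Rightarrow> real \<Rightarrow> ('a \<Rightarrow> real) \<Rightarrow> ('a \<times> real \<Rightarrow> real) set" where
  "U_space \<Omega> T p = {u. (AE t in lebesgue_on {0<..<T}. (\<lambda>x. u (x, t)) \<in> V_space \<Omega> p) \<and>
     L2_fun (cylinder \<Omega> T) u \<and> (\<exists>G. has_space_grad (cylinder \<Omega> T) u G) \<and>
     integrable (lebesgue_on (cylinder \<Omega> T))
       (\<lambda>z. norm (space_grad (cylinder \<Omega> T) u z) powr p (fst z))}"

definition U_norm ::
    "'a::euclidean_space set \<Rightarrow> real \<Rightarrow> ('a \<Rightarrow> real) \<Rightarrow> ('a \<times> real \<Rightarrow> real) \<Rightarrow> real" where
  "U_norm \<Omega> T p u = sqrt (LINT z|lebesgue_on (cylinder \<Omega> T). (u z)\<^sup>2) +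
     luxemburg_norm (cylinder \<Omega> T) (\<lambda>z. p (fst z)) (space_grad (cylinder \<Omega> T) u)"

text \<open>A function \<open>v\<close> on the cylinder belongs to the dual of \<^const>\<open>U_space\<close> if the functional
  \<open>w \<mapsto> \<integral>\<integral> v w\<close> is defined and bounded on it.\<close>

definition U_dual_fun ::
    "'a::euclidean_space set \<Rightarrow> real \<Rightarrow> ('a \<Rightarrow> real) \<Rightarrow> ('a \<times> real \<Rightarrow> real) \<Rightarrow> bool" where
  "U_dual_fun \<Omega> T p v \<longleftrightarrow> (\<exists>C. \<forall>w\<in>U_space \<Omega> T p.
     integrable (lebesgue_on (cylinder \<Omega> T)) (\<lambda>z. v z * w z) \<and>
     \<bar>LINT z|lebesgue_on (cylinder \<Omega> T). v z * w z\<bar> \<le> C * U_norm \<Omega> T p w)"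


subsection \<open>Traces\<close>

text \<open>The Hausdorff measure of dimension \<open>s > 0\<close>. The outer measure is countably additive on the
  Borel sets by Caratheodory's criterion, so \<^const>\<open>measure_of\<close> does not collapse to the
  null measure.\<close>

definition hausdorff_outer :: "nat \<Rightarrow> 'b::euclidean_space set \<Rightarrow> ennreal" where
  "hausdorff_outer s A = (SUP \<delta>\<in>{0::real<..}.
     INF C\<in>{C :: nat \<Rightarrow> 'b set. A \<subseteq> (\<Union>i. C i) \<and> (\<forall>i. bounded (C i) \<and> diameter (C i) \<le> \<delta>)}.
       \<Sum>i. ennreal (unit_ball_vol (real s) * (diameter (C i) / 2) ^ s))"

definition hausdorff_measure :: "nat \<Rightarrow> 'b::euclidean_space measure" where
  "hausdorff_measure s = measure_of UNIV (sets borel) (hausdorff_outer s)"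

text \<open>The trace operator on \<open>W\<^sup>1\<^sup>,\<^sup>1(Q)\<close> is the continuous extension of the restriction to the
  boundary, so \<open>f\<close> has trace \<open>g\<close> if \<open>f\<close> is a limit in \<open>W\<^sup>1\<^sup>,\<^sup>1(Q)\<close> of functions that are \<open>C\<^sup>1\<close> up
  to the boundary and whose boundary values tend to \<open>g\<close> in \<open>L\<^sup>1\<close>. The relevant part of the boundary
  is given by a parametrisation \<open>\<iota>\<close> and by the surface measure \<open>M\<close> on the parameters.\<close>

definition has_trace ::
    "'b::euclidean_space set \<Rightarrow> ('b \<Rightarrow> real) \<Rightarrow> 'c measure \<Rightarrow> ('c \<Rightarrow> 'b) \<Rightarrow> ('c \<Rightarrow> real) \<Rightarrow> bool" where
  "has_trace Q f M \<iota> g \<longleftrightarrow> g \<in> borel_measurable M \<and>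
     (\<exists>\<psi>::nat \<Rightarrow> 'b \<Rightarrow> real. (\<forall>k. C1_fun (\<psi> k)) \<and>
       (\<lambda>k. \<integral>\<^sup>+z. ennreal \<bar>\<psi> k z - f z\<bar> \<partial>lebesgue_on Q) \<longlonglongrightarrow> 0 \<and>
       (\<forall>e\<in>Basis. \<exists>d. has_weak_deriv Q e f d \<and>
         (\<lambda>k. \<integral>\<^sup>+z. ennreal \<bar>frechet_derivative (\<psi> k) (at z) e - d z\<bar> \<partial>lebesgue_on Q) \<longlonglongrightarrow> 0) \<and>
       (\<lambda>k. \<integral>\<^sup>+y. ennreal \<bar>\<psi> k (\<iota> y) - g y\<bar> \<partial>M) \<longlonglongrightarrow> 0)"

definition zero_lateral_trace ::
    "'a::euclidean_space set \<Rightarrow> real \<Rightarrow> ('a \<times> real \<Rightarrow> real) \<Rightarrow> bool" where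
  "zero_lateral_trace \<Omega> T u \<longleftrightarrow> has_trace (cylinder \<Omega> T) u
     (restrict_space (hausdorff_measure DIM('a)) (frontier \<Omega> \<times> {0<..<T})) (\<lambda>z. z) (\<lambda>_. 0)"

definition initial_trace ::
    "'a::euclidean_space set \<Rightarrow> real \<Rightarrow> ('a \<times> real \<Rightarrow> real) \<Rightarrow> ('a \<Rightarrow> real) \<Rightarrow> bool" where
  "initial_trace \<Omega> T u u0 \<longleftrightarrow> has_trace (cylinder \<Omega> T) u (lebesgue_on \<Omega>) (\<lambda>x. (x, 0)) u0"


subsection \<open>Weak solutions\<close>

text \<open>At points where the gradient vanishes, the flux \<open>|Du|\<^sup>p\<^sup>-\<^sup>2 Du\<close> is zero also for \<open>p < 2\<close>.\<close>

definition weak_solution ::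
    "'a::euclidean_space set \<Rightarrow> real \<Rightarrow> ('a \<Rightarrow> real) \<Rightarrow> real \<Rightarrow> ('a \<Rightarrow> real) \<Rightarrow> ('a \<times> real \<Rightarrow> real) \<Rightarrow> bool"
  where
  "weak_solution \<Omega> T p m u0 u \<longleftrightarrow> (let Q = cylinder \<Omega> T in
     (\<forall>z\<in>Q. 0 \<le> u z) \<and> u \<in> U_space \<Omega> T p \<and> Linf_fun Q u \<and>
     (\<exists>ut. has_weak_deriv Q (0, 1) u ut \<and> U_dual_fun \<Omega> T p ut \<and> L2_fun Q ut \<and>
       (\<forall>\<phi>\<in>C01 Q.
          (LINT z|lebesgue_on Q. ut z * \<phi> z) +
          (LINT z|lebesgue_on Q.
             (norm (space_grad Q u z) powr (p (fst z) - 2) *\<^sub>R space_grad Q u z) \<bullet>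
             space_grad Q (\<lambda>y. u y powr m * \<phi> y) z) = 0)) \<and>
     zero_lateral_trace \<Omega> T u \<and> initial_trace \<Omega> T u u0)"

end

theory Submission
  imports Defs
begin

text \<open>Divide the equation by \<open>u\<^sup>m\<close>: formally, the time derivative of a primitive of \<open>u\<^sup>-\<^sup>m\<close> is the divergence
  of the flux \<open>|Du|\<^sup>p\<^sup>-\<^sup>2 Du\<close>. For \<open>m \<ge> 1\<close> such a primitive tends to \<open>-\<infinity>\<close> as \<open>u\<close> tends to \<open>0\<close>, so an
  integrable flux cannot lift the solution off zero within finite time: where the initial value
  vanishes, the solution stays zero.

  To make this precise, test the equation with \<open>\<phi> = \<eta>(x) \<chi>(t) g(u)\<close>, where \<open>g(s) = s / (s\<^sup>2 + \<epsilon>)\<close>, the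
  cutoff function \<open>\<eta>\<close> is supported in \<open>\<Omega>\<close> outside the support of the initial value, and \<open>\<chi>\<close> approaches
  \<open>T - t\<close>. Besides \<open>\<integral>\<integral> u\<^sub>t \<phi>\<close> two terms arise. One is \<open>\<integral>\<integral> |Du|\<^sup>p \<eta> \<chi> k(u)\<close>, where \<open>k\<close> is the
  derivative of \<open>s\<^sup>m g(s)\<close>; it is nonnegative as \<open>m \<ge> 1\<close>. The other one contains \<open>u\<^sup>m g(u) D\<eta>\<close> and is
  bounded independently of \<open>\<epsilon>\<close>, as \<open>u\<close> is bounded and \<open>s\<^sup>m g(s) \<le> s\<^sup>m\<^sup>-\<^sup>1\<close>. An integration by parts in time turns
  \<open>\<integral>\<integral> u\<^sub>t \<phi>\<close> into \<open>\<integral>\<integral> \<eta> G(u)\<close> with \<open>G(s) = ln ((s\<^sup>2 + \<epsilon>) / \<epsilon>) / 2\<close>. This integral is therefore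
  bounded as \<open>\<epsilon>\<close> tends to \<open>0\<close>, although \<open>G(u)\<close> tends to infinity where \<open>u > 0\<close>; by Fatou's lemma,
  \<open>u = 0\<close> almost everywhere on \<open>{\<eta> > 0}\<close> (lemmas \<open>energy_estimate\<close>, \<open>time_identity\<close> and
  \<open>vanishes_off_initial_support\<close>).

  Two points need work. First, \<open>g(u)\<close> is only weakly differentiable. Chain rules for the solution come
  from the functions of class \<open>C\<^sup>1\<close> that approximate it in \<open>W\<^sup>1\<^sup>,\<^sup>1\<close> by the definition of the trace
  (lemma \<open>chain_rule\<close>), and the test function is replaced by its mollifications. Their gradients must
  converge when paired with the flux, which lies in the dual variable exponent space; this is the density
  of smooth functions for log-Hoelder exponents (lemmas \<open>mollify_powr_bound\<close>,
  \<open>mollify_pairing_L1_tendsto\<close> and \<open>tested_identity\<close>).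

  Second, the support is defined by densities. That the initial value vanishes almost everywhere outside
  its support is Lebesgue's density theorem, which follows from Vitali's covering theorem (lemma
  \<open>lebesgue_density\<close>). Conversely, a time slice that vanishes almost everywhere in the open set outside
  a closed set has no points of positive density there (lemma \<open>msupp_subset\<close>); almost every time slice
  is of this kind by Fubini's theorem.\<close>

section \<open>Convergence in mean\<close>

definition L1_tendsto :: "'c measure \<Rightarrow> (nat \<Rightarrow> 'c \<Rightarrow> real) \<Rightarrow> ('c \<Rightarrow> real) \<Rightarrow> bool" where
  "L1_tendsto M F f \<longleftrightarrow> (\<forall>k. integrable M (F k)) \<and> integrable M f \<and>
     (\<lambda>k. LINT x|M. \<bar>F k x - f x\<bar>) \<longlonglongrightarrow> 0"

lemma L1_tendstoD:
  assumes "L1_tendsto M F f"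
  shows "integrable M (F k)" "integrable M f" "(\<lambda>k. LINT x|M. \<bar>F k x - f x\<bar>) \<longlonglongrightarrow> 0"
  using assms by (auto simp: L1_tendsto_def)

lemma L1_tendsto_bound:
  assumes F: "\<And>k. integrable M (F k)" and f: "integrable M f"
    and bnd: "\<And>k. AE x in M. \<bar>F k x - f x\<bar> \<le> G k x"
    and G: "\<And>k. integrable M (G k)" "(\<lambda>k. LINT x|M. G k x) \<longlonglongrightarrow> 0"
  shows "L1_tendsto M F f"
  unfolding L1_tendsto_def
proof (intro conjI allI F f)
  show "(\<lambda>k. LINT x|M. \<bar>F k x - f x\<bar>) \<longlonglongrightarrow> 0"
  proof (rule tendsto_sandwich[OF _ _ tendsto_const G(2)])
    show "\<forall>\<^sub>F k in sequentially. (LINT x|M. \<bar>F k x - f x\<bar>) \<le> (LINT x|M. G k x)"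
      by (intro always_eventually allI integral_mono_AE integrable_abs Bochner_Integration.integrable_diff F f G(1) bnd)
  qed auto
qed

lemma L1_tendsto_integral:
  assumes "L1_tendsto M F f"
  shows "(\<lambda>k. LINT x|M. F k x) \<longlonglongrightarrow> (LINT x|M. f x)"
proof -
  note L = L1_tendstoD[OF assms]
  have "(\<lambda>k. (LINT x|M. F k x) - (LINT x|M. f x)) \<longlonglongrightarrow> 0"
  proof (rule tendsto_0_le[OF L(3), of _ 1], intro always_eventually allI)
    fix k
    have "\<bar>LINT x|M. F k x - f x\<bar> \<le> (LINT x|M. \<bar>F k x - f x\<bar>)" by (rule integral_abs_bound)
    then show "norm ((LINT x|M. F k x) - (LINT x|M. f x)) \<le> norm (LINT x|M. \<bar>F k x - f x\<bar>) * 1"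
      using L(1,2) by simp
  qed
  then show ?thesis by (simp add: LIM_zero_iff)
qed

lemma L1_tendsto_const: "integrable M f \<Longrightarrow> L1_tendsto M (\<lambda>k. f) f"
  by (simp add: L1_tendsto_def)

lemma L1_tendsto_add:
  assumes "L1_tendsto M F f" "L1_tendsto M G g"
  shows "L1_tendsto M (\<lambda>k x. F k x + G k x) (\<lambda>x. f x + g x)"
proof (rule L1_tendsto_bound)
  note L = L1_tendstoD[OF assms(1)] L1_tendstoD[OF assms(2)]
  show "(\<lambda>k. LINT x|M. \<bar>F k x - f x\<bar> + \<bar>G k x - g x\<bar>) \<longlonglongrightarrow> 0"
    using tendsto_add[OF L(3,6)] L(1,2,4,5) by simp
qed (use L1_tendstoD[OF assms(1)] L1_tendstoD[OF assms(2)] in auto)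

lemma L1_tendsto_AE_subseq:
  assumes "L1_tendsto M F f"
  obtains r :: "nat \<Rightarrow> nat" where "strict_mono r" "AE x in M. (\<lambda>k. F (r k) x) \<longlonglongrightarrow> f x"
proof -
  note L = L1_tendstoD[OF assms]
  have "\<exists>r::nat\<Rightarrow>nat. strict_mono r \<and> (AE x in M. (\<lambda>k. F (r k) x - f x) \<longlonglongrightarrow> 0)"
    by (rule tendsto_L1_AE_subseq) (use L in auto)
  then show ?thesis using that by (auto simp: LIM_zero_iff)
qed

lemma L1_tendsto_subseq:
  assumes "L1_tendsto M F f" "strict_mono r"
  shows "L1_tendsto M (\<lambda>k. F (r k)) f"
  using L1_tendstoD[OF assms(1)] LIMSEQ_subseq_LIMSEQ[OF L1_tendstoD(3)[OF assms(1)] assms(2)]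
  by (auto simp: L1_tendsto_def o_def)

text \<open>Dominated convergence with dominating functions that vary but converge in mean. The difference
  \<open>\<bar>a k - A\<bar>\<close> is at most \<open>min \<bar>a k - A\<bar> (2 * h0) + \<bar>h k - h0\<bar>\<close>: the first term has the
  fixed majorant \<open>2 * h0\<close>, the second tends to \<open>0\<close> in mean by assumption. This form is what the
  mollified gradients need, whose natural majorants are themselves mollified.\<close>

lemma L1_tendsto_dominated:
  assumes a[measurable]: "\<And>k. a k \<in> borel_measurable M" and A[measurable]: "A \<in> borel_measurable M"
    and lim: "AE x in M. (\<lambda>k. a k x) \<longlonglongrightarrow> A x"
    and h: "L1_tendsto M h h0"
    and bnd: "\<And>k. AE x in M. \<bar>a k x\<bar> \<le> h k x" "AE x in M. \<bar>A x\<bar> \<le> h0 x"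
  shows "L1_tendsto M a A"
proof -
  note L = L1_tendstoD[OF h]
  have [measurable]: "h0 \<in> borel_measurable M" "\<And>k. h k \<in> borel_measurable M" using L by auto
  have ia: "integrable M (a k)" for k
    by (rule Bochner_Integration.integrable_bound[OF L(1)[of k]]) (use bnd(1)[of k] in auto)
  have iA: "integrable M A"
    by (rule Bochner_Integration.integrable_bound[OF L(2)]) (use bnd(2) in auto)
  let ?m = "\<lambda>k x. min \<bar>a k x - A x\<bar> (2 * h0 x)"
  have h0: "AE x in M. 0 \<le> h0 x" using bnd(2) by eventually_elim auto
  have m0: "(\<lambda>k. LINT x|M. ?m k x) \<longlonglongrightarrow> (LINT x|M. 0)"
  proof (rule integral_dominated_convergence[where w="\<lambda>x. 2 * h0 x"])
    show "AE x in M. (\<lambda>k. ?m k x) \<longlonglongrightarrow> 0"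
      using lim h0
    proof eventually_elim
      case (elim x)
      have "(\<lambda>k. min \<bar>a k x - A x\<bar> (2 * h0 x)) \<longlonglongrightarrow> min \<bar>A x - A x\<bar> (2 * h0 x)"
        by (intro tendsto_intros elim)
      then show ?case using elim by simp
    qed
    show "AE x in M. norm (?m k x) \<le> 2 * h0 x" for k using h0 by eventually_elim auto
  qed (use L in auto)
  have mi: "integrable M (?m k)" for k
    by (rule Bochner_Integration.integrable_bound[of _ "\<lambda>x. a k x - A x"])
       (use ia iA h0 in auto)
  show ?thesis
  proof (rule L1_tendsto_bound[OF ia iA])
    show "AE x in M. \<bar>a k x - A x\<bar> \<le> ?m k x + \<bar>h k x - h0 x\<bar>" for k
      using bnd(1)[of k] bnd(2) by eventually_elim auto
    show "(\<lambda>k. LINT x|M. ?m k x + \<bar>h k x - h0 x\<bar>) \<longlonglongrightarrow> 0"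
      using tendsto_add[OF m0 L(3)] mi L(1,2) by simp
  qed (use mi L in auto)
qed

text \<open>Write \<open>b k * F k - c * f = b k * (F k - f) + (b k - c) * f\<close>; the factor \<open>b k\<close> converges only almost
  everywhere, which suffices for the second term because \<open>f\<close> is fixed.\<close>

lemma L1_tendsto_mult_bounded:
  assumes f: "L1_tendsto M F f"
    and b[measurable]: "\<And>k. b k \<in> borel_measurable M" and B[measurable]: "c \<in> borel_measurable M"
    and lim: "AE x in M. (\<lambda>k. b k x) \<longlonglongrightarrow> c x"
    and bnd: "\<And>k. AE x in M. \<bar>b k x\<bar> \<le> K"
  shows "L1_tendsto M (\<lambda>k x. b k x * F k x) (\<lambda>x. c x * f x)"
proof -
  note L = L1_tendstoD[OF f]
  have [measurable]: "f \<in> borel_measurable M" "\<And>k. F k \<in> borel_measurable M" using L by auto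
  have all: "AE x in M. \<forall>k. \<bar>b k x\<bar> \<le> K" using bnd by (simp add: AE_all_countable)
  have cK: "AE x in M. \<bar>c x\<bar> \<le> K"
    using lim all
  proof eventually_elim
    case (elim x)
    have "(\<lambda>k. \<bar>b k x\<bar>) \<longlonglongrightarrow> \<bar>c x\<bar>" by (intro tendsto_intros elim)
    then show ?case by (rule LIMSEQ_le_const2) (use elim in auto)
  qed
  have 1: "L1_tendsto M (\<lambda>k x. b k x * f x) (\<lambda>x. c x * f x)"
  proof (rule L1_tendsto_dominated[where h="\<lambda>k x. K * \<bar>f x\<bar>" and ?h0.0="\<lambda>x. K * \<bar>f x\<bar>"])
    show "AE x in M. (\<lambda>k. b k x * f x) \<longlonglongrightarrow> c x * f x"
      using lim by eventually_elim (intro tendsto_intros)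
    show "AE x in M. \<bar>b k x * f x\<bar> \<le> K * \<bar>f x\<bar>" for k
      using bnd[of k] by eventually_elim (simp add: abs_mult mult_right_mono)
    show "AE x in M. \<bar>c x * f x\<bar> \<le> K * \<bar>f x\<bar>"
      using cK by eventually_elim (simp add: abs_mult mult_right_mono)
  qed (auto intro!: L1_tendsto_const L(2))
  have ib: "integrable M (\<lambda>x. b k x * g x)" if g: "integrable M g" for k g
    by (rule Bochner_Integration.integrable_bound[of _ "\<lambda>x. K * g x"])
       (use g bnd[of k] in \<open>auto simp: abs_mult elim!: eventually_mono intro!: mult_right_mono\<close>)
  have 2: "L1_tendsto M (\<lambda>k x. b k x * (F k x - f x)) (\<lambda>x. 0)"
  proof (rule L1_tendsto_bound)
    show "AE x in M. \<bar>b k x * (F k x - f x) - 0\<bar> \<le> K * \<bar>F k x - f x\<bar>" for k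
      using bnd[of k] by eventually_elim (simp add: abs_mult mult_right_mono)
    show "(\<lambda>k. LINT x|M. K * \<bar>F k x - f x\<bar>) \<longlonglongrightarrow> 0"
      using tendsto_mult_left[OF L(3), of K] by simp
  qed (use L ib in auto)
  from L1_tendsto_add[OF 1 2] show ?thesis by (simp add: algebra_simps)
qed

lemma L1_tendsto_mult_bounded_const:
  assumes f: "L1_tendsto M F f"
    and b[measurable]: "b \<in> borel_measurable M" 
    and bnd: "AE x in M. \<bar>b x\<bar> \<le> K"
  shows "L1_tendsto M (\<lambda>k x. b x * F k x) (\<lambda>x. b x * f x)"
  by (rule L1_tendsto_mult_bounded[OF f b b _ bnd]) auto

section \<open>Mollification\<close>

text \<open>The profile \<open>(\<delta>\<^sup>2 - |z|\<^sup>2)\<^sub>+\<^sup>2\<close> is only of class \<open>C\<^sup>1\<close>, but this is all the smoothness that test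
  functions have here, and all its constants are explicit.\<close>

definition bump :: "real \<Rightarrow> 'b::euclidean_space \<Rightarrow> real" where
  "bump \<delta> z = (max 0 (\<delta>\<^sup>2 - z \<bullet> z))\<^sup>2"

definition bump_deriv :: "real \<Rightarrow> 'b::euclidean_space \<Rightarrow> 'b \<Rightarrow> real" where
  "bump_deriv \<delta> z h = - 4 * max 0 (\<delta>\<^sup>2 - z \<bullet> z) * (z \<bullet> h)"

lemma continuous_on_bump [continuous_intros]:
  "continuous_on S f \<Longrightarrow> continuous_on S (\<lambda>x. bump \<delta> (f x))"
  unfolding bump_def by (intro continuous_intros)

lemma continuous_on_bump_deriv:
  "continuous_on S f \<Longrightarrow> continuous_on S (\<lambda>x. bump_deriv \<delta> (f x) h)"
  unfolding bump_deriv_def by (intro continuous_intros)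

lemma bump_nonneg: "0 \<le> bump \<delta> z"
  by (simp add: bump_def)

lemma bump_zero: "0 \<le> \<delta> \<Longrightarrow> \<delta> \<le> norm z \<Longrightarrow> bump \<delta> z = 0"
  by (auto simp: bump_def max_def power2_norm_eq_inner[symmetric] power_mono)

lemma bump_nonzero: "norm z < \<delta> \<Longrightarrow> bump \<delta> z \<noteq> 0"
  using power_strict_mono[of "norm z" \<delta> 2] by (simp add: bump_def power2_norm_eq_inner)

lemma bump_deriv_zero: "0 \<le> \<delta> \<Longrightarrow> \<delta> \<le> norm z \<Longrightarrow> bump_deriv \<delta> z h = 0"
proof -
  assume "0 \<le> \<delta>" "\<delta> \<le> norm z"
  then have "\<delta>\<^sup>2 \<le> z \<bullet> z" by (metis power2_norm_eq_inner power_mono)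
  then show ?thesis by (simp add: bump_deriv_def)
qed

lemma bump_le: "bump \<delta> z \<le> \<delta>^4"
proof -
  have "(max 0 (\<delta>\<^sup>2 - z \<bullet> z))\<^sup>2 \<le> (\<delta>\<^sup>2)\<^sup>2"
    by (intro power_mono) auto
  then show ?thesis by (simp add: bump_def power_mult[symmetric])
qed

lemma bump_deriv_bound:
  assumes "0 \<le> \<delta>" shows "\<bar>bump_deriv \<delta> z h\<bar> \<le> 4 * \<delta>^3 * norm h"
proof (cases "\<delta> \<le> norm z")
  case True then show ?thesis using assms by (simp add: bump_deriv_zero)
next
  case False
  have "\<bar>bump_deriv \<delta> z h\<bar> = 4 * (max 0 (\<delta>\<^sup>2 - z \<bullet> z) * \<bar>z \<bullet> h\<bar>)"
    by (simp add: bump_deriv_def abs_mult)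
  also have "\<dots> \<le> 4 * (\<delta>\<^sup>2 * (\<delta> * norm h))"
  proof (intro mult_left_mono mult_mono)
    have "\<bar>z \<bullet> h\<bar> \<le> norm z * norm h" by (rule Cauchy_Schwarz_ineq2)
    also have "\<dots> \<le> \<delta> * norm h" using False by (intro mult_right_mono) auto
    finally show "\<bar>z \<bullet> h\<bar> \<le> \<delta> * norm h" .
  qed (use assms in auto)
  finally show ?thesis by (simp add: power2_eq_square power3_eq_cube ac_simps)
qed

text \<open>The function \<open>a \<mapsto> (a\<^sub>+)\<^sup>2\<close> has a Lipschitz continuous derivative, hence a quadratic Taylor remainder.\<close>

lemma sqr_pos_part_remainder:
  fixes a b :: real
  shows "\<bar>(max 0 b)\<^sup>2 - (max 0 a)\<^sup>2 - 2 * max 0 a * (b - a)\<bar> \<le> (b - a)\<^sup>2"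
proof -
  consider "0 \<le> a" "0 \<le> b" | "a < 0" "0 \<le> b" | "0 \<le> a" "b < 0" | "a < 0" "b < 0" by linarith
  then show ?thesis
  proof cases
    case 1
    then have "(max 0 b)\<^sup>2 - (max 0 a)\<^sup>2 - 2 * max 0 a * (b - a) = (b - a)\<^sup>2"
      by (simp add: power2_eq_square algebra_simps)
    then show ?thesis by simp
  next
    case 2
    then have "b\<^sup>2 \<le> (b - a)\<^sup>2" by (intro power_mono) auto
    then show ?thesis using 2 by simp
  next
    case 3
    have "(max 0 b)\<^sup>2 - (max 0 a)\<^sup>2 - 2 * max 0 a * (b - a) = a * a - 2 * a * b"
      using 3 by (simp add: power2_eq_square algebra_simps)
    moreover have "0 \<le> a * a - 2 * a * b"
      using 3 mult_nonneg_nonpos[of a b] zero_le_square[of a] by linarith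
    moreover have "a * a - 2 * a * b \<le> (b - a)\<^sup>2"
      by (simp add: power2_eq_square algebra_simps)
    ultimately show ?thesis by simp
  next
    case 4
    then show ?thesis by simp
  qed
qed

text \<open>The remainder is quadratic uniformly in \<open>z\<close>. Differentiation under an integral against an arbitrary
  integrable function then only costs its \<open>L\<^sup>1\<close> norm.\<close>

lemma bump_remainder:
  fixes z h :: "'b::euclidean_space"
  assumes d: "0 < \<delta>" and h: "norm h \<le> 1"
  shows "\<bar>bump \<delta> (z + h) - bump \<delta> z - bump_deriv \<delta> z h\<bar> \<le> ((2 * \<delta> + 3)\<^sup>2 + 2 * \<delta>\<^sup>2) * (norm h)\<^sup>2"
proof (cases "norm z \<le> \<delta> + 1")
  case False
  have "norm z \<le> norm (z + h) + norm h" by (metis add_diff_cancel_right' norm_triangle_sub norm_triangle_ineq4)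
  then have "\<delta> \<le> norm (z + h)" "\<delta> \<le> norm z" using False h by linarith+
  then show ?thesis using d by (simp add: bump_zero bump_deriv_zero)
next
  case True
  define a where "a = \<delta>\<^sup>2 - z \<bullet> z"
  define b where "b = \<delta>\<^sup>2 - (z + h) \<bullet> (z + h)"
  have ba: "b - a = - (2 * (z \<bullet> h) + h \<bullet> h)"
    by (simp add: a_def b_def inner_simps inner_commute)
  have "\<bar>b - a\<bar> \<le> 2 * (norm z * norm h) + norm h * norm h"
    using Cauchy_Schwarz_ineq2[of z h] unfolding ba
    by (simp add: power2_norm_eq_inner[symmetric] power2_eq_square[symmetric] abs_le_iff)
       (smt (verit) zero_le_power2)
  also have "\<dots> \<le> 2 * ((\<delta> + 1) * norm h) + 1 * norm h"
    using True h by (intro add_mono mult_left_mono mult_right_mono) auto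
  finally have 1: "\<bar>b - a\<bar> \<le> (2 * \<delta> + 3) * norm h" by (simp add: algebra_simps)
  have 2: "(b - a)\<^sup>2 \<le> (2 * \<delta> + 3)\<^sup>2 * (norm h)\<^sup>2"
    using power_mono[OF 1, of 2] by (simp add: power_mult_distrib)
  have 3: "max 0 a \<le> \<delta>\<^sup>2" "0 \<le> max 0 a" by (auto simp: a_def)
  have 4: "\<bar>2 * max 0 a * (h \<bullet> h)\<bar> \<le> 2 * \<delta>\<^sup>2 * (norm h)\<^sup>2"
    using 3 by (simp add: power2_norm_eq_inner mult_right_mono)
  have "bump \<delta> (z + h) - bump \<delta> z - bump_deriv \<delta> z h
      = ((max 0 b)\<^sup>2 - (max 0 a)\<^sup>2 - 2 * max 0 a * (b - a)) - 2 * max 0 a * (h \<bullet> h)"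
    unfolding bump_def bump_deriv_def a_def[symmetric] b_def[symmetric] ba
    by (simp add: algebra_simps)
  also have "\<bar>\<dots>\<bar> \<le> \<bar>(max 0 b)\<^sup>2 - (max 0 a)\<^sup>2 - 2 * max 0 a * (b - a)\<bar> + \<bar>2 * max 0 a * (h \<bullet> h)\<bar>"
    by (rule abs_triangle_ineq4)
  also have "\<dots> \<le> (2 * \<delta> + 3)\<^sup>2 * (norm h)\<^sup>2 + 2 * \<delta>\<^sup>2 * (norm h)\<^sup>2"
    using sqr_pos_part_remainder[of b a] 2 by (intro add_mono 4) linarith
  finally show ?thesis by (simp only: distrib_right)
qed

lemma bump_has_derivative:
  fixes z :: "'b::euclidean_space"
  assumes d: "0 < \<delta>"
  shows "(bump \<delta> has_derivative bump_deriv \<delta> z) (at z)"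
  unfolding has_derivative_at_alt
proof (intro conjI allI impI)
  show "bounded_linear (bump_deriv \<delta> z)"
    unfolding bump_deriv_def by (intro bounded_linear_const_mult bounded_linear_inner_right)
  fix e :: real assume e: "0 < e"
  define C where "C = (2 * \<delta> + 3)\<^sup>2 + 2 * \<delta>\<^sup>2"
  have C: "0 < C" using d by (auto simp: C_def intro!: add_pos_nonneg)
  show "\<exists>d'>0. \<forall>y. norm (y - z) < d' \<longrightarrow> norm (bump \<delta> y - bump \<delta> z - bump_deriv \<delta> z (y - z)) \<le> e * norm (y - z)"
  proof (intro exI[of _ "min 1 (e / C)"] conjI allI impI)
    fix y assume y: "norm (y - z) < min 1 (e / C)"
    have "norm (bump \<delta> y - bump \<delta> z - bump_deriv \<delta> z (y - z)) \<le> C * (norm (y - z))\<^sup>2"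
      using bump_remainder[OF d, of "y - z" z] y by (simp add: C_def)
    also have "\<dots> = (C * norm (y - z)) * norm (y - z)" by (simp add: power2_eq_square)
    also have "\<dots> \<le> e * norm (y - z)"
      using y C by (intro mult_right_mono) (auto simp: field_simps)
    finally show "norm (bump \<delta> y - bump \<delta> z - bump_deriv \<delta> z (y - z)) \<le> e * norm (y - z)" .
  qed (use e C in auto)
qed

lemma bump_reflect_has_derivative:
  assumes "0 < \<delta>"
  shows "((\<lambda>y. bump \<delta> (z - y)) has_derivative (\<lambda>h. - bump_deriv \<delta> (z - y) h)) (at y)"
proof -
  have "((\<lambda>y. bump \<delta> (z - y)) has_derivative (\<lambda>h. bump_deriv \<delta> (z - y) (- h))) (at y)"
    by (rule has_derivative_compose[of "\<lambda>y. z - y" "\<lambda>h. - h", OF _ bump_has_derivative[OF assms]])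
       (auto intro!: derivative_eq_intros)
  then show ?thesis by (simp add: bump_deriv_def)
qed

definition bump_mass :: "'b::euclidean_space itself \<Rightarrow> real \<Rightarrow> real" where
  "bump_mass _ \<delta> = (LINT y|lborel. bump \<delta> (y :: 'b))"

lemma integrable_bump: "0 < \<delta> \<Longrightarrow> integrable lborel (bump \<delta> :: 'b::euclidean_space \<Rightarrow> real)"
proof -
  assume d: "0 < \<delta>"
  have "integrable lborel (\<lambda>x. indicator (cball 0 \<delta>) x *\<^sub>R bump \<delta> (x::'b))"
    by (rule borel_integrable_compact) (auto intro!: continuous_intros)
  also have "(\<lambda>x. indicator (cball 0 \<delta>) x *\<^sub>R bump \<delta> (x::'b)) = bump \<delta>"
    using d by (auto simp: fun_eq_iff indicator_def bump_zero)
  finally show ?thesis .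
qed

text \<open>On the ball of half the radius the profile is at least half of its maximal value \<open>\<delta>\<^sup>4\<close>.\<close>

lemma bump_mass_lower:
  assumes d: "0 < \<delta>"
  shows "\<delta>^(4 + DIM('b)) * (unit_ball_vol (DIM('b)) / (2 * 2^DIM('b))) \<le> bump_mass TYPE('b::euclidean_space) \<delta>"
proof -
  have "(LINT y|lborel. indicator (cball (0::'b) (\<delta>/2)) y * (\<delta>^4 / 2)) \<le> bump_mass TYPE('b) \<delta>"
    unfolding bump_mass_def
  proof (rule integral_mono)
    show "integrable lborel (\<lambda>y. indicator (cball (0::'b) (\<delta>/2)) y * (\<delta>^4 / 2))"
      using emeasure_lborel_cball_finite[of "0::'b" "\<delta>/2"]
      by (intro integrable_mult_left integrable_real_indicator) auto
    fix y :: 'b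
    show "indicator (cball 0 (\<delta>/2)) y * (\<delta>^4 / 2) \<le> bump \<delta> y"
    proof (cases "norm y \<le> \<delta> / 2")
      case True
      then have "y \<bullet> y \<le> (\<delta>/2)\<^sup>2" using d by (metis norm_ge_zero power2_norm_eq_inner power_mono)
      then have "3/4 * \<delta>\<^sup>2 \<le> \<delta>\<^sup>2 - y \<bullet> y" by (simp add: power_divide)
      then have "3/4 * \<delta>\<^sup>2 \<le> max 0 (\<delta>\<^sup>2 - y \<bullet> y)" by (rule max.coboundedI2)
      then have "(3/4 * \<delta>\<^sup>2)\<^sup>2 \<le> bump \<delta> y" unfolding bump_def by (intro power_mono) auto
      then have "9/16 * \<delta>^4 \<le> bump \<delta> y" by (simp add: power_mult_distrib power_mult[symmetric] power_divide)
      moreover have "0 \<le> \<delta>^4" by simp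
      ultimately have "\<delta>^4/2 \<le> bump \<delta> y" by linarith
      then show ?thesis using True by simp
    qed (simp add: bump_nonneg)
  qed (use integrable_bump[OF d] in auto)
  also have "(LINT y|lborel. indicator (cball (0::'b) (\<delta>/2)) y * (\<delta>^4 / 2)) = measure lborel (cball (0::'b) (\<delta>/2)) * (\<delta>^4 / 2)"
    by simp
  also have "measure lborel (cball (0::'b) (\<delta>/2)) = unit_ball_vol (DIM('b)) * (\<delta>/2)^DIM('b)"
    using d by (intro content_cball) auto
  finally show ?thesis by (simp add: power_add power_divide field_simps)
qed

lemma bump_mass_pos: "0 < \<delta> \<Longrightarrow> 0 < bump_mass TYPE('b::euclidean_space) \<delta>"
proof -
  assume d: "0 < \<delta>"
  have "0 < \<delta>^(4 + DIM('b)) * (unit_ball_vol (DIM('b)) / (2 * 2^DIM('b)))"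
    using d by simp
  then show ?thesis using bump_mass_lower[OF d] by (rule less_le_trans)
qed

definition mollifier :: "real \<Rightarrow> 'b::euclidean_space \<Rightarrow> real" where
  "mollifier \<delta> z = bump \<delta> z / bump_mass TYPE('b) \<delta>"

definition mollify :: "real \<Rightarrow> ('b::euclidean_space \<Rightarrow> real) \<Rightarrow> 'b \<Rightarrow> real" where
  "mollify \<delta> f z = (LINT y|lebesgue. mollifier \<delta> (z - y) * f y)"

lemma mollifier_nonneg: "0 < \<delta> \<Longrightarrow> 0 \<le> mollifier \<delta> (z::'b::euclidean_space)"
  using bump_mass_pos[of \<delta>, where 'b='b] by (simp add: mollifier_def bump_nonneg)

lemma mollifier_zero: "0 < \<delta> \<Longrightarrow> \<delta> \<le> norm z \<Longrightarrow> mollifier \<delta> z = 0"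
  by (simp add: mollifier_def bump_zero)

lemma continuous_on_mollifier [continuous_intros]:
  "continuous_on S f \<Longrightarrow> continuous_on S (\<lambda>x. mollifier \<delta> (f x))"
  unfolding mollifier_def divide_inverse by (intro continuous_intros)

text \<open>The oscillation of a log-Hoelder exponent at distance \<open>\<delta>\<close> will absorb this growth, which is
  polynomial in \<open>1 / \<delta>\<close>.\<close>

lemma mollifier_bound:
  fixes z :: "'b::euclidean_space"
  assumes d: "0 < \<delta>"
  shows "mollifier \<delta> z \<le> (2 * 2^DIM('b)) / unit_ball_vol (DIM('b)) / \<delta>^DIM('b)"
proof -
  have "mollifier \<delta> z \<le> \<delta>^4 / (\<delta>^(4 + DIM('b)) * (unit_ball_vol (DIM('b)) / (2 * 2^DIM('b))))"
    unfolding mollifier_def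
    using d bump_le[of \<delta> z] bump_mass_lower[OF d, where 'b='b] by (intro frac_le) (auto intro!: mult_pos_pos)
  also have "\<dots> = (2 * 2^DIM('b)) / unit_ball_vol (DIM('b)) / \<delta>^DIM('b)"
    using d by (simp add: power_add)
  finally show ?thesis .
qed

lemma measurable_mollifier [measurable]: "mollifier \<delta> \<in> borel_measurable borel"
  by (intro borel_measurable_continuous_onI continuous_intros)

lemma nn_integral_mollifier:
  fixes y :: "'b::euclidean_space"
  assumes d: "0 < \<delta>"
  shows "(\<integral>\<^sup>+z. ennreal (mollifier \<delta> (z - y)) \<partial>lborel) = 1"
    "(\<integral>\<^sup>+z. ennreal (mollifier \<delta> (y - z)) \<partial>lborel) = 1"
proof -
  have 0: "(\<integral>\<^sup>+z. ennreal (mollifier \<delta> (z::'b)) \<partial>lborel) = 1"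
  proof -
    have "integrable lborel (mollifier \<delta> :: 'b \<Rightarrow> real)"
      unfolding mollifier_def using integrable_bump[OF d] by (intro integrable_divide)
    then have "(\<integral>\<^sup>+z. ennreal (mollifier \<delta> (z::'b)) \<partial>lborel) = ennreal (LINT z|lborel. mollifier \<delta> (z::'b))"
      by (intro nn_integral_eq_integral) (auto simp: mollifier_nonneg d)
    also have "(LINT z|lborel. mollifier \<delta> (z::'b)) = 1"
      using bump_mass_pos[OF d, where 'b='b] by (simp add: mollifier_def bump_mass_def)
    finally show ?thesis by simp
  qed
  have "(\<integral>\<^sup>+z. ennreal (mollifier \<delta> (z::'b)) \<partial>lborel) = (\<integral>\<^sup>+z. ennreal (mollifier \<delta> (z::'b)) \<partial>(distr lborel borel ((+) (-y))))"
    by (simp add: lborel_distr_plus)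
  also have "\<dots> = (\<integral>\<^sup>+z. ennreal (mollifier \<delta> (z - y)) \<partial>lborel)"
    by (subst nn_integral_distr) (auto simp: algebra_simps)
  finally show 1: "(\<integral>\<^sup>+z. ennreal (mollifier \<delta> (z - y)) \<partial>lborel) = 1" using 0 by simp
  have "mollifier \<delta> (z - y) = mollifier \<delta> (y - z)" for z
    by (simp add: mollifier_def bump_def inner_diff_left inner_diff_right inner_commute algebra_simps)
  then show "(\<integral>\<^sup>+z. ennreal (mollifier \<delta> (y - z)) \<partial>lborel) = 1" using 1 by simp
qed

lemma integrable_mult_bounded:
  fixes f b :: "'c \<Rightarrow> real"
  assumes f: "integrable M f" and b[measurable]: "b \<in> borel_measurable M" and B: "AE x in M. \<bar>b x\<bar> \<le> C"
  shows "integrable M (\<lambda>x. b x * f x)"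
proof (rule Bochner_Integration.integrable_bound[of _ "\<lambda>x. C * f x"])
  show "AE x in M. norm (b x * f x) \<le> norm (C * f x)"
    using B by eventually_elim (auto simp: abs_mult intro!: mult_right_mono)
qed (use f in auto)

lemma borel_measurable_lebesgueI: "f \<in> borel_measurable borel \<Longrightarrow> f \<in> borel_measurable lebesgue"
  by (rule measurable_completion) simp

lemma integrable_conv:
  fixes f :: "'b::euclidean_space \<Rightarrow> real"
  assumes f: "integrable lebesgue f" and K: "continuous_on UNIV K" and C: "\<And>z. \<bar>K z\<bar> \<le> C"
  shows "integrable lebesgue (\<lambda>y. K (z - y) * f y)"
proof (rule integrable_mult_bounded[OF f])
  have "continuous_on UNIV (\<lambda>y. K (z - y))"
    by (rule continuous_on_compose2[OF K]) (auto intro!: continuous_intros)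
  then show "(\<lambda>y. K (z - y)) \<in> borel_measurable lebesgue"
    by (intro borel_measurable_lebesgueI borel_measurable_continuous_onI)
qed (use C in auto)

lemma continuous_on_conv:
  fixes f :: "'b::euclidean_space \<Rightarrow> real"
  assumes f: "integrable lebesgue f" and K: "continuous_on UNIV K" and C: "\<And>z. \<bar>K z\<bar> \<le> C"
  shows "continuous_on UNIV (\<lambda>z. LINT y|lebesgue. K (z - y) * f y)"
  unfolding continuous_on_sequentially o_def
proof (intro ballI allI impI, elim conjE)
  fix z and w :: "nat \<Rightarrow> 'b" assume w: "w \<longlonglongrightarrow> z"
  have [measurable]: "f \<in> borel_measurable lebesgue" using f by auto
  note i = integrable_conv[OF f K C]
  show "(\<lambda>n. LINT y|lebesgue. K (w n - y) * f y) \<longlonglongrightarrow> (LINT y|lebesgue. K (z - y) * f y)"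
  proof (rule integral_dominated_convergence[where w="\<lambda>y. C * \<bar>f y\<bar>"])
    show "AE y in lebesgue. (\<lambda>n. K (w n - y) * f y) \<longlonglongrightarrow> K (z - y) * f y"
    proof (intro AE_I2 tendsto_mult tendsto_const)
      fix y
      show "(\<lambda>n. K (w n - y)) \<longlonglongrightarrow> K (z - y)"
        by (rule continuous_on_tendsto_compose[OF K]) (auto intro!: tendsto_intros w)
    qed
    show "AE y in lebesgue. norm (K (w n - y) * f y) \<le> C * \<bar>f y\<bar>" for n
      using C by (intro AE_I2) (simp add: abs_mult mult_right_mono)
  qed (intro borel_measurable_integrable i integrable_mult_right integrable_abs f)+
qed

lemma mollifier_abs_le:
  fixes z :: "'b::euclidean_space"
  assumes d: "0 < \<delta>"
  shows "\<bar>mollifier \<delta> z\<bar> \<le> \<delta>^4 / bump_mass TYPE('b) \<delta>"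
  using bump_le[of \<delta> z] bump_nonneg[of \<delta> z] bump_mass_pos[OF d, where 'b='b]
  by (simp add: mollifier_def divide_right_mono)

lemma integrable_mollify:
  "0 < \<delta> \<Longrightarrow> integrable lebesgue f \<Longrightarrow> integrable lebesgue (\<lambda>y. mollifier \<delta> (z - y) * f y)"
  by (rule integrable_conv[OF _ _ mollifier_abs_le]) (auto intro!: continuous_intros)

lemma continuous_on_mollify:
  "0 < \<delta> \<Longrightarrow> integrable lebesgue f \<Longrightarrow> continuous_on UNIV (mollify \<delta> f)"
  unfolding mollify_def[abs_def]
  by (rule continuous_on_conv[OF _ _ mollifier_abs_le]) (auto intro!: continuous_intros)

lemma measurable_mollify:
  "0 < \<delta> \<Longrightarrow> integrable lebesgue f \<Longrightarrow> mollify \<delta> f \<in> borel_measurable borel"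
  by (intro borel_measurable_continuous_onI continuous_on_mollify)

lemma mollify_has_derivative:
  fixes f :: "'b::euclidean_space \<Rightarrow> real"
  assumes d: "0 < \<delta>" and f: "integrable lebesgue f"
  shows "(mollify \<delta> f has_derivative
     (\<lambda>h. (LINT y|lebesgue. bump_deriv \<delta> (z - y) h * f y) / bump_mass TYPE('b) \<delta>)) (at z)"
proof -
  define c where "c = bump_mass TYPE('b) \<delta>"
  have c: "0 < c" unfolding c_def by (rule bump_mass_pos[OF d])
  have i: "integrable lebesgue (\<lambda>y. bump_deriv \<delta> (z - y) h * f y)" for z h
    by (rule integrable_conv[OF f _ bump_deriv_bound[where h=h]])
       (use d in \<open>auto intro!: continuous_on_bump_deriv continuous_intros\<close>)
  have ib: "integrable lebesgue (\<lambda>y. bump \<delta> (z - y) * f y)" for z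
    by (rule integrable_conv[OF f, of _ "\<delta>^4"])
       (auto intro!: continuous_intros simp: bump_le bump_nonneg)
  define I where "I z = (LINT y|lebesgue. bump \<delta> (z - y) * f y)" for z
  define D where "D h = (LINT y|lebesgue. bump_deriv \<delta> (z - y) h * f y)" for h
  define C where "C = (2 * \<delta> + 3)\<^sup>2 + 2 * \<delta>\<^sup>2"
  define N where "N = (LINT y|lebesgue. \<bar>f y\<bar>)"
  have N: "0 \<le> N" by (simp add: N_def)
  have C: "0 < C" using d by (auto simp: C_def intro!: add_pos_nonneg)
  have lin_add: "D (g + h) = D g + D h" for g h
  proof -
    have "D (g + h) = (LINT y|lebesgue. bump_deriv \<delta> (z - y) g * f y + bump_deriv \<delta> (z - y) h * f y)"
      unfolding D_def by (intro Bochner_Integration.integral_cong) (auto simp: bump_deriv_def inner_add_right algebra_simps)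
    then show ?thesis using i[of z g] i[of z h] by (simp add: D_def)
  qed
  have lin_sc: "D (r *\<^sub>R g) = r * D g" for r g
  proof -
    have "D (r *\<^sub>R g) = (LINT y|lebesgue. r * (bump_deriv \<delta> (z - y) g * f y))"
      unfolding D_def by (intro Bochner_Integration.integral_cong) (auto simp: bump_deriv_def)
    then show ?thesis by (simp add: D_def)
  qed
  have bl: "bounded_linear D"
    by (rule linear_conv_bounded_linear[THEN iffD1])
       (auto intro!: linearI simp: lin_add lin_sc)
  have "(I has_derivative D) (at z)"
    unfolding has_derivative_at_alt
  proof (intro conjI allI impI bl)
    fix e :: real assume e: "0 < e"
    show "\<exists>d'>0. \<forall>w. norm (w - z) < d' \<longrightarrow> norm (I w - I z - D (w - z)) \<le> e * norm (w - z)"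
    proof (intro exI[of _ "min 1 (e / (C * (N + 1)))"] conjI allI impI)
      fix w assume w: "norm (w - z) < min 1 (e / (C * (N + 1)))"
      define h where "h = w - z"
      have wh: "w = z + h" by (simp add: h_def)
      have "I w - I z - D h = (LINT y|lebesgue. (bump \<delta> (z - y + h) - bump \<delta> (z - y) - bump_deriv \<delta> (z - y) h) * f y)"
        unfolding I_def D_def
        using ib[of w] ib[of z] i[of z h]
        by (simp add: wh algebra_simps)
      also have "norm \<dots> \<le> (LINT y|lebesgue. C * (norm h)\<^sup>2 * \<bar>f y\<bar>)"
      proof (rule Bochner_Integration.integral_norm_bound_integral)
        have "integrable lebesgue (\<lambda>y. bump \<delta> (w - y) * f y - bump \<delta> (z - y) * f y - bump_deriv \<delta> (z - y) h * f y)"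
          using ib i by (intro Bochner_Integration.integrable_diff)
        then show "integrable lebesgue (\<lambda>y. (bump \<delta> (z - y + h) - bump \<delta> (z - y) - bump_deriv \<delta> (z - y) h) * f y)"
          by (simp add: wh algebra_simps)
        fix y
        have "norm h \<le> 1" using w by (simp add: h_def)
        from bump_remainder[OF d this, of "z - y"]
        show "norm ((bump \<delta> (z - y + h) - bump \<delta> (z - y) - bump_deriv \<delta> (z - y) h) * f y) \<le> C * (norm h)\<^sup>2 * \<bar>f y\<bar>"
          by (simp add: abs_mult C_def mult_right_mono)
      qed (use f in auto)
      also have "\<dots> = (C * N * norm h) * norm h" by (simp add: N_def power2_eq_square)
      also have "\<dots> \<le> e * norm h"
      proof (intro mult_right_mono)
        have "C * N * norm h \<le> C * (N + 1) * (e / (C * (N + 1)))"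
          using w C N by (intro mult_mono) (auto simp: h_def)
        then show "C * N * norm h \<le> e" using C N by simp
      qed simp
      finally show "norm (I w - I z - D (w - z)) \<le> e * norm (w - z)" by (simp add: h_def)
    qed (use e C N in auto)
  qed
  then have "((\<lambda>w. I w / c) has_derivative (\<lambda>h. D h / c)) (at z)"
    using c by (auto intro!: derivative_eq_intros)
  moreover have "mollify \<delta> f = (\<lambda>w. I w / c)"
    by (auto simp: fun_eq_iff mollify_def mollifier_def I_def c_def)
  ultimately show ?thesis by (simp add: D_def c_def)
qed

lemma frechet_derivative_mollify:
  fixes f :: "'b::euclidean_space \<Rightarrow> real"
  assumes d: "0 < \<delta>" and f: "integrable lebesgue f"
  shows "frechet_derivative (mollify \<delta> f) (at z) h =
     (LINT y|lebesgue. bump_deriv \<delta> (z - y) h * f y) / bump_mass TYPE('b) \<delta>"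
  using frechet_derivative_at[OF mollify_has_derivative[OF d f, of z]] by metis

lemma mollify_C1:
  fixes f :: "'b::euclidean_space \<Rightarrow> real"
  assumes d: "0 < \<delta>" and f: "integrable lebesgue f"
  shows "C1_fun (mollify \<delta> f)"
  unfolding C1_fun_def
proof (intro conjI allI)
  show "mollify \<delta> f differentiable at z" for z
    using mollify_has_derivative[OF d f, of z] differentiable_def by blast
  fix e :: 'b
  have "continuous_on UNIV (\<lambda>z. LINT y|lebesgue. bump_deriv \<delta> (z - y) e * f y)"
    by (rule continuous_on_conv[OF f _ bump_deriv_bound[where h=e]])
       (use d in \<open>auto intro!: continuous_on_bump_deriv continuous_intros\<close>)
  then show "continuous_on UNIV (\<lambda>z. frechet_derivative (mollify \<delta> f) (at z) e)"
    unfolding frechet_derivative_mollify[OF d f] divide_inverse by (intro continuous_intros)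
qed

lemma mollify_zero:
  assumes d: "0 < \<delta>" and f: "\<And>y. y \<in> ball z \<delta> \<Longrightarrow> f y = 0"
  shows "mollify \<delta> f z = 0"
proof -
  have "mollifier \<delta> (z - y) * f y = 0" for y
    using d f[of y] by (cases "norm (z - y) < \<delta>") (auto simp: mollifier_zero dist_norm)
  then have "(\<lambda>y. mollifier \<delta> (z - y) * f y) = (\<lambda>y. 0)" by (rule ext)
  then show ?thesis by (simp add: mollify_def)
qed

lemma mollify_cong_AE:
  assumes "AE y in lebesgue. f y = g y" "f \<in> borel_measurable lebesgue" "g \<in> borel_measurable lebesgue"
  shows "mollify \<delta> f z = mollify \<delta> g z"
proof -
  have [measurable]: "(\<lambda>y. mollifier \<delta> (z - y)) \<in> borel_measurable lebesgue"
    by (intro borel_measurable_lebesgueI) measurable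
  note [measurable] = assms(2,3)
  show ?thesis unfolding mollify_def
    by (rule integral_cong_AE) (use assms(1) in \<open>auto elim!: eventually_mono\<close>)
qed

lemma integrable_mollifier_lebesgue:
  assumes d: "0 < \<delta>"
  shows "has_bochner_integral lebesgue (\<lambda>y. mollifier \<delta> (z - y :: 'b::euclidean_space)) 1"
proof (rule has_bochner_integral_nn_integral)
  show "(\<lambda>y. mollifier \<delta> (z - y)) \<in> borel_measurable lebesgue"
    by (intro borel_measurable_lebesgueI) measurable
  show "(\<integral>\<^sup>+y. ennreal (mollifier \<delta> (z - y)) \<partial>lebesgue) = ennreal 1"
    by (simp add: nn_integral_completion nn_integral_mollifier[OF d])
qed (auto simp: mollifier_nonneg d)

lemma mollify_diff:
  assumes d: "0 < \<delta>" and f: "integrable lebesgue f" "integrable lebesgue g"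
  shows "mollify \<delta> (\<lambda>y. f y - g y) z = mollify \<delta> f z - mollify \<delta> g z"
  unfolding mollify_def
  using integrable_mollify[OF d f(1), of z] integrable_mollify[OF d f(2), of z]
  by (simp add: algebra_simps)

text \<open>A mollification is an average over a ball, so a bound for the deviation from a constant on this ball
  is inherited. The constant \<open>0\<close> gives the bound for the supremum.\<close>

lemma mollify_close:
  assumes d: "0 < \<delta>" and f: "integrable lebesgue f" and B: "\<And>y. y \<in> ball z \<delta> \<Longrightarrow> \<bar>f y - c\<bar> \<le> B"
  shows "\<bar>mollify \<delta> f z - c\<bar> \<le> B"
proof -
  note m = integrable_mollifier_lebesgue[OF d, of z]
  have m': "integrable lebesgue (\<lambda>y. mollifier \<delta> (z - y))" "(LINT y|lebesgue. mollifier \<delta> (z - y)) = 1"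
    using m by (auto simp: has_bochner_integral_iff)
  note i = integrable_mollify[OF d f, of z]
  have "mollify \<delta> f z - c = (LINT y|lebesgue. mollifier \<delta> (z - y) * (f y - c))"
    using i m' by (simp add: mollify_def right_diff_distrib)
  also have "norm \<dots> \<le> (LINT y|lebesgue. B * mollifier \<delta> (z - y))"
  proof (rule Bochner_Integration.integral_norm_bound_integral)
    show "integrable lebesgue (\<lambda>y. mollifier \<delta> (z - y) * (f y - c))"
      using i m' by (simp add: right_diff_distrib)
    show "integrable lebesgue (\<lambda>y. B * mollifier \<delta> (z - y))"
      using m' by simp
    show "norm (mollifier \<delta> (z - y) * (f y - c)) \<le> B * mollifier \<delta> (z - y)" for y
    proof (cases "norm (z - y) < \<delta>")
      case True
      then have "y \<in> ball z \<delta>" by (simp add: dist_norm)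
      from mult_right_mono[OF B[OF this] mollifier_nonneg[OF d, of "z - y"]]
      show ?thesis
        by (simp add: abs_mult mollifier_nonneg[OF d] mult.commute[of "mollifier \<delta> (z - y)"])
    qed (use d in \<open>simp add: mollifier_zero\<close>)
  qed
  also have "\<dots> = B" using m' by simp
  finally show ?thesis by simp
qed

text \<open>This is Tonelli's theorem. The completed measure on pairs is not a product measure, therefore the
  function is first replaced by a Borel measurable one.\<close>

lemma nn_integral_mollify_le:
  fixes f :: "'b::euclidean_space \<Rightarrow> real"
  assumes d: "0 < \<delta>" and f: "integrable lebesgue f"
  shows "(\<integral>\<^sup>+z. ennreal \<bar>mollify \<delta> f z\<bar> \<partial>lebesgue) \<le> (\<integral>\<^sup>+y. ennreal \<bar>f y\<bar> \<partial>lebesgue)"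
proof -
  obtain g where [measurable]: "g \<in> borel_measurable lborel" and fg: "AE y in lborel. f y = g y"
    using completion_ex_borel_measurable_real[of f lborel] f by auto
  have fg': "AE y in lebesgue. f y = g y" using fg by (rule AE_completion)
  have gm: "g \<in> borel_measurable lebesgue"
    by (rule borel_measurable_lebesgueI) measurable
  have g: "integrable lebesgue g"
    using gm f fg' by (subst integrable_cong_AE[of g _ f]) (auto elim!: eventually_mono)
  have "(\<integral>\<^sup>+z. ennreal \<bar>mollify \<delta> f z\<bar> \<partial>lebesgue) \<le> (\<integral>\<^sup>+z. (\<integral>\<^sup>+y. ennreal (mollifier \<delta> (z - y) * \<bar>g y\<bar>) \<partial>lborel) \<partial>lborel)"
    unfolding nn_integral_completion
  proof (rule nn_integral_mono)
    fix z
    have "mollify \<delta> f z = mollify \<delta> g z"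
      using fg' f gm by (intro mollify_cong_AE) auto
    then have "ennreal \<bar>mollify \<delta> f z\<bar> = ennreal (norm (LINT y|lebesgue. mollifier \<delta> (z - y) * g y))" by (simp add: mollify_def)
    also have "\<dots> \<le> (\<integral>\<^sup>+y. ennreal (norm (mollifier \<delta> (z - y) * g y)) \<partial>lebesgue)"
      by (rule integral_norm_bound_ennreal[OF integrable_mollify[OF d g]])
    also have "\<dots> = (\<integral>\<^sup>+y. ennreal (mollifier \<delta> (z - y) * \<bar>g y\<bar>) \<partial>lborel)"
      by (simp add: nn_integral_completion abs_mult mollifier_nonneg[OF d])
    finally show "ennreal \<bar>mollify \<delta> f z\<bar> \<le> \<dots>" .
  qed
  also have "\<dots> = (\<integral>\<^sup>+y. (\<integral>\<^sup>+z. ennreal (mollifier \<delta> (z - y) * \<bar>g y\<bar>) \<partial>lborel) \<partial>lborel)"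
    by (rule lborel_pair.Fubini') measurable
  also have "\<dots> = (\<integral>\<^sup>+y. ennreal \<bar>g y\<bar> \<partial>lborel)"
  proof (rule nn_integral_cong)
    fix y
    have "(\<integral>\<^sup>+z. ennreal (mollifier \<delta> (z - y) * \<bar>g y\<bar>) \<partial>lborel) = (\<integral>\<^sup>+z. ennreal (mollifier \<delta> (z - y)) * ennreal \<bar>g y\<bar> \<partial>lborel)"
      by (intro nn_integral_cong) (simp add: ennreal_mult mollifier_nonneg[OF d])
    also have "\<dots> = ennreal \<bar>g y\<bar>"
      by (subst nn_integral_multc) (auto simp: nn_integral_mollifier[OF d])
    finally show "(\<integral>\<^sup>+z. ennreal (mollifier \<delta> (z - y) * \<bar>g y\<bar>) \<partial>lborel) = ennreal \<bar>g y\<bar>" .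
  qed
  also have "\<dots> = (\<integral>\<^sup>+y. ennreal \<bar>f y\<bar> \<partial>lebesgue)"
    unfolding nn_integral_completion by (rule nn_integral_cong_AE) (use fg in \<open>auto elim!: eventually_mono\<close>)
  finally show ?thesis .
qed

lemma mollify_integrable:
  fixes f :: "'b::euclidean_space \<Rightarrow> real"
  assumes d: "0 < \<delta>" and f: "integrable lebesgue f"
  shows "integrable lebesgue (mollify \<delta> f)"
    and "(LINT z|lebesgue. \<bar>mollify \<delta> f z\<bar>) \<le> (LINT z|lebesgue. \<bar>f z\<bar>)"
proof -
  have fin: "(\<integral>\<^sup>+y. ennreal \<bar>f y\<bar> \<partial>lebesgue) = ennreal (LINT z|lebesgue. \<bar>f z\<bar>)"
    using f by (intro nn_integral_eq_integral) auto
  have m: "mollify \<delta> f \<in> borel_measurable lebesgue"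
    by (intro borel_measurable_lebesgueI measurable_mollify d f)
  show i: "integrable lebesgue (mollify \<delta> f)"
  proof (rule integrableI_bounded[OF m])
    have "(\<integral>\<^sup>+z. ennreal (norm (mollify \<delta> f z)) \<partial>lebesgue) \<le> ennreal (LINT z|lebesgue. \<bar>f z\<bar>)"
      using nn_integral_mollify_le[OF d f] unfolding fin by simp
    then show "(\<integral>\<^sup>+z. ennreal (norm (mollify \<delta> f z)) \<partial>lebesgue) < \<infinity>"
      using le_less_trans ennreal_less_top by (metis infinity_ennreal_def)
  qed
  have "(\<integral>\<^sup>+z. ennreal \<bar>mollify \<delta> f z\<bar> \<partial>lebesgue) = ennreal (LINT z|lebesgue. \<bar>mollify \<delta> f z\<bar>)"
    using i by (intro nn_integral_eq_integral) auto
  then show "(LINT z|lebesgue. \<bar>mollify \<delta> f z\<bar>) \<le> (LINT z|lebesgue. \<bar>f z\<bar>)"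
    using nn_integral_mollify_le[OF d f] unfolding fin by simp
qed

text \<open>Truncating values and domain approximates \<open>f\<close> in mean by a bounded function \<open>F k\<close> of bounded
  support. A measurable function is almost everywhere a limit of continuous ones; the same truncation
  of these has a fixed integrable majorant and converges to \<open>F k\<close>.\<close>

lemma integrable_approx_continuous:
  fixes f :: "'b::euclidean_space \<Rightarrow> real"
  assumes f: "integrable lebesgue f" and e: "0 < e"
  obtains g R where "continuous_on UNIV g" "0 < R" "\<And>z. R \<le> norm z \<Longrightarrow> g z = 0"
    "integrable lebesgue g" "(LINT z|lebesgue. \<bar>f z - g z\<bar>) < e"
proof -
  have fm [measurable]: "f \<in> borel_measurable lebesgue" using f by auto
  define cl where "cl k y = max (- real k) (min (real k) y)" for k :: nat and y :: real
  define cut where "cut k x = max 0 (min 1 (real k + 1 - norm x))" for k :: nat and x :: 'b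
  have cutc: "continuous_on UNIV (cut k)" for k unfolding cut_def by (intro continuous_intros)
  have clc: "continuous_on UNIV (cl k)" for k unfolding cl_def by (intro continuous_intros)
  have [measurable]: "cut k \<in> borel_measurable lebesgue" for k
    by (intro borel_measurable_lebesgueI borel_measurable_continuous_onI cutc)
  have [measurable]: "cl k \<in> borel_measurable borel" for k
    by (intro borel_measurable_continuous_onI clc)
  have cut01: "0 \<le> cut k x" "cut k x \<le> 1" for k x by (auto simp: cut_def)
  have cl1: "\<bar>cl k y\<bar> \<le> \<bar>y\<bar>" "\<bar>cl k y\<bar> \<le> real k" for k y by (auto simp: cl_def)
  define F where "F k x = cut k x * cl k (f x)" for k x
  have L1: "L1_tendsto lebesgue F f"
  proof (rule L1_tendsto_dominated[where h="\<lambda>k x. \<bar>f x\<bar>" and ?h0.0="\<lambda>x. \<bar>f x\<bar>"])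
    show "AE x in lebesgue. (\<lambda>k. F k x) \<longlonglongrightarrow> f x"
    proof (intro AE_I2 tendsto_eventually)
      fix x
      obtain n where n: "norm x + \<bar>f x\<bar> < real n" using reals_Archimedean2 by blast
      show "\<forall>\<^sub>F k in sequentially. F k x = f x"
        using eventually_ge_at_top[of n]
      proof eventually_elim
        case (elim k)
        then have "real n \<le> real k" by simp
        then have "norm x + \<bar>f x\<bar> < real k" using n by linarith
        then have "cut k x = 1" "cl k (f x) = f x"
          unfolding cut_def cl_def using norm_ge_zero[of x] by linarith+
        then show ?case by (simp add: F_def)
      qed
    qed
    show "AE x in lebesgue. \<bar>F k x\<bar> \<le> \<bar>f x\<bar>" for k
    proof (rule AE_I2)
      fix x show "\<bar>F k x\<bar> \<le> \<bar>f x\<bar>"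
        using mult_mono[OF cut01(2)[of k x] cl1(1)[of k "f x"]] cut01[of k x] by (simp add: F_def abs_mult)
    qed
    show "L1_tendsto lebesgue (\<lambda>k x. \<bar>f x\<bar>) (\<lambda>x. \<bar>f x\<bar>)" using f by (intro L1_tendsto_const) auto
  qed (auto simp: F_def[abs_def])
  from order_tendstoD(2)[OF L1_tendstoD(3)[OF L1], of "e/2"] e
  obtain k where k: "(LINT x|lebesgue. \<bar>F k x - f x\<bar>) < e/2"
    by (auto simp: eventually_sequentially)
  obtain N g where N: "negligible N" and g: "\<And>n. continuous_on UNIV (g n :: 'b \<Rightarrow> real)"
    and lim: "\<And>x. x \<notin> N \<Longrightarrow> (\<lambda>n. g n x) \<longlonglongrightarrow> f x"
    using lebesgue_measurable_imp_measurable_on[OF fm, of UNIV] unfolding measurable_on_def by auto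
  define G where "G n x = cut k x * cl k (g n x)" for n x
  have Gc: "continuous_on UNIV (G n)" for n
    unfolding G_def by (intro continuous_intros cutc continuous_on_compose2[OF clc g]) auto
  have Gz: "G n z = 0" if "real k + 1 \<le> norm z" for n z
    using that by (simp add: G_def cut_def)
  have L2: "L1_tendsto lebesgue G (F k)"
  proof (rule L1_tendsto_dominated[where h="\<lambda>_ x. real k * indicator (cball 0 (real k + 1)) x"
        and ?h0.0="\<lambda>x. real k * indicator (cball 0 (real k + 1)) x"])
    show "G n \<in> borel_measurable lebesgue" for n
      by (intro borel_measurable_lebesgueI borel_measurable_continuous_onI Gc)
    have "AE x in lebesgue. x \<notin> N" using N by (simp add: negligible_iff_null_sets AE_not_in)
    then show "AE x in lebesgue. (\<lambda>n. G n x) \<longlonglongrightarrow> F k x"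
    proof eventually_elim
      case (elim x)
      show ?case unfolding G_def F_def
        by (intro tendsto_intros continuous_on_tendsto_compose[OF clc] lim elim) auto
    qed
    have b: "\<bar>cut k x * cl k y\<bar> \<le> real k * indicator (cball 0 (real k + 1)) x" for x y
      using mult_mono[OF cut01(2)[of k x] cl1(2)[of k y]] cut01[of k x]
      by (auto simp: abs_mult indicator_def cut_def)
    show "AE x in lebesgue. \<bar>G n x\<bar> \<le> real k * indicator (cball 0 (real k + 1)) x" for n
      unfolding G_def using b by simp
    show "AE x in lebesgue. \<bar>F k x\<bar> \<le> real k * indicator (cball 0 (real k + 1)) x"
      unfolding F_def using b by simp
    show "L1_tendsto lebesgue (\<lambda>_ x. real k * indicator (cball (0::'b) (real k + 1)) x) (\<lambda>x. real k * indicator (cball 0 (real k + 1)) x)"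
      using emeasure_lborel_cball_finite[of "0::'b" "real k + 1"]
      by (intro L1_tendsto_const integrable_mult_right integrable_real_indicator) auto
  qed (auto simp: F_def[abs_def])
  from order_tendstoD(2)[OF L1_tendstoD(3)[OF L2], of "e/2"] e
  obtain n where n: "(LINT x|lebesgue. \<bar>G n x - F k x\<bar>) < e/2"
    by (auto simp: eventually_sequentially)
  have "(LINT x|lebesgue. \<bar>f x - G n x\<bar>) \<le> (LINT x|lebesgue. \<bar>F k x - f x\<bar> + \<bar>G n x - F k x\<bar>)"
    using L1_tendstoD[OF L1] L1_tendstoD[OF L2] by (intro integral_mono) auto
  also have "\<dots> = (LINT x|lebesgue. \<bar>F k x - f x\<bar>) + (LINT x|lebesgue. \<bar>G n x - F k x\<bar>)"
    using L1_tendstoD[OF L1] L1_tendstoD[OF L2] by (intro Bochner_Integration.integral_add) auto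
  also have "\<dots> < e" using k n by simp
  finally show ?thesis
    using Gz[of _ n] by (intro that[OF Gc, of "real k + 1" n] L1_tendstoD[OF L2]) auto
qed

text \<open>For a continuous function of bounded support the convergence is uniform. The general case follows by
  approximation, because mollification does not increase the \<open>L\<^sup>1\<close> norm of the error.\<close>

lemma mollify_L1_tendsto:
  fixes f :: "'b::euclidean_space \<Rightarrow> real"
  assumes f: "integrable lebesgue f" and d: "\<And>j. 0 < \<delta> j" "\<delta> \<longlonglongrightarrow> 0"
  shows "L1_tendsto lebesgue (\<lambda>j. mollify (\<delta> j) f) f"
  unfolding L1_tendsto_def
proof (intro conjI allI mollify_integrable d f)
  show "(\<lambda>j. LINT x|lebesgue. \<bar>mollify (\<delta> j) f x - f x\<bar>) \<longlonglongrightarrow> 0"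
  proof (rule order_tendstoI)
    fix e :: real assume e: "0 < e"
    obtain g R where g: "continuous_on UNIV g" and R: "0 < R" "\<And>z. R \<le> norm z \<Longrightarrow> g z = 0"
      and gi: "integrable lebesgue g" and fg: "(LINT z|lebesgue. \<bar>f z - g z\<bar>) < e/3"
      using integrable_approx_continuous[OF f, of "e/3"] e by auto
    define V where "V = measure lebesgue (cball (0::'b) (R + 1))"
    define e' where "e' = e / (3 * (V + 1))"
    have V: "0 \<le> V" by (simp add: V_def)
    have e': "0 < e'" using e V by (simp add: e'_def)
    have "uniformly_continuous_on (cball 0 (R + 2)) g"
      by (rule compact_uniformly_continuous[OF continuous_on_subset[OF g]]) auto
    from uniformly_continuous_onE[OF this e'] obtain d' where d': "d' > 0"
      "\<And>x y. \<lbrakk>x \<in> cball 0 (R + 2); y \<in> cball 0 (R + 2); dist y x < d'\<rbrakk> \<Longrightarrow> dist (g y) (g x) < e'" by blast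
    have "\<forall>\<^sub>F j in sequentially. \<delta> j < min 1 d'"
      using order_tendstoD(2)[OF d(2), of "min 1 d'"] d' by auto
    then show "\<forall>\<^sub>F j in sequentially. (LINT x|lebesgue. \<bar>mollify (\<delta> j) f x - f x\<bar>) < e"
    proof eventually_elim
      case (elim j)
      let ?d = "\<delta> j"
      have dj: "0 < ?d" by (rule d)
      have pw: "\<bar>mollify ?d g z - g z\<bar> \<le> e' * indicator (cball 0 (R + 1)) z" for z
      proof (cases "norm z \<le> R + 1")
        case True
        have "\<bar>mollify ?d g z - g z\<bar> \<le> e'"
        proof (rule mollify_close[OF dj gi])
          fix y assume y: "y \<in> ball z ?d"
          have "norm y \<le> norm z + dist z y" by (metis dist_norm norm_minus_commute norm_triangle_sub)
          then have "dist (g y) (g z) < e'" using y True elim by (intro d') (auto simp: dist_commute)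
          then show "\<bar>g y - g z\<bar> \<le> e'" by (simp add: dist_real_def)
        qed
        then show ?thesis using True by simp
      next
        case False
        have "mollify ?d g z = 0"
        proof (rule mollify_zero[OF dj])
          fix y assume y: "y \<in> ball z ?d"
          have "norm z \<le> norm y + dist z y" by (metis dist_norm norm_triangle_sub)
          then show "g y = 0" using y False elim by (intro R) auto
        qed
        then show ?thesis using R(2)[of z] False by simp
      qed
      note mi = mollify_integrable[OF dj]
      have fgi: "integrable lebesgue (\<lambda>x. f x - g x)" using f gi by simp
      have gm: "(LINT x|lebesgue. \<bar>mollify ?d g x - g x\<bar>) \<le> (LINT x|lebesgue. e' * indicator (cball (0::'b) (R + 1)) x)"
        using emeasure_lborel_cball_finite[of "0::'b" "R + 1"] pw gi mi(1)[OF gi]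
        by (intro integral_mono integrable_mult_right integrable_real_indicator) auto
      also have "\<dots> = e' * V" by (simp add: V_def)
      also have "\<dots> \<le> e / 3" using e V by (simp add: e'_def field_simps)
      finally have gm: "(LINT x|lebesgue. \<bar>mollify ?d g x - g x\<bar>) \<le> e / 3" .
      have "(LINT x|lebesgue. \<bar>mollify ?d f x - f x\<bar>)
        \<le> (LINT x|lebesgue. \<bar>mollify ?d (\<lambda>y. f y - g y) x\<bar> + \<bar>mollify ?d g x - g x\<bar> + \<bar>f x - g x\<bar>)"
        using f gi mi[OF f] mi[OF gi] mi[OF fgi]
        by (intro integral_mono) (auto simp: mollify_diff[OF dj f gi])
      also have "\<dots> = (LINT x|lebesgue. \<bar>mollify ?d (\<lambda>y. f y - g y) x\<bar>) + (LINT x|lebesgue. \<bar>mollify ?d g x - g x\<bar>) + (LINT x|lebesgue. \<bar>f x - g x\<bar>)"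
        using f gi mi[OF f] mi[OF gi] mi[OF fgi] by simp
      also have "\<dots> < e" using mi(2)[OF fgi] gm fg by linarith
      finally show ?case .
    qed
  next
    fix e :: real assume "e < 0"
    moreover have "0 \<le> (LINT x|lebesgue. \<bar>mollify (\<delta> j) f x - f x\<bar>)" for j by simp
    ultimately show "\<forall>\<^sub>F j in sequentially. e < (LINT x|lebesgue. \<bar>mollify (\<delta> j) f x - f x\<bar>)"
      by (intro always_eventually allI) (rule less_le_trans)
  qed
qed

section \<open>Continuously differentiable test functions\<close>

lemma C1_fun_has_derivative: "C1_fun \<phi> \<Longrightarrow> (\<phi> has_derivative frechet_derivative \<phi> (at z)) (at z)"
  by (simp add: C1_fun_def frechet_derivative_works)

lemma C1_fun_continuous: "C1_fun \<phi> \<Longrightarrow> continuous_on S \<phi>"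
  unfolding C1_fun_def using differentiable_imp_continuous_within
  by (metis continuous_at_imp_continuous_on)

lemma C1_fun_continuous_deriv: "C1_fun \<phi> \<Longrightarrow> continuous_on S (\<lambda>z. frechet_derivative \<phi> (at z) e)"
  unfolding C1_fun_def using continuous_on_subset by blast

lemma C1_funI:
  assumes "\<And>z. (\<phi> has_derivative D z) (at z)" "\<And>e. continuous_on UNIV (\<lambda>z. D z e)"
  shows "C1_fun \<phi>" "frechet_derivative \<phi> (at z) e = D z e"
proof -
  have eq: "frechet_derivative \<phi> (at z) = D z" for z
    using frechet_derivative_at[OF assms(1)[of z]] by simp
  then show "frechet_derivative \<phi> (at z) e = D z e" by simp
  show "C1_fun \<phi>" unfolding C1_fun_def eq using assms differentiable_def by blast
qed

lemma C1_fun_measurable: "C1_fun \<phi> \<Longrightarrow> \<phi> \<in> borel_measurable borel"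
  by (intro borel_measurable_continuous_onI C1_fun_continuous)

lemma C1_fun_measurable_deriv: "C1_fun \<phi> \<Longrightarrow> (\<lambda>z. frechet_derivative \<phi> (at z) e) \<in> borel_measurable borel"
  by (intro borel_measurable_continuous_onI C1_fun_continuous_deriv)

lemma C1_fun_mult:
  assumes "C1_fun \<phi>" "C1_fun \<psi>"
  shows "C1_fun (\<lambda>z. \<phi> z * \<psi> z)"
    "frechet_derivative (\<lambda>z. \<phi> z * \<psi> z) (at z) e
       = \<phi> z * frechet_derivative \<psi> (at z) e + frechet_derivative \<phi> (at z) e * \<psi> z"
proof -
  have d: "((\<lambda>z. \<phi> z * \<psi> z) has_derivative
     (\<lambda>e. \<phi> z * frechet_derivative \<psi> (at z) e + frechet_derivative \<phi> (at z) e * \<psi> z)) (at z)" for z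
    using has_derivative_mult[OF C1_fun_has_derivative[OF assms(1)] C1_fun_has_derivative[OF assms(2)], of z] by simp
  have c: "continuous_on UNIV (\<lambda>z. \<phi> z * frechet_derivative \<psi> (at z) e + frechet_derivative \<phi> (at z) e * \<psi> z)" for e
    by (intro continuous_intros C1_fun_continuous C1_fun_continuous_deriv assms)
  show "C1_fun (\<lambda>z. \<phi> z * \<psi> z)" by (rule C1_funI(1)[OF d c])
  show "frechet_derivative (\<lambda>z. \<phi> z * \<psi> z) (at z) e
       = \<phi> z * frechet_derivative \<psi> (at z) e + frechet_derivative \<phi> (at z) e * \<psi> z"
    by (rule C1_funI(2)[OF d c])
qed

lemma C1_fun_compose:
  assumes \<phi>: "C1_fun \<phi>" and H: "\<And>s. (H has_real_derivative H' s) (at s)" "continuous_on UNIV H'"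
  shows "C1_fun (\<lambda>z. H (\<phi> z))"
    "frechet_derivative (\<lambda>z. H (\<phi> z)) (at z) e = H' (\<phi> z) * frechet_derivative \<phi> (at z) e"
proof -
  have d: "((\<lambda>z. H (\<phi> z)) has_derivative (\<lambda>e. H' (\<phi> z) * frechet_derivative \<phi> (at z) e)) (at z)" for z
    using has_derivative_compose[OF C1_fun_has_derivative[OF \<phi>, of z] H(1)[THEN has_field_derivative_imp_has_derivative]]
    by (simp add: o_def)
  have c: "continuous_on UNIV (\<lambda>z. H' (\<phi> z) * frechet_derivative \<phi> (at z) e)" for e
    by (intro continuous_intros continuous_on_compose2[OF H(2)] C1_fun_continuous C1_fun_continuous_deriv \<phi>) auto
  show "C1_fun (\<lambda>z. H (\<phi> z))" by (rule C1_funI(1)[OF d c])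
  show "frechet_derivative (\<lambda>z. H (\<phi> z)) (at z) e = H' (\<phi> z) * frechet_derivative \<phi> (at z) e"
    by (rule C1_funI(2)[OF d c])
qed

lemma C01_D:
  assumes "\<phi> \<in> C01 Q"
  shows "C1_fun \<phi>" "compact (closure {z. \<phi> z \<noteq> 0})" "closure {z. \<phi> z \<noteq> 0} \<subseteq> Q"
  using assms by (auto simp: C01_def)

lemma C01_I:
  assumes "C1_fun \<phi>" "compact K" "K \<subseteq> Q" "\<And>z. z \<notin> K \<Longrightarrow> \<phi> z = 0"
  shows "\<phi> \<in> C01 Q"
proof -
  have "closure {z. \<phi> z \<noteq> 0} \<subseteq> K"
    using assms(2,4) by (intro closure_minimal compact_imp_closed) auto
  moreover have "compact (closure {z. \<phi> z \<noteq> 0})"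
    using assms(2) calculation by (meson bounded_subset closed_closure compact_eq_bounded_closed)
  ultimately show ?thesis
    using assms(1,3) unfolding C01_def by auto
qed

lemma deriv_zero_outside_support:
  assumes "z \<notin> closure {z. \<phi> z \<noteq> 0}"
  shows "frechet_derivative \<phi> (at z) e = 0"
proof -
  have "((\<lambda>z. 0) has_derivative (\<lambda>h. 0)) (at z)" by simp
  then have "(\<phi> has_derivative (\<lambda>h. 0)) (at z)"
  proof (rule has_derivative_transform_within_open)
    show "open (- closure {z. \<phi> z \<noteq> 0})" by auto
    fix x assume "x \<in> - closure {z. \<phi> z \<noteq> 0}"
    then show "0 = \<phi> x" using closure_subset[of "{z. \<phi> z \<noteq> 0}"] by auto
  qed (use assms in auto)
  from frechet_derivative_at[OF this, symmetric] show ?thesis by simp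
qed

lemma bounded_compact_support:
  fixes f :: "'b::euclidean_space \<Rightarrow> real"
  assumes "continuous_on UNIV f" "compact K" "\<And>z. z \<notin> K \<Longrightarrow> f z = 0"
  obtains B where "0 \<le> B" "\<And>z. \<bar>f z\<bar> \<le> B"
proof -
  have "bounded (f ` K)"
    using assms(1,2) by (intro compact_imp_bounded compact_continuous_image continuous_on_subset[OF assms(1)]) auto
  then obtain B where B: "\<And>z. z \<in> K \<Longrightarrow> \<bar>f z\<bar> \<le> B" unfolding bounded_iff by auto
  have "\<bar>f z\<bar> \<le> max B 0" for z using B[of z] assms(3)[of z] by (cases "z \<in> K") auto
  then show ?thesis by (intro that[of "max B 0"]) auto
qed

lemma C01_support:
  assumes "\<phi> \<in> C01 Q"
  obtains K where "compact K" "K \<subseteq> Q" "\<And>z. z \<notin> K \<Longrightarrow> \<phi> z = 0"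
    "\<And>z e. z \<notin> K \<Longrightarrow> frechet_derivative \<phi> (at z) e = 0"
proof (rule that[of "closure {z. \<phi> z \<noteq> 0}"])
  show "z \<notin> closure {z. \<phi> z \<noteq> 0} \<Longrightarrow> \<phi> z = 0" for z
    using closure_subset[of "{z. \<phi> z \<noteq> 0}"] by auto
qed (use C01_D(2,3)[OF assms] deriv_zero_outside_support in auto)

lemma C01_mult:
  assumes "\<phi> \<in> C01 Q" "C1_fun \<psi>"
  shows "(\<lambda>z. \<psi> z * \<phi> z) \<in> C01 Q"
proof -
  obtain K where "compact K" "K \<subseteq> Q" "\<And>z. z \<notin> K \<Longrightarrow> \<phi> z = 0"
    using C01_support[OF assms(1)] by metis
  then show ?thesis
    by (intro C01_I[of _ K] C1_fun_mult(1) assms(2) C01_D(1)[OF assms(1)]) auto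
qed

lemma C01_mult_bounded:
  assumes "\<phi> \<in> C01 Q" "continuous_on UNIV b"
  obtains B where "0 \<le> B" "\<And>z. \<bar>b z * \<phi> z\<bar> \<le> B"
proof -
  obtain K where K: "compact K" "\<And>z. z \<notin> K \<Longrightarrow> \<phi> z = 0"
    using C01_support[OF assms(1)] by metis
  have "continuous_on UNIV (\<lambda>z. b z * \<phi> z)"
    by (intro continuous_intros C1_fun_continuous C01_D(1)[OF assms(1)] assms(2))
  from bounded_compact_support[OF this K(1)] K(2) show ?thesis using that by auto
qed

lemma C01_mult_deriv_bounded:
  assumes "\<phi> \<in> C01 Q" "continuous_on UNIV b"
  obtains B where "0 \<le> B" "\<And>z. \<bar>b z * frechet_derivative \<phi> (at z) e\<bar> \<le> B"
proof -
  obtain K where K: "compact K" "\<And>z. z \<notin> K \<Longrightarrow> frechet_derivative \<phi> (at z) e = 0"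
    using C01_support[OF assms(1)] by metis
  have "continuous_on UNIV (\<lambda>z. b z * frechet_derivative \<phi> (at z) e)"
    by (intro continuous_intros C1_fun_continuous_deriv C01_D(1)[OF assms(1)] assms(2))
  from bounded_compact_support[OF this K(1)] K(2) show ?thesis using that by auto
qed

lemma C01_bounded:
  assumes "\<phi> \<in> C01 Q"
  obtains B where "0 \<le> B" "\<And>z. \<bar>\<phi> z\<bar> \<le> B"
  using C01_mult_bounded[OF assms continuous_on_const[of _ 1]] by auto

lemma C01_deriv_bounded:
  assumes "\<phi> \<in> C01 Q"
  obtains B where "0 \<le> B" "\<And>z. \<bar>frechet_derivative \<phi> (at z) e\<bar> \<le> B"
  using C01_mult_deriv_bounded[OF assms continuous_on_const[of _ 1]] by auto

lemma integrable_compact_support: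
  fixes f :: "'b::euclidean_space \<Rightarrow> real"
  assumes "continuous_on UNIV f" "compact K" "\<And>z. z \<notin> K \<Longrightarrow> f z = 0"
  shows "integrable lborel f"
proof -
  have "integrable lborel (\<lambda>x. indicator K x *\<^sub>R f x)"
    by (rule borel_integrable_compact[OF assms(2) continuous_on_subset[OF assms(1)]]) auto
  moreover have "(\<lambda>x. indicator K x *\<^sub>R f x) = f" using assms(3) by (auto simp: fun_eq_iff indicator_def)
  ultimately show ?thesis by simp
qed

lemma lborel_integral_translate:
  fixes f :: "'b::euclidean_space \<Rightarrow> real"
  assumes [measurable]: "f \<in> borel_measurable borel"
  shows "(LINT z|lborel. f (z + c)) = (LINT z|lborel. f z)"
proof -
  have "(LINT z|lborel. f z) = (LINT z|distr lborel borel ((+) c). f z)" by (simp add: lborel_distr_plus)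
  also have "\<dots> = (LINT z|lborel. f (c + z))" by (rule integral_distr) auto
  finally show ?thesis by (simp add: add.commute)
qed

text \<open>By translation invariance the difference quotients in the direction \<open>e\<close> have integral \<open>0\<close>. They
  converge boundedly to the directional derivative, and their supports stay in a fixed ball.\<close>

lemma integral_directional_deriv_zero:
  fixes \<phi> :: "'b::euclidean_space \<Rightarrow> real"
  assumes \<phi>: "\<phi> \<in> C01 UNIV"
  shows "(LINT z|lborel. frechet_derivative \<phi> (at z) e) = 0"
proof -
  note C1 = C01_D(1)[OF \<phi>]
  obtain K where K: "compact K" and z0: "\<And>z. z \<notin> K \<Longrightarrow> \<phi> z = 0"
    using C01_support[OF \<phi>] by metis
  obtain R where R: "0 < R" "\<And>z. z \<in> K \<Longrightarrow> norm z \<le> R"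
    using compact_imp_bounded[OF K] bounded_pos by metis
  obtain B where B: "0 \<le> B" "\<And>z. \<bar>frechet_derivative \<phi> (at z) e\<bar> \<le> B"
    using C01_deriv_bounded[OF \<phi>] by metis
  define h where "h n = 1 / real (Suc n)" for n
  have h: "0 < h n" "h n \<le> 1" for n by (auto simp: h_def)
  have h0: "h \<longlonglongrightarrow> 0" unfolding h_def using LIMSEQ_Suc[OF lim_1_over_n] by simp
  define q where "q n z = (\<phi> (z + h n *\<^sub>R e) - \<phi> z) / h n" for n z
  have meas [measurable]: "\<phi> \<in> borel_measurable borel" by (rule C1_fun_measurable[OF C1])
  have line: "((\<lambda>s. \<phi> (z + s *\<^sub>R e)) has_real_derivative frechet_derivative \<phi> (at (z + s *\<^sub>R e)) e) (at s)" for z s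
  proof -
    interpret bounded_linear "frechet_derivative \<phi> (at (z + s *\<^sub>R e))"
      by (rule has_derivative_bounded_linear[OF C1_fun_has_derivative[OF C1]])
    have "((\<lambda>s. \<phi> (z + s *\<^sub>R e)) has_derivative (\<lambda>k. frechet_derivative \<phi> (at (z + s *\<^sub>R e)) (k *\<^sub>R e))) (at s)"
      by (rule has_derivative_compose[OF _ C1_fun_has_derivative[OF C1]]) (auto intro!: derivative_eq_intros)
    then show ?thesis by (simp add: has_field_derivative_def scaleR mult.commute[of _ "frechet_derivative _ _ _"])
  qed
  have "(\<lambda>n. LINT z|lborel. q n z) \<longlonglongrightarrow> (LINT z|lborel. frechet_derivative \<phi> (at z) e)"
  proof (rule integral_dominated_convergence[where w="\<lambda>z. B * indicator (cball 0 (R + norm e)) z"])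
    show "(\<lambda>z. frechet_derivative \<phi> (at z) e) \<in> borel_measurable lborel"
      using C1_fun_measurable_deriv[OF C1] by simp
    show "q n \<in> borel_measurable lborel" for n unfolding q_def by measurable
    show "integrable lborel (\<lambda>z. B * indicator (cball (0::'b) (R + norm e)) z)"
      using emeasure_lborel_cball_finite[of "0::'b" "R + norm e"]
      by (intro integrable_mult_right integrable_real_indicator) auto
    show "AE z in lborel. (\<lambda>n. q n z) \<longlonglongrightarrow> frechet_derivative \<phi> (at z) e"
    proof (rule AE_I2)
      fix z
      have "((\<lambda>s. (\<phi> (z + s *\<^sub>R e) - \<phi> z) / s) \<longlongrightarrow> frechet_derivative \<phi> (at z) e) (at 0)"
        using line[of z 0] by (simp add: has_field_derivative_iff)
      moreover have "filterlim h (at 0) sequentially"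
        using h0 h(1) by (auto simp: filterlim_at intro!: always_eventually less_imp_neq[symmetric])
      ultimately show "(\<lambda>n. q n z) \<longlonglongrightarrow> frechet_derivative \<phi> (at z) e"
        unfolding q_def by (rule filterlim_compose)
    qed
    show "AE z in lborel. norm (q n z) \<le> B * indicator (cball 0 (R + norm e)) z" for n
    proof (rule AE_I2)
      fix z
      show "norm (q n z) \<le> B * indicator (cball 0 (R + norm e)) z"
      proof (cases "norm z \<le> R + norm e")
        case True
        obtain s where "\<phi> (z + h n *\<^sub>R e) - \<phi> (z + 0 *\<^sub>R e) = (h n - 0) * frechet_derivative \<phi> (at (z + s *\<^sub>R e)) e"
          using MVT2[OF h(1)[of n] line[of z]] by blast
        then have "q n z = frechet_derivative \<phi> (at (z + s *\<^sub>R e)) e" using h(1)[of n] by (simp add: q_def)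
        then show ?thesis using True B(2) by simp
      next
        case False
        have "norm (h n *\<^sub>R e) \<le> norm e" using h[of n] by (simp add: mult_left_le_one_le)
        moreover have "norm z \<le> norm (z + h n *\<^sub>R e) + norm (h n *\<^sub>R e)"
          by (metis add_diff_cancel_right' norm_triangle_ineq4)
        ultimately have "R < norm (z + h n *\<^sub>R e)" "R < norm z" using False norm_ge_zero[of e] by linarith+
        then have "\<phi> (z + h n *\<^sub>R e) = 0" "\<phi> z = 0" by (metis R(2) not_less z0)+
        then show ?thesis using False by (simp add: q_def)
      qed
    qed
  qed
  moreover have "(LINT z|lborel. q n z) = 0" for n
  proof -
    have i: "integrable lborel \<phi>"
      by (rule integrable_compact_support[OF C1_fun_continuous[OF C1] K z0])
    have i2: "integrable lborel (\<lambda>z. \<phi> (z + h n *\<^sub>R e))"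
    proof -
      have "integrable (distr lborel borel ((+) (h n *\<^sub>R e))) \<phi>" using i by (simp add: lborel_distr_plus)
      then show ?thesis by (subst (asm) integrable_distr_eq) (auto simp: add.commute)
    qed
    show ?thesis
      using i i2 lborel_integral_translate[OF meas, of "h n *\<^sub>R e"] by (simp add: q_def)
  qed
  ultimately show ?thesis by (simp add: LIMSEQ_const_iff)
qed



section \<open>Uniqueness of weak derivatives\<close>

lemma AE_lebesgue_iff: "(AE x in lebesgue. P x) \<longleftrightarrow> negligible {x. \<not> P x}"
  using completion.AE_iff_null_sets[where M=lborel and P=P]
  by (simp add: negligible_iff_null_sets)

lemma locally_integrable_measurable:
  fixes Q :: "'b::euclidean_space set"
  assumes Q: "open Q" and f: "locally_integrable Q f"
  shows "f \<in> borel_measurable (lebesgue_on Q)"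
proof -
  obtain C :: "nat \<Rightarrow> 'b set" where C: "\<And>n. compact (C n)" "\<And>n. C n \<subseteq> Q" 
    "\<And>K. \<lbrakk>compact K; K \<subseteq> Q\<rbrakk> \<Longrightarrow> \<exists>N. \<forall>n\<ge>N. K \<subseteq> C n"
    using open_Union_compact_subsets[OF Q] by metis
  have "(\<lambda>x. indicator Q x *\<^sub>R f x) \<in> borel_measurable lebesgue"
  proof (rule borel_measurable_LIMSEQ_real)
    fix n
    have "integrable (lebesgue_on (C n)) f" using f C by (auto simp: locally_integrable_def)
    then show "(\<lambda>x. indicator (C n) x *\<^sub>R f x) \<in> borel_measurable lebesgue"
      using C(1)[of n] by (subst (asm) integrable_restrict_space) (auto simp: borel_compact)
  next
    fix x
    show "(\<lambda>n. indicator (C n) x *\<^sub>R f x) \<longlonglongrightarrow> indicator Q x *\<^sub>R f x"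
    proof (cases "x \<in> Q")
      case True
      then obtain N where "\<forall>n\<ge>N. x \<in> C n" using C(3)[of "{x}"] by auto
      then have "\<forall>\<^sub>F n in sequentially. indicator (C n) x *\<^sub>R f x = indicator Q x *\<^sub>R f x"
        using True by (auto simp: eventually_sequentially intro!: exI[of _ N])
      then show ?thesis by (rule tendsto_eventually)
    next
      case False
      then have "x \<notin> C n" for n using C(2) by auto
      then show ?thesis using False by simp
    qed
  qed
  then show ?thesis using Q by (subst borel_measurable_restrict_space_iff) auto
qed

lemma integrable_lebesgue_on_iff:
  fixes f :: "'b::euclidean_space \<Rightarrow> real"
  assumes "open Q"
  shows "integrable (lebesgue_on Q) f \<longleftrightarrow> integrable lebesgue (\<lambda>z. indicator Q z * f z)"
  using assms by (subst integrable_restrict_space) auto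

lemma integral_lebesgue_on_eq:
  fixes f :: "'b::euclidean_space \<Rightarrow> real"
  assumes "open Q"
  shows "(LINT z|lebesgue_on Q. f z) = (LINT z|lebesgue. indicator Q z * f z)"
  using assms by (subst integral_restrict_space) auto

lemma AE_lebesgue_on_iff:
  assumes "open Q"
  shows "(AE z in lebesgue_on Q. P z) \<longleftrightarrow> (AE z in lebesgue. z \<in> Q \<longrightarrow> P z)"
  using assms by (subst AE_restrict_space_iff) auto

lemma locally_integrable_mult:
  fixes Q :: "'b::euclidean_space set"
  assumes Q: "open Q" and f: "locally_integrable Q f"
    and b: "b \<in> C01 Q"
  shows "integrable (lebesgue_on Q) (\<lambda>z. f z * b z)"
proof -
  obtain K where K: "compact K" "K \<subseteq> Q" and z0: "\<And>z. z \<notin> K \<Longrightarrow> b z = 0"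
    using C01_support[OF b] by metis
  obtain B where B: "\<And>z. \<bar>b z\<bar> \<le> B"
    using C01_bounded[OF b] by metis
  have "integrable (lebesgue_on K) f" using f K by (auto simp: locally_integrable_def)
  then have i: "integrable lebesgue (\<lambda>z. indicator K z *\<^sub>R f z)"
    using K by (subst (asm) integrable_restrict_space) (auto simp: borel_compact)
  have "integrable lebesgue (\<lambda>z. b z * (indicator K z *\<^sub>R f z))"
    by (rule integrable_mult_bounded[OF i, of _ B])
       (auto simp: B intro!: borel_measurable_lebesgueI C1_fun_measurable C01_D(1)[OF b])
  also have "(\<lambda>z. b z * (indicator K z *\<^sub>R f z)) = (\<lambda>z. indicator Q z * (f z * b z))"
    using K z0 by (auto simp: fun_eq_iff indicator_def)
  finally show ?thesis by (simp add: integrable_lebesgue_on_iff[OF Q])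
qed

lemma AE_lebesgue_local:
  fixes Q :: "'b::euclidean_space set"
  assumes "\<And>z. z \<in> Q \<Longrightarrow> \<exists>r>0. AE y in lebesgue. y \<in> ball z r \<longrightarrow> P y"
  shows "AE y in lebesgue. y \<in> Q \<longrightarrow> P y"
  unfolding AE_lebesgue_iff
proof (subst locally_negligible_alt, intro ballI)
  fix z assume z: "z \<in> {y. \<not> (y \<in> Q \<longrightarrow> P y)}"
  then obtain r where r: "0 < r" "negligible {y. \<not> (y \<in> ball z r \<longrightarrow> P y)}"
    using assms[of z] unfolding AE_lebesgue_iff by auto
  show "\<exists>U. openin (top_of_set {y. \<not> (y \<in> Q \<longrightarrow> P y)}) U \<and> z \<in> U \<and> negligible U"
  proof (intro exI conjI)
    show "openin (top_of_set {y. \<not> (y \<in> Q \<longrightarrow> P y)}) ({y. \<not> (y \<in> Q \<longrightarrow> P y)} \<inter> ball z r)"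
      by (simp add: openin_open_Int)
    show "negligible ({y. \<not> (y \<in> Q \<longrightarrow> P y)} \<inter> ball z r)"
      by (rule negligible_subset[OF r(2)]) auto
  qed (use z r in auto)
qed

lemma C1_fun_const: "C1_fun (\<lambda>z. c)"
  by (rule C1_funI(1)[of _ "\<lambda>z h. 0"]) auto

lemma bump_reflect_C1: "0 < \<delta> \<Longrightarrow> C1_fun (\<lambda>y. bump \<delta> (z - y))"
  "0 < \<delta> \<Longrightarrow> frechet_derivative (\<lambda>y. bump \<delta> (z - y)) (at y) e = - bump_deriv \<delta> (z - y) e"
  by (rule C1_funI[OF bump_reflect_has_derivative], assumption,
      auto intro!: continuous_intros continuous_on_bump_deriv)+

lemma bump_C01:
  assumes "0 < r" "cball z r \<subseteq> Q"
  shows "(\<lambda>y. bump r (z - y)) \<in> C01 Q"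
  by (rule C01_I[OF bump_reflect_C1(1)[OF assms(1)] compact_cball assms(2)])
     (use assms(1) in \<open>auto intro!: bump_zero simp: dist_norm\<close>)

text \<open>Around a point of \<open>Q\<close> multiply \<open>h\<close> by a cutoff function. Every value of a mollification of the
  product pairs \<open>h\<close> with a test function and is \<open>0\<close>, and the mollifications converge in mean to the
  product.\<close>

lemma fundamental_lemma:
  fixes Q :: "'b::euclidean_space set"
  assumes Q: "open Q" and h: "locally_integrable Q h"
    and z: "\<And>\<phi>. \<phi> \<in> C01 Q \<Longrightarrow> (LINT z|lebesgue_on Q. h z * \<phi> z) = 0"
  shows "AE z in lebesgue_on Q. h z = 0"
  unfolding AE_lebesgue_on_iff[OF Q]
proof (rule AE_lebesgue_local)
  fix z0 assume "z0 \<in> Q"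
  then obtain r where r: "0 < r" "cball z0 r \<subseteq> Q" using Q open_contains_cball by blast
  define \<zeta> where "\<zeta> y = bump r (z0 - y)" for y
  have \<zeta>: "\<zeta> \<in> C01 Q" unfolding \<zeta>_def[abs_def] by (rule bump_C01[OF r])
  define F where "F y = indicator Q y * (h y * \<zeta> y)" for y
  have F: "integrable lebesgue F"
    using locally_integrable_mult[OF Q h \<zeta>] unfolding integrable_lebesgue_on_iff[OF Q] F_def[abs_def] .
  have m0: "mollify \<delta> F z = 0" if d: "0 < \<delta>" for \<delta> z
  proof -
    have "(\<lambda>y. (bump \<delta> (z - y) * (1 / bump_mass TYPE('b) \<delta>)) * \<zeta> y) \<in> C01 Q"
      by (rule C01_mult[OF \<zeta> C1_fun_mult(1)[OF bump_reflect_C1(1)[OF d] C1_fun_const]])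
    from assms(3)[OF this] show ?thesis
      unfolding integral_lebesgue_on_eq[OF Q] mollify_def F_def mollifier_def
      by (simp add: ac_simps)
  qed
  have L1: "L1_tendsto lebesgue (\<lambda>j. mollify (1 / real (Suc j)) F) F"
    by (rule mollify_L1_tendsto[OF F]) (use LIMSEQ_Suc[OF lim_1_over_n] in auto)
  have "mollify (1 / real (Suc j)) F = (\<lambda>z. 0)" for j
    by (rule ext, rule m0) simp
  with L1_tendstoD(3)[OF L1] have "(LINT z|lebesgue. \<bar>F z\<bar>) = 0" by (simp add: LIMSEQ_const_iff)
  then have "AE z in lebesgue. \<bar>F z\<bar> = 0"
    using F by (subst (asm) integral_nonneg_eq_0_iff_AE) auto
  then have "AE y in lebesgue. y \<in> ball z0 r \<longrightarrow> h y = 0"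
  proof eventually_elim
    case (elim y)
    show ?case
    proof
      assume y: "y \<in> ball z0 r"
      have "\<zeta> y \<noteq> 0" unfolding \<zeta>_def by (rule bump_nonzero) (use y in \<open>simp add: dist_norm\<close>)
      moreover have "y \<in> Q" using y r by auto
      ultimately show "h y = 0" using elim by (simp add: F_def)
    qed
  qed
  then show "\<exists>r>0. AE y in lebesgue. y \<in> ball z0 r \<longrightarrow> h y = 0" using r by blast
qed

lemma weak_deriv_unique:
  fixes Q :: "'b::euclidean_space set"
  assumes Q: "open Q" and 1: "has_weak_deriv Q e f g1" and 2: "has_weak_deriv Q e f g2"
  shows "AE z in lebesgue_on Q. g1 z = g2 z"
proof -
  have l: "locally_integrable Q g1" "locally_integrable Q g2" using 1 2 by (auto simp: has_weak_deriv_def)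
  have "AE z in lebesgue_on Q. g1 z - g2 z = 0"
  proof (rule fundamental_lemma[OF Q])
    show "locally_integrable Q (\<lambda>z. g1 z - g2 z)" using l by (auto simp: locally_integrable_def)
    fix \<phi> assume \<phi>: "\<phi> \<in> C01 Q"
    have "(LINT z|lebesgue_on Q. g1 z * \<phi> z) = (LINT z|lebesgue_on Q. g2 z * \<phi> z)"
      using 1 2 \<phi> unfolding has_weak_deriv_def by (metis neg_equal_iff_equal)
    then show "(LINT z|lebesgue_on Q. (g1 z - g2 z) * \<phi> z) = 0"
      using locally_integrable_mult[OF Q l(1) \<phi>] locally_integrable_mult[OF Q l(2) \<phi>]
      by (simp add: left_diff_distrib)
  qed
  then show ?thesis by simp
qed

section \<open>The chain rule for weak derivatives\<close>

text \<open>A function with a trace comes with functions of class \<open>C\<^sup>1\<close> on the whole space that approximate it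
  in \<open>W\<^sup>1\<^sup>,\<^sup>1(Q)\<close>. All chain rules for the solution are obtained from them. Convergence almost
  everywhere, which a subsequence always has, is included for the sake of nonlinear compositions.\<close>

definition W11_approx :: "'b::euclidean_space set \<Rightarrow> (nat \<Rightarrow> 'b \<Rightarrow> real) \<Rightarrow> ('b \<Rightarrow> real) \<Rightarrow> ('b \<Rightarrow> 'b \<Rightarrow> real) \<Rightarrow> bool"
  where "W11_approx Q \<psi> u d \<longleftrightarrow> (\<forall>k. C1_fun (\<psi> k)) \<and> L1_tendsto (lebesgue_on Q) \<psi> u \<and>
     (\<forall>e\<in>Basis. L1_tendsto (lebesgue_on Q) (\<lambda>k z. frechet_derivative (\<psi> k) (at z) e) (d e)) \<and>
     (AE z in lebesgue_on Q. (\<lambda>k. \<psi> k z) \<longlonglongrightarrow> u z)"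

lemma W11_approxD:
  assumes "W11_approx Q \<psi> u d"
  shows "C1_fun (\<psi> k)" "L1_tendsto (lebesgue_on Q) \<psi> u"
    "e \<in> Basis \<Longrightarrow> L1_tendsto (lebesgue_on Q) (\<lambda>k z. frechet_derivative (\<psi> k) (at z) e) (d e)"
    "AE z in lebesgue_on Q. (\<lambda>k. \<psi> k z) \<longlonglongrightarrow> u z"
  using assms by (auto simp: W11_approx_def)

lemma measurable_lebesgue_onI: "f \<in> borel_measurable borel \<Longrightarrow> f \<in> borel_measurable (lebesgue_on Q)"
  by (intro measurable_restrict_space1 borel_measurable_lebesgueI)

lemma integral_C01_deriv_zero:
  assumes Q: "open Q" and \<phi>: "\<phi> \<in> C01 Q"
  shows "(LINT z|lebesgue_on Q. frechet_derivative \<phi> (at z) e) = 0"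
proof -
  obtain K where KQ: "K \<subseteq> Q" and K0: "\<And>z. z \<notin> K \<Longrightarrow> frechet_derivative \<phi> (at z) e = 0"
    using C01_support[OF \<phi>] by metis
  have "(\<lambda>z. indicator Q z * frechet_derivative \<phi> (at z) e) = (\<lambda>z. frechet_derivative \<phi> (at z) e)"
    using KQ K0 by (auto simp: fun_eq_iff indicator_def)
  then have "(LINT z|lebesgue_on Q. frechet_derivative \<phi> (at z) e) = (LINT z|lebesgue. frechet_derivative \<phi> (at z) e)"
    by (simp add: integral_lebesgue_on_eq[OF Q])
  also have "\<dots> = (LINT z|lborel. frechet_derivative \<phi> (at z) e)"
    using C1_fun_measurable_deriv[OF C01_D(1)[OF \<phi>]] by (intro integral_completion) auto
  also have "\<dots> = 0"
    by (rule integral_directional_deriv_zero) (use \<phi> in \<open>auto simp: C01_def\<close>)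
  finally show ?thesis .
qed

lemma lipschitz_bound_real:
  fixes H :: "real \<Rightarrow> real"
  assumes "\<And>s. (H has_real_derivative H' s) (at s)" "\<And>s. \<bar>H' s\<bar> \<le> B"
  shows "\<bar>H a - H b\<bar> \<le> B * \<bar>a - b\<bar>"
  using field_differentiable_bound[of UNIV H H' B a b] assms by auto

lemma integrable_const_on_bounded:
  fixes Q :: "'b::euclidean_space set"
  assumes "open Q" "bounded Q"
  shows "integrable (lebesgue_on Q) (\<lambda>z. c :: real)"
  using assms by (intro finite_measure.integrable_const finite_measure_lebesgue_on)
    (auto intro: bounded_set_imp_lmeasurable)

lemma compose_L1_tendsto:
  fixes Q :: "'b::euclidean_space set"
  assumes Q: "open Q" "bounded Q" and W: "L1_tendsto (lebesgue_on Q) \<psi> u"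
    and H: "\<And>s. (H has_real_derivative H' s) (at s)" "\<And>s. \<bar>H' s\<bar> \<le> B"
  shows "L1_tendsto (lebesgue_on Q) (\<lambda>k z. H (\<psi> k z)) (\<lambda>z. H (u z))"
proof -
  have cH: "continuous_on UNIV H" using H(1) by (meson DERIV_isCont continuous_at_imp_continuous_on)
  note fm = integrable_const_on_bounded[OF Q]
  have HB: "\<bar>H a - H b\<bar> \<le> B * \<bar>a - b\<bar>" for a b by (rule lipschitz_bound_real[OF H])
  have i: "integrable (lebesgue_on Q) (\<lambda>z. H (v z))" if v: "integrable (lebesgue_on Q) v" for v
  proof (rule Bochner_Integration.integrable_bound[of _ "\<lambda>z. \<bar>H 0\<bar> + B * \<bar>v z\<bar>"])
    show "integrable (lebesgue_on Q) (\<lambda>z. \<bar>H 0\<bar> + B * \<bar>v z\<bar>)"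
      using fm v by auto
    have [measurable]: "H \<in> borel_measurable borel" by (rule borel_measurable_continuous_onI[OF cH])
    have [measurable]: "v \<in> borel_measurable (lebesgue_on Q)" using v by auto
    show "(\<lambda>z. H (v z)) \<in> borel_measurable (lebesgue_on Q)" by measurable
    have "norm (H (v z)) \<le> norm (\<bar>H 0\<bar> + B * \<bar>v z\<bar>)" for z
      using HB[of "v z" 0] by simp
    then show "AE z in lebesgue_on Q. norm (H (v z)) \<le> norm (\<bar>H 0\<bar> + B * \<bar>v z\<bar>)" by simp
  qed
  note L = L1_tendstoD[OF W]
  show ?thesis
  proof (rule L1_tendsto_bound[where G="\<lambda>k z. B * \<bar>\<psi> k z - u z\<bar>"])
    show "(\<lambda>k. LINT z|lebesgue_on Q. B * \<bar>\<psi> k z - u z\<bar>) \<longlonglongrightarrow> 0"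
      using tendsto_mult_left[OF L(3), of B] by simp
  qed (use L i HB in auto)
qed

text \<open>Integration by parts for the approximants, followed by the limit in mean. Since \<open>\<zeta>\<close> has compact
  support, \<open>\<theta>\<close> may be any function of class \<open>C\<^sup>1\<close>; this freedom is used with \<open>\<theta>\<close> a translated
  convolution kernel.\<close>

lemma chain_rule:
  fixes Q :: "'b::euclidean_space set"
  assumes Q: "open Q" "bounded Q" and W: "W11_approx Q \<psi> u d"
    and e: "e \<in> Basis"
    and H: "\<And>s. (H has_real_derivative H' s) (at s)" "continuous_on UNIV H'" "\<And>s. \<bar>H' s\<bar> \<le> B"
    and \<zeta>: "\<zeta> \<in> C01 Q" and \<theta>: "C1_fun \<theta>"
  shows "integrable (lebesgue_on Q) (\<lambda>z. H (u z))"
    "integrable (lebesgue_on Q) (\<lambda>z. H' (u z) * d e z)"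
    "(LINT z|lebesgue_on Q. H (u z) * \<zeta> z * frechet_derivative \<theta> (at z) e) =
     - (LINT z|lebesgue_on Q. (H' (u z) * d e z * \<zeta> z + H (u z) * frechet_derivative \<zeta> (at z) e) * \<theta> z)"
proof -
  let ?M = "lebesgue_on Q"
  note W = W11_approxD[OF W] W11_approxD(3)[OF W e]
  have LH: "L1_tendsto ?M (\<lambda>k z. H (\<psi> k z)) (\<lambda>z. H (u z))"
    by (rule compose_L1_tendsto[OF Q W(2) H(1,3)])
  show "integrable ?M (\<lambda>z. H (u z))" using L1_tendstoD(2)[OF LH] .
  have mH' [measurable]: "H' \<in> borel_measurable borel" by (rule borel_measurable_continuous_onI[OF H(2)])
  have um [measurable]: "u \<in> borel_measurable ?M" "\<And>k. \<psi> k \<in> borel_measurable ?M" using L1_tendstoD[OF W(2)] by auto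
  have LD: "L1_tendsto ?M (\<lambda>k z. H' (\<psi> k z) * frechet_derivative (\<psi> k) (at z) e) (\<lambda>z. H' (u z) * d e z)"
  proof (rule L1_tendsto_mult_bounded[OF W(5), where K=B])
    show "AE z in ?M. (\<lambda>k. H' (\<psi> k z)) \<longlonglongrightarrow> H' (u z)"
      using W(4) by eventually_elim (auto intro: continuous_on_tendsto_compose[OF H(2)])
  qed (auto simp: H(3))
  show "integrable ?M (\<lambda>z. H' (u z) * d e z)" using L1_tendstoD(2)[OF LD] .
  note C\<zeta> = C01_D(1)[OF \<zeta>]
  let ?X = "\<lambda>z. frechet_derivative \<theta> (at z) e * \<zeta> z"
  let ?Y = "\<lambda>z. \<theta> z * \<zeta> z"
  let ?Z = "\<lambda>z. \<theta> z * frechet_derivative \<zeta> (at z) e"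
  obtain BX where BX: "\<And>z. \<bar>?X z\<bar> \<le> BX" using C01_mult_bounded[OF \<zeta> C1_fun_continuous_deriv[OF \<theta>]] by blast
  obtain BY where BY: "\<And>z. \<bar>?Y z\<bar> \<le> BY" using C01_mult_bounded[OF \<zeta> C1_fun_continuous[OF \<theta>]] by blast
  obtain BZ where BZ: "\<And>z. \<bar>?Z z\<bar> \<le> BZ" using C01_mult_deriv_bounded[OF \<zeta> C1_fun_continuous[OF \<theta>]] by blast
  have mb: "?X \<in> borel_measurable ?M" "?Y \<in> borel_measurable ?M" "?Z \<in> borel_measurable ?M"
    by (intro measurable_lebesgue_onI borel_measurable_times C1_fun_measurable C1_fun_measurable_deriv C\<zeta> \<theta>)+
  have LX: "L1_tendsto ?M (\<lambda>k z. ?X z * H (\<psi> k z)) (\<lambda>z. ?X z * H (u z))"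
    by (rule L1_tendsto_mult_bounded_const[OF LH mb(1), where K=BX]) (rule AE_I2, rule BX)
  have LY: "L1_tendsto ?M (\<lambda>k z. ?Y z * (H' (\<psi> k z) * frechet_derivative (\<psi> k) (at z) e)) (\<lambda>z. ?Y z * (H' (u z) * d e z))"
    by (rule L1_tendsto_mult_bounded_const[OF LD mb(2), where K=BY]) (rule AE_I2, rule BY)
  have LZ: "L1_tendsto ?M (\<lambda>k z. ?Z z * H (\<psi> k z)) (\<lambda>z. ?Z z * H (u z))"
    by (rule L1_tendsto_mult_bounded_const[OF LH mb(3), where K=BZ]) (rule AE_I2, rule BZ)
  have z: "(LINT z|?M. ?X z * H (\<psi> k z) + ?Y z * (H' (\<psi> k z) * frechet_derivative (\<psi> k) (at z) e) + ?Z z * H (\<psi> k z)) = 0" for k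
  proof -
    note c = C1_fun_compose[OF W(1)[of k] H(1,2)]
    note c2 = C1_fun_mult[OF c(1) \<theta>]
    have mem: "(\<lambda>z. (H (\<psi> k z) * \<theta> z) * \<zeta> z) \<in> C01 Q" by (rule C01_mult[OF \<zeta> c2(1)])
    have "frechet_derivative (\<lambda>z. (H (\<psi> k z) * \<theta> z) * \<zeta> z) (at z) e =
       ?X z * H (\<psi> k z) + ?Y z * (H' (\<psi> k z) * frechet_derivative (\<psi> k) (at z) e) + ?Z z * H (\<psi> k z)" for z
      unfolding C1_fun_mult(2)[OF c2(1) C\<zeta>] c2(2) c(2) by (simp add: algebra_simps)
    with integral_C01_deriv_zero[OF Q(1) mem, of e] show ?thesis by simp
  qed
  have "(LINT z|?M. ?X z * H (u z) + ?Y z * (H' (u z) * d e z) + ?Z z * H (u z)) = 0"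
    using L1_tendsto_integral[OF L1_tendsto_add[OF L1_tendsto_add[OF LX LY] LZ]] unfolding z by (simp add: LIMSEQ_const_iff)
  also have "(LINT z|?M. ?X z * H (u z) + ?Y z * (H' (u z) * d e z) + ?Z z * H (u z))
    = (LINT z|?M. ?X z * H (u z)) + (LINT z|?M. ?Y z * (H' (u z) * d e z) + ?Z z * H (u z))"
    unfolding add.assoc
    using L1_tendstoD(2)[OF LX] L1_tendstoD(2)[OF LY] L1_tendstoD(2)[OF LZ]
    by (intro Bochner_Integration.integral_add Bochner_Integration.integrable_add)
  finally show "(LINT z|lebesgue_on Q. H (u z) * \<zeta> z * frechet_derivative \<theta> (at z) e) =
     - (LINT z|lebesgue_on Q. (H' (u z) * d e z * \<zeta> z + H (u z) * frechet_derivative \<zeta> (at z) e) * \<theta> z)"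
    by (simp add: algebra_simps)
qed

section \<open>Mollification with a variable exponent\<close>

text \<open>Here \<open>C / ln (exp 1 + 1 / \<delta>)\<close> is the oscillation of a log-Hoelder exponent at distance \<open>\<delta>\<close>. As
  \<open>ln t\<close> is at most a multiple of \<open>ln (exp 1 + 1 / \<delta>)\<close>, a quantity of polynomial growth in \<open>1 / \<delta>\<close>
  raised to this power stays bounded.\<close>

lemma powr_log_bounded:
  fixes C K \<delta> t :: real and n :: nat
  assumes C: "0 \<le> C" and K: "1 \<le> K" and d: "0 < \<delta>" "\<delta> \<le> 1" and t: "1 \<le> t" "t \<le> K / \<delta> ^ n"
  shows "t powr (C / ln (exp 1 + 1 / \<delta>)) \<le> exp (C * (ln K + real n))"
proof -
  define l where "l = ln (exp 1 + 1 / \<delta>)"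
  have "ln (exp 1 :: real) \<le> l"
    unfolding l_def using d by (subst ln_le_cancel_iff) (auto intro!: add_pos_pos)
  then have l1: "1 \<le> l" by simp
  have l2: "ln (1 / \<delta>) \<le> l"
    unfolding l_def using d by (subst ln_le_cancel_iff) (auto intro!: add_pos_pos)
  have l3: "0 \<le> ln (1 / \<delta>)" using d by simp
  have "ln t \<le> ln (K / \<delta> ^ n)" using t K d by (subst ln_le_cancel_iff) auto
  also have "\<dots> = ln K + real n * ln (1 / \<delta>)"
    using K d by (simp add: ln_div ln_realpow)
  also have "\<dots> \<le> ln K * l + real n * l"
    using l1 l2 K mult_left_mono[of 1 l "ln K"] by (intro add_mono mult_left_mono) auto
  finally have "ln t \<le> (ln K + real n) * l" by (simp add: algebra_simps)
  then have "C / l * ln t \<le> C / l * ((ln K + real n) * l)" using C l1 by (intro mult_left_mono) auto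
  also have "\<dots> = C * (ln K + real n)" using l1 by simp
  finally show ?thesis using t by (simp add: powr_def l_def[symmetric])
qed

text \<open>The pointwise modular estimate behind the density of smooth functions in variable exponent spaces.
  Let \<open>\<tau>\<close> be half of the mean \<open>t\<close> of \<open>\<bar>f\<bar>\<close>, let \<open>\<tau> \<ge> 1\<close>, and let \<open>s = r - \<omega>\<close> be a lower bound of the
  exponent on the ball. Then \<open>\<bar>f\<bar> \<le> \<tau> + \<tau> powr (1 - s) * \<bar>f\<bar> powr q\<close> on the ball; averaging and
  absorbing \<open>\<tau>\<close> yields \<open>\<tau> powr s \<le> P\<close> for the mean \<open>P\<close> of \<open>\<bar>f\<bar> powr q\<close>. Passing from \<open>s\<close> back
  to \<open>r\<close> costs the factor \<open>\<tau> powr \<omega>\<close>, which is bounded by \<open>A\<close>.\<close>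

lemma mollify_powr_bound:
  fixes f :: "'b::euclidean_space \<Rightarrow> real"
  assumes d: "0 < \<delta>" and f: "integrable lebesgue f" and fq: "integrable lebesgue (\<lambda>y. \<bar>f y\<bar> powr q y)"
    and q: "\<And>y. f y \<noteq> 0 \<Longrightarrow> 1 \<le> q y" "\<And>y. y \<in> ball z \<delta> \<Longrightarrow> f y \<noteq> 0 \<Longrightarrow> r - \<omega> \<le> q y"
    and r: "1 \<le> r" and A: "0 \<le> A"
    and tA: "1 \<le> mollify \<delta> (\<lambda>y. \<bar>f y\<bar>) z / 2 \<Longrightarrow> (mollify \<delta> (\<lambda>y. \<bar>f y\<bar>) z / 2) powr \<omega> \<le> A"
  shows "\<bar>mollify \<delta> f z\<bar> powr r \<le> 2 powr r * (1 + A * mollify \<delta> (\<lambda>y. \<bar>f y\<bar> powr q y) z)"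
proof -
  define t where "t = mollify \<delta> (\<lambda>y. \<bar>f y\<bar>) z"
  define P where "P = mollify \<delta> (\<lambda>y. \<bar>f y\<bar> powr q y) z"
  have fa: "integrable lebesgue (\<lambda>y. \<bar>f y\<bar>)" using f by simp
  have P0: "0 \<le> P" unfolding P_def mollify_def
    by (intro integral_nonneg_AE AE_I2 mult_nonneg_nonneg mollifier_nonneg[OF d]) auto
  have t0: "0 \<le> t" unfolding t_def mollify_def
    by (intro integral_nonneg_AE AE_I2 mult_nonneg_nonneg mollifier_nonneg[OF d]) auto
  have ft: "\<bar>mollify \<delta> f z\<bar> \<le> t"
  proof -
    have "\<bar>mollify \<delta> f z\<bar> \<le> (LINT y|lebesgue. \<bar>mollifier \<delta> (z - y) * f y\<bar>)"
      unfolding mollify_def by (rule integral_abs_bound)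
    also have "\<dots> = t" by (simp add: t_def mollify_def abs_mult mollifier_nonneg[OF d])
    finally show ?thesis .
  qed
  have le: "\<bar>mollify \<delta> f z\<bar> powr r \<le> t powr r" using ft r by (intro powr_mono2) auto
  also have "t powr r \<le> 2 powr r * (1 + A * P)"
  proof (cases "t \<le> 2")
    case True
    have "t powr r \<le> 2 powr r" using True t0 r by (intro powr_mono2) auto
    also have "\<dots> \<le> 2 powr r * (1 + A * P)" using A P0 by simp
    finally show ?thesis .
  next
    case False
    define \<tau> where "\<tau> = t / 2"
    have \<tau>: "1 \<le> \<tau>" "t = 2 * \<tau>" using False by (auto simp: \<tau>_def)
    define s where "s = r - \<omega>"
    have pw: "\<bar>f y\<bar> \<le> \<tau> + \<tau> powr (1 - s) * \<bar>f y\<bar> powr q y" if y: "y \<in> ball z \<delta>" for y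
    proof (cases "\<bar>f y\<bar> \<le> \<tau>")
      case True then show ?thesis using \<tau> by (simp add: add_increasing2)
    next
      case False
      then have fy: "0 < \<bar>f y\<bar>" "f y \<noteq> 0" using \<tau> by auto
      have "\<bar>f y\<bar> = \<bar>f y\<bar> powr q y * \<bar>f y\<bar> powr (1 - q y)"
        using fy by (simp add: powr_add[symmetric])
      also have "\<dots> \<le> \<bar>f y\<bar> powr q y * \<tau> powr (1 - q y)"
        using False \<tau> q(1)[OF fy(2)] by (intro mult_left_mono powr_mono2') auto
      also have "\<dots> \<le> \<bar>f y\<bar> powr q y * \<tau> powr (1 - s)"
        using \<tau> q(2)[OF y fy(2)] by (intro mult_left_mono powr_mono) (auto simp: s_def)
      finally show ?thesis using \<tau> by (simp add: mult.commute)
    qed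
    have m: "integrable lebesgue (\<lambda>y. mollifier \<delta> (z - y))" "(LINT y|lebesgue. mollifier \<delta> (z - y)) = 1"
      using integrable_mollifier_lebesgue[OF d, of z] by (auto simp: has_bochner_integral_iff)
    note im = integrable_mollify[OF d fa, of z] integrable_mollify[OF d fq, of z]
    have "t \<le> (LINT y|lebesgue. \<tau> * mollifier \<delta> (z - y) + \<tau> powr (1 - s) * (mollifier \<delta> (z - y) * \<bar>f y\<bar> powr q y))"
      unfolding t_def mollify_def
    proof (rule integral_mono[OF im(1)])
      show "integrable lebesgue (\<lambda>y. \<tau> * mollifier \<delta> (z - y) + \<tau> powr (1 - s) * (mollifier \<delta> (z - y) * \<bar>f y\<bar> powr q y))"
        using m im by (intro Bochner_Integration.integrable_add integrable_mult_right)
      fix y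
      show "mollifier \<delta> (z - y) * \<bar>f y\<bar> \<le> \<tau> * mollifier \<delta> (z - y) + \<tau> powr (1 - s) * (mollifier \<delta> (z - y) * \<bar>f y\<bar> powr q y)"
      proof (cases "y \<in> ball z \<delta>")
        case True
        from mult_left_mono[OF pw[OF True] mollifier_nonneg[OF d, of "z - y"]]
        show ?thesis by (simp add: algebra_simps)
      next
        case False
        then show ?thesis using d by (simp add: mollifier_zero dist_norm)
      qed
    qed
    also have "\<dots> = \<tau> + \<tau> powr (1 - s) * P"
      using m im by (simp add: P_def mollify_def)
    finally have "\<tau> \<le> \<tau> powr (1 - s) * P" using \<tau> by simp
    then have "\<tau> powr (s - 1) * \<tau> \<le> \<tau> powr (s - 1) * (\<tau> powr (1 - s) * P)"
      by (intro mult_left_mono) auto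
    also have "\<dots> = P" using \<tau> by (simp add: mult.assoc[symmetric] powr_add[symmetric])
    also have "\<tau> powr (s - 1) * \<tau> = \<tau> powr s"
      using \<tau> powr_add[of \<tau> "s - 1" 1] by simp
    finally have sP: "\<tau> powr s \<le> P" .
    have "\<tau> powr r = \<tau> powr \<omega> * \<tau> powr s" by (simp add: powr_add[symmetric] s_def)
    also have "\<dots> \<le> A * P" using sP tA \<tau> A by (intro mult_mono) (auto simp: \<tau>_def t_def)
    also have "\<dots> \<le> 1 + A * P" by simp
    finally have "2 powr r * \<tau> powr r \<le> 2 powr r * (1 + A * P)" by (intro mult_left_mono) auto
    then show ?thesis using \<tau> by (simp add: powr_mult)
  qed
  finally show ?thesis by (simp add: P_def)
qed

lemma powr_young:
  fixes x y q :: real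
  assumes "0 \<le> x" "0 \<le> y" "1 \<le> q"
  shows "x powr (q - 1) * y \<le> x powr q + y powr q"
proof (cases "y \<le> x")
  case True
  have "x powr (q - 1) * y \<le> x powr (q - 1) * x" using True by (intro mult_left_mono) auto
  also have "\<dots> = x powr q" using assms powr_add[of x "q - 1" 1] by (cases "x = 0") auto
  finally show ?thesis by (simp add: add_increasing2)
next
  case False
  have "x powr (q - 1) * y \<le> y powr (q - 1) * y" using False assms by (intro mult_right_mono powr_mono2) auto
  also have "\<dots> = y powr q" using assms False powr_add[of y "q - 1" 1] by (cases "y = 0") auto
  finally show ?thesis by (simp add: add_increasing)
qed

lemma L1_tendsto_lebesgue_on:
  fixes f :: "'b::euclidean_space \<Rightarrow> real"
  assumes Q: "open Q" and L: "L1_tendsto lebesgue F f"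
  shows "L1_tendsto (lebesgue_on Q) F f"
proof -
  note L = L1_tendstoD[OF L]
  have Qm: "Q \<in> sets lebesgue" using Q by auto
  have i: "integrable (lebesgue_on Q) g" if g: "integrable lebesgue g" for g :: "'b \<Rightarrow> real"
    using integrable_mult_indicator[OF Qm g] by (simp add: integrable_lebesgue_on_iff[OF Q])
  have "(\<lambda>k. LINT x|lebesgue_on Q. \<bar>F k x - f x\<bar>) \<longlonglongrightarrow> 0"
  proof (rule tendsto_sandwich[OF _ _ tendsto_const L(3)])
    show "\<forall>\<^sub>F k in sequentially. (LINT x|lebesgue_on Q. \<bar>F k x - f x\<bar>) \<le> (LINT x|lebesgue. \<bar>F k x - f x\<bar>)"
    proof (intro always_eventually allI)
      fix k
      have a: "integrable lebesgue (\<lambda>x. \<bar>F k x - f x\<bar>)" using L by auto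
      show "(LINT x|lebesgue_on Q. \<bar>F k x - f x\<bar>) \<le> (LINT x|lebesgue. \<bar>F k x - f x\<bar>)"
        unfolding integral_lebesgue_on_eq[OF Q]
        using integrable_mult_indicator[OF Qm a] a by (intro integral_mono) (auto simp: indicator_def)
    qed
  qed auto
  then show ?thesis using L i by (auto simp: L1_tendsto_def)
qed

text \<open>This is where log-Hoelder continuity enters. A function \<open>a\<close> of growth \<open>w powr (q - 1)\<close> lies in the
  dual variable exponent space, and by Young's inequality \<open>\<bar>a * mollify \<delta> f\<bar>\<close> is bounded by
  \<open>w powr q + \<bar>mollify \<delta> f\<bar> powr q\<close>. The modular estimate replaces the last term by a mollification of
  \<open>\<bar>f\<bar> powr q\<close>, which converges in mean.\<close>

lemma mollify_pairing_L1_tendsto: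
  fixes f :: "'b::euclidean_space \<Rightarrow> real"
  assumes Q: "open Q" "bounded Q"
    and q: "\<And>z. z \<in> Q \<Longrightarrow> 1 \<le> q z" "\<And>z. z \<in> Q \<Longrightarrow> q z \<le> q_plus"
    and C: "0 \<le> C" and lh: "\<And>y z. \<lbrakk>y \<in> Q; z \<in> Q; y \<noteq> z\<rbrakk> \<Longrightarrow> \<bar>q y - q z\<bar> \<le> C / ln (exp 1 + 1 / dist y z)"
    and f: "integrable lebesgue f" "\<And>z. z \<notin> Q \<Longrightarrow> f z = 0" "integrable lebesgue (\<lambda>y. \<bar>f y\<bar> powr q y)"
    and a: "a \<in> borel_measurable (lebesgue_on Q)" "AE z in lebesgue_on Q. \<bar>a z\<bar> \<le> c * w z powr (q z - 1)" "0 \<le> c"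
    and w: "\<And>z. 0 \<le> w z" "integrable (lebesgue_on Q) (\<lambda>z. w z powr q z)"
    and d: "\<And>j. 0 < \<delta> j" "\<And>j. \<delta> j \<le> 1" "\<delta> \<longlonglongrightarrow> 0"
    and ae: "AE z in lebesgue_on Q. (\<lambda>j. mollify (\<delta> j) f z) \<longlonglongrightarrow> f z"
  shows "L1_tendsto (lebesgue_on Q) (\<lambda>j z. a z * mollify (\<delta> j) f z) (\<lambda>z. a z * f z)"
proof -
  let ?M = "lebesgue_on Q"
  define n where "n = DIM('b)"
  define K0 where "K0 = 2 * 2 ^ n / unit_ball_vol (real n)"
  define N where "N = (LINT y|lebesgue. \<bar>f y\<bar>)"
  have K0: "0 \<le> K0" by (simp add: K0_def)
  have N: "0 \<le> N" by (simp add: N_def)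
  \<comment> \<open>The summand \<open>1\<close> makes \<open>ln K\<close> nonnegative.\<close>
  define K where "K = K0 * N + 1"
  have K: "1 \<le> K" using K0 N by (simp add: K_def)
  define A where "A = exp (C * (ln K + real n))"
  have A: "1 \<le> A" using C K by (simp add: A_def)
  have fa: "integrable lebesgue (\<lambda>y. \<bar>f y\<bar>)" using f(1) by simp
  define P where "P j z = mollify (\<delta> j) (\<lambda>y. \<bar>f y\<bar> powr q y) z" for j z
  have tb: "mollify \<delta>' (\<lambda>y. \<bar>f y\<bar>) z \<le> K / \<delta>' ^ n" if d': "0 < \<delta>'" for \<delta>' z
  proof -
    have "mollify \<delta>' (\<lambda>y. \<bar>f y\<bar>) z \<le> (LINT y|lebesgue. K0 / \<delta>' ^ n * \<bar>f y\<bar>)"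
      unfolding mollify_def
      using mollifier_bound[OF d', where 'b='b] fa integrable_mollify[OF d' fa]
      by (intro integral_mono mult_right_mono integrable_mult_right) (auto simp: K0_def n_def)
    also have "\<dots> = K0 * N / \<delta>' ^ n" by (simp add: N_def)
    also have "\<dots> \<le> K / \<delta>' ^ n" using d' by (intro divide_right_mono) (auto simp: K_def)
    finally show ?thesis .
  qed
  have pw: "\<bar>mollify (\<delta> j) f z\<bar> powr q z \<le> 2 powr q_plus * (1 + A * P j z)" if z: "z \<in> Q" for j z
  proof -
    have P0: "0 \<le> P j z" unfolding P_def mollify_def
      by (intro integral_nonneg_AE AE_I2 mult_nonneg_nonneg mollifier_nonneg[OF d(1)]) auto
    have "\<bar>mollify (\<delta> j) f z\<bar> powr q z \<le> 2 powr q z * (1 + A * mollify (\<delta> j) (\<lambda>y. \<bar>f y\<bar> powr q y) z)"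
    proof (rule mollify_powr_bound[OF d(1) f(1,3), where \<omega>="C / ln (exp 1 + 1 / \<delta> j)"])
      fix y assume y: "f y \<noteq> 0"
      then have yQ: "y \<in> Q" using f(2) by auto
      then show "1 \<le> q y" by (rule q)
      assume yb: "y \<in> ball z (\<delta> j)"
      have "(1::real) < exp 1" "0 < 1 / \<delta> j" using d(1)[of j] by auto
      then have "1 < exp 1 + 1 / \<delta> j" by linarith
      then have l0: "0 < ln (exp 1 + 1 / \<delta> j)" by (rule ln_gt_zero)
      show "q z - C / ln (exp 1 + 1 / \<delta> j) \<le> q y"
      proof (cases "y = z")
        case True
        then show ?thesis using C l0 by simp
      next
        case False
        have "\<bar>q y - q z\<bar> \<le> C / ln (exp 1 + 1 / dist y z)" by (rule lh[OF yQ z False])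
        also have "\<dots> \<le> C / ln (exp 1 + 1 / \<delta> j)"
        proof (intro divide_left_mono C)
          show "ln (exp 1 + 1 / \<delta> j) \<le> ln (exp 1 + 1 / dist y z)"
            using yb False d(1)[of j] by (subst ln_le_cancel_iff) (auto intro!: add_pos_pos frac_le simp: dist_commute)
          then show "0 < ln (exp 1 + 1 / dist y z) * ln (exp 1 + 1 / \<delta> j)" using l0 by simp
        qed
        finally show ?thesis by simp
      qed
    next
      let ?t = "mollify (\<delta> j) (\<lambda>y. \<bar>f y\<bar>) z"
      assume t: "1 \<le> ?t / 2"
      show "(?t / 2) powr (C / ln (exp 1 + 1 / \<delta> j)) \<le> A"
        unfolding A_def
        using t tb[OF d(1), of j z] by (intro powr_log_bounded[OF C K d(1,2) t]) linarith
    qed (use q(1)[OF z] A in auto)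
    also have "\<dots> \<le> 2 powr q_plus * (1 + A * P j z)"
      unfolding P_def[symmetric] using q(2)[OF z] A P0 by (intro mult_right_mono powr_mono) auto
    finally show ?thesis .
  qed
  define h where "h j z = c * (w z powr q z + 2 powr q_plus * (1 + A * P j z))" for j z
  define h0 where "h0 z = c * (w z powr q z + 2 powr q_plus * (1 + A * \<bar>f z\<bar> powr q z))" for z
  have LP: "L1_tendsto ?M P (\<lambda>y. \<bar>f y\<bar> powr q y)"
    unfolding P_def[abs_def] by (intro L1_tendsto_lebesgue_on mollify_L1_tendsto Q f(3) d(1,3))
  note fm = integrable_const_on_bounded[OF Q]
  have Lh: "L1_tendsto ?M h h0"
  proof -
    have 1: "integrable ?M (\<lambda>z. c * (w z powr q z + 2 powr q_plus))"
      by (intro integrable_mult_right Bochner_Integration.integrable_add w(2) fm)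
    have 2: "L1_tendsto ?M (\<lambda>j z. (c * 2 powr q_plus * A) * P j z) (\<lambda>z. (c * 2 powr q_plus * A) * \<bar>f z\<bar> powr q z)"
      by (rule L1_tendsto_mult_bounded_const[OF LP, where K="\<bar>c * 2 powr q_plus * A\<bar>"]) auto
    show ?thesis using L1_tendsto_add[OF L1_tendsto_const[OF 1] 2]
      by (simp add: h_def[abs_def] h0_def[abs_def] algebra_simps)
  qed
  have aq: "\<bar>a z * x\<bar> \<le> c * (w z powr q z + \<bar>x\<bar> powr q z)" if z: "z \<in> Q" and az: "\<bar>a z\<bar> \<le> c * w z powr (q z - 1)" for z x
  proof -
    have "\<bar>a z * x\<bar> \<le> (c * w z powr (q z - 1)) * \<bar>x\<bar>"
      unfolding abs_mult using az by (intro mult_right_mono) auto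
    also have "\<dots> \<le> c * (w z powr q z + \<bar>x\<bar> powr q z)"
      unfolding mult.assoc using a(3) powr_young[OF w(1)[of z] abs_ge_zero[of x] q(1)[OF z]] by (intro mult_left_mono) auto
    finally show ?thesis .
  qed
  show ?thesis
  proof (rule L1_tendsto_dominated[OF _ _ _ Lh])
    show "(\<lambda>z. a z * mollify (\<delta> j) f z) \<in> borel_measurable ?M" for j
      by (intro borel_measurable_times a(1) measurable_lebesgue_onI measurable_mollify d(1) f(1))
    have "f \<in> borel_measurable ?M" using f(1) by (intro measurable_restrict_space1) auto
    then show "(\<lambda>z. a z * f z) \<in> borel_measurable ?M"
      by (intro borel_measurable_times a(1))
    show "AE z in ?M. (\<lambda>j. a z * mollify (\<delta> j) f z) \<longlonglongrightarrow> a z * f z"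
      using ae by eventually_elim (intro tendsto_intros)
    show "AE z in ?M. \<bar>a z * mollify (\<delta> j) f z\<bar> \<le> h j z" for j
      using a(2) AE_space
    proof eventually_elim
      case (elim z)
      then have z: "z \<in> Q" by simp
      have "\<bar>a z * mollify (\<delta> j) f z\<bar> \<le> c * (w z powr q z + \<bar>mollify (\<delta> j) f z\<bar> powr q z)" by (rule aq[OF z elim(1)])
      also have "\<dots> \<le> h j z" unfolding h_def using a(3) pw[OF z, of j] by (intro mult_left_mono add_left_mono) auto
      finally show "\<bar>a z * mollify (\<delta> j) f z\<bar> \<le> h j z" .
    qed
    show "AE z in ?M. \<bar>a z * f z\<bar> \<le> h0 z"
      using a(2) AE_space
    proof eventually_elim
      case (elim z)
      then have z: "z \<in> Q" by simp
      have qp: "0 \<le> q_plus" using q(1)[OF z] q(2)[OF z] by linarith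
      have "\<bar>f z\<bar> powr q z \<le> A * \<bar>f z\<bar> powr q z" using A mult_right_mono[of 1 A "\<bar>f z\<bar> powr q z"] by simp
      also have "\<dots> \<le> 2 powr q_plus * (1 + A * \<bar>f z\<bar> powr q z)"
        using mult_right_mono[of 1 "2 powr q_plus" "1 + A * \<bar>f z\<bar> powr q z"] qp A by (simp add: ge_one_powr_ge_zero)
      finally have *: "\<bar>f z\<bar> powr q z \<le> 2 powr q_plus * (1 + A * \<bar>f z\<bar> powr q z)" .
      have "\<bar>a z * f z\<bar> \<le> c * (w z powr q z + \<bar>f z\<bar> powr q z)" by (rule aq[OF z elim(1)])
      also have "\<dots> \<le> h0 z" unfolding h0_def using a(3) * by (intro mult_left_mono add_left_mono) auto
      finally show "\<bar>a z * f z\<bar> \<le> h0 z" .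
    qed
  qed
qed

section \<open>Powers of a weakly differentiable function\<close>

text \<open>The derivative of \<open>s \<mapsto> s powr m\<close> on \<open>s \<ge> 0\<close>. The case \<open>m = 1\<close> is separate because \<open>0 powr 0 = 0\<close>,
  whereas the one-sided derivative of \<open>s\<close> at \<open>0\<close> is \<open>1\<close>.\<close>

definition powr_deriv :: "real \<Rightarrow> real \<Rightarrow> real" where
  "powr_deriv m s = (if m = 1 then 1 else m * s powr (m - 1))"

text \<open>The chain rule wants a function with bounded derivative on the whole line. On the range \<open>[0, M]\<close> of
  the solution the power agrees with the primitive of its clamped derivative.\<close>

lemma truncated_power:
  fixes m M :: real
  assumes m: "1 \<le> m" and M: "0 < M"
  obtains H H' B where "\<And>s. (H has_real_derivative H' s) (at s)" "continuous_on UNIV H'"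
    "\<And>s. \<bar>H' s\<bar> \<le> B" "\<And>s. 0 \<le> s \<Longrightarrow> s \<le> M \<Longrightarrow> H s = s powr m \<and> H' s = powr_deriv m s"
proof (cases "m = 1")
  case True
  show ?thesis
    by (rule that[of "\<lambda>s. s" "\<lambda>s. 1" 1]) (auto simp: True powr_deriv_def intro!: derivative_eq_intros)
next
  case False
  then have m1: "0 < m - 1" using m by simp
  define cl where "cl s = max 0 (min M s)" for s
  define H' where "H' s = m * cl s powr (m - 1)" for s
  have cl: "0 \<le> cl s" "cl s \<le> M" for s using M by (auto simp: cl_def)
  have cH': "continuous_on UNIV H'"
    unfolding H'_def cl_def using m1 M by (intro continuous_intros continuous_on_powr') auto
  have "\<exists>F. \<forall>x. -\<infinity> < ereal x \<longrightarrow> ereal x < \<infinity> \<longrightarrow> (F has_vector_derivative H' x) (at x)"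
    by (rule einterval_antiderivative) (use cH' in \<open>auto simp: continuous_on_eq_continuous_at\<close>)
  then obtain F where F: "\<And>x. (F has_real_derivative H' x) (at x)"
    by (auto simp: has_real_derivative_iff_has_vector_derivative)
  have "F s - F 0 = s powr m" if s: "0 \<le> s" "s \<le> M" for s
  proof (cases "s = 0")
    case False
    then have s0: "0 < s" using s by simp
    have cont: "continuous_on {0..s} (\<lambda>x. F x - x powr m)"
      using m F by (intro continuous_intros continuous_on_powr')
        (auto intro: DERIV_isCont continuous_at_imp_continuous_on)
    have "(\<lambda>x. F x - x powr m) s = (\<lambda>x. F x - x powr m) 0"
    proof (rule DERIV_isconst2[OF s0 cont])
      fix x assume x: "0 < x" "x < s"
      have "cl x = x" using x s by (simp add: cl_def)
      then show "((\<lambda>x. F x - x powr m) has_real_derivative 0) (at x)"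
        using x by (auto intro!: derivative_eq_intros F simp: H'_def)
    qed (use s0 in auto)
    then show ?thesis using m by simp
  qed (use m in simp)
  moreover have "H' s = powr_deriv m s" if "0 \<le> s" "s \<le> M" for s
    using that False by (simp add: H'_def cl_def powr_deriv_def)
  moreover have "\<bar>H' s\<bar> \<le> m * M powr (m - 1)" for s
    unfolding H'_def using cl[of s] m m1 by (simp add: abs_mult powr_mono2 mult_left_mono)
  moreover have "((\<lambda>s. F s - F 0) has_real_derivative H' s) (at s)" for s
    by (auto intro!: derivative_eq_intros F)
  ultimately show ?thesis
    by (intro that[OF _ cH', of "\<lambda>s. F s - F 0" "m * M powr (m - 1)"]) auto
qed

lemma integrable_locally_integrable:
  fixes Q :: "'b::euclidean_space set"
  assumes Q: "open Q" and f: "integrable (lebesgue_on Q) f"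
  shows "locally_integrable Q f"
  unfolding locally_integrable_def
proof (intro allI impI, elim conjE)
  fix K assume K: "compact K" "K \<subseteq> Q"
  have Km: "K \<in> sets lebesgue" using K by (auto simp: borel_compact)
  have "integrable lebesgue (\<lambda>z. indicator K z *\<^sub>R (indicator Q z * f z))"
    using f Km by (intro integrable_mult_indicator) (simp_all add: integrable_lebesgue_on_iff[OF Q])
  also have "(\<lambda>z. indicator K z *\<^sub>R (indicator Q z * f z)) = (\<lambda>z. indicator K z *\<^sub>R f z)"
    using K by (auto simp: fun_eq_iff indicator_def)
  finally show "integrable (lebesgue_on K) f"
    using Km by (subst integrable_restrict_space) auto
qed

lemma has_weak_deriv_power_mult:
  fixes Q :: "'b::euclidean_space set"
  assumes Q: "open Q" "bounded Q" and W: "W11_approx Q \<psi> u d" and e: "e \<in> Basis"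
    and u: "\<And>z. z \<in> Q \<Longrightarrow> 0 \<le> u z" "AE z in lebesgue_on Q. u z \<le> M" and M: "0 < M" and m: "1 \<le> m"
    and \<phi>: "\<phi> \<in> C01 Q"
  shows "has_weak_deriv Q e (\<lambda>z. u z powr m * \<phi> z)
     (\<lambda>z. powr_deriv m (u z) * d e z * \<phi> z + u z powr m * frechet_derivative \<phi> (at z) e)"
proof -
  let ?M = "lebesgue_on Q"
  obtain H H' B where H: "\<And>s. (H has_real_derivative H' s) (at s)" "continuous_on UNIV H'"
    "\<And>s. \<bar>H' s\<bar> \<le> B" and Hu: "\<And>s. 0 \<le> s \<Longrightarrow> s \<le> M \<Longrightarrow> H s = s powr m \<and> H' s = powr_deriv m s"
    using truncated_power[OF m M] by blast
  have ae: "AE z in ?M. H (u z) = u z powr m \<and> H' (u z) = powr_deriv m (u z)"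
    using u(2) AE_space by eventually_elim (auto intro!: Hu u(1))
  note ch = chain_rule[OF Q W e H \<phi>]
  have iu: "integrable ?M (\<lambda>z. H (u z))" "integrable ?M (\<lambda>z. H' (u z) * d e z)"
    using ch(1,2)[OF C1_fun_const[of 0]] by auto
  have um: "u \<in> borel_measurable ?M" "d e \<in> borel_measurable ?M"
    using L1_tendstoD(2)[OF W11_approxD(2)[OF W]] L1_tendstoD(2)[OF W11_approxD(3)[OF W e]] by auto
  have pm: "powr_deriv m \<in> borel_measurable borel" unfolding powr_deriv_def[abs_def] by measurable
  note [measurable] = um pm
  have [measurable]: "\<phi> \<in> borel_measurable ?M" "(\<lambda>z. frechet_derivative \<phi> (at z) e) \<in> borel_measurable ?M"
    by (intro measurable_lebesgue_onI C1_fun_measurable C1_fun_measurable_deriv C01_D[OF \<phi>])+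
  have [measurable]: "H \<in> borel_measurable borel" "H' \<in> borel_measurable borel"
    using H by (auto intro!: borel_measurable_continuous_onI DERIV_isCont continuous_at_imp_continuous_on)
  obtain B0 where B0: "\<And>z. \<bar>\<phi> z\<bar> \<le> B0" using C01_bounded[OF \<phi>] by blast
  obtain B1 where B1: "\<And>z. \<bar>frechet_derivative \<phi> (at z) e\<bar> \<le> B1" using C01_deriv_bounded[OF \<phi>] by blast
  let ?f = "\<lambda>z. u z powr m * \<phi> z"
  let ?g = "\<lambda>z. powr_deriv m (u z) * d e z * \<phi> z + u z powr m * frechet_derivative \<phi> (at z) e"
  have fm: "?f \<in> borel_measurable ?M" "?g \<in> borel_measurable ?M" by measurable
  have i1: "integrable ?M (\<lambda>z. \<phi> z * H (u z))"
    by (rule integrable_mult_bounded[OF iu(1)]) (auto intro: B0)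
  have i2: "integrable ?M (\<lambda>z. \<phi> z * (H' (u z) * d e z))"
    by (rule integrable_mult_bounded[OF iu(2)]) (auto intro: B0)
  have i3: "integrable ?M (\<lambda>z. frechet_derivative \<phi> (at z) e * H (u z))"
    by (rule integrable_mult_bounded[OF iu(1)]) (auto intro: B1)
  have if': "integrable ?M ?f"
    using i1 fm ae by (subst integrable_cong_AE[of _ _ "\<lambda>z. \<phi> z * H (u z)"]) (auto elim!: eventually_mono)
  have ig: "integrable ?M ?g"
  proof (rule integrable_cong_AE_imp[OF Bochner_Integration.integrable_add[OF i2 i3] fm(2)])
    show "AE z in ?M. \<phi> z * (H' (u z) * d e z) + frechet_derivative \<phi> (at z) e * H (u z) = ?g z"
      using ae by eventually_elim (simp add: ac_simps)
  qed
  show ?thesis unfolding has_weak_deriv_def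
  proof (intro conjI ballI integrable_locally_integrable Q(1) if' ig)
    fix \<theta> assume \<theta>: "\<theta> \<in> C01 Q"
    note C\<theta> = C01_D(1)[OF \<theta>]
    have [measurable]: "\<theta> \<in> borel_measurable ?M" "(\<lambda>z. frechet_derivative \<theta> (at z) e) \<in> borel_measurable ?M"
      by (intro measurable_lebesgue_onI C1_fun_measurable C1_fun_measurable_deriv C\<theta>)+
    have ae1: "AE z in ?M. ?f z * frechet_derivative \<theta> (at z) e = H (u z) * \<phi> z * frechet_derivative \<theta> (at z) e"
      using ae by eventually_elim simp
    have ae2: "AE z in ?M. (H' (u z) * d e z * \<phi> z + H (u z) * frechet_derivative \<phi> (at z) e) * \<theta> z = ?g z * \<theta> z"
      using ae by eventually_elim simp
    have "(LINT z|?M. ?f z * frechet_derivative \<theta> (at z) e) = (LINT z|?M. H (u z) * \<phi> z * frechet_derivative \<theta> (at z) e)"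
      by (rule integral_cong_AE[OF _ _ ae1]) measurable
    also have "\<dots> = - (LINT z|?M. (H' (u z) * d e z * \<phi> z + H (u z) * frechet_derivative \<phi> (at z) e) * \<theta> z)"
      by (rule ch(3)[OF C\<theta>])
    also have "(LINT z|?M. (H' (u z) * d e z * \<phi> z + H (u z) * frechet_derivative \<phi> (at z) e) * \<theta> z) = (LINT z|?M. ?g z * \<theta> z)"
      by (rule integral_cong_AE[OF _ _ ae2]) measurable
    finally show "(LINT z|?M. ?f z * frechet_derivative \<theta> (at z) e) = - (LINT z|?M. ?g z * \<theta> z)" .
  qed
qed

text \<open>Differentiating the kernel under the integral and moving the derivative over by the chain rule shows
  that mollification commutes with weak differentiation.\<close>

lemma mollify_chain:
  fixes Q :: "'b::euclidean_space set"
  assumes Q: "open Q" "bounded Q" and W: "W11_approx Q \<psi> u d"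
    and e: "e \<in> Basis"
    and H: "\<And>s. (H has_real_derivative H' s) (at s)" "continuous_on UNIV H'" "\<And>s. \<bar>H' s\<bar> \<le> B"
    and \<zeta>: "\<zeta> \<in> C01 Q" and \<delta>: "0 < \<delta>"
  defines "f \<equiv> \<lambda>z. indicator Q z * (H (u z) * \<zeta> z)"
    and "g \<equiv> \<lambda>z. indicator Q z * (H' (u z) * d e z * \<zeta> z + H (u z) * frechet_derivative \<zeta> (at z) e)"
  shows "integrable lebesgue f" "integrable lebesgue g"
    "frechet_derivative (mollify \<delta> f) (at z) e = mollify \<delta> g z"
proof -
  let ?M = "lebesgue_on Q"
  note ch = chain_rule[OF Q W e H \<zeta>]
  have iu: "integrable ?M (\<lambda>z. H (u z))" "integrable ?M (\<lambda>z. H' (u z) * d e z)"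
    using ch(1,2)[OF C1_fun_const[of 0]] by auto
  have [measurable]: "\<zeta> \<in> borel_measurable ?M" "(\<lambda>z. frechet_derivative \<zeta> (at z) e) \<in> borel_measurable ?M"
    by (intro measurable_lebesgue_onI C1_fun_measurable C1_fun_measurable_deriv C01_D[OF \<zeta>])+
  obtain B0 where B0: "\<And>z. \<bar>\<zeta> z\<bar> \<le> B0" using C01_bounded[OF \<zeta>] by blast
  obtain B1 where B1: "\<And>z. \<bar>frechet_derivative \<zeta> (at z) e\<bar> \<le> B1" using C01_deriv_bounded[OF \<zeta>] by blast
  have i1: "integrable ?M (\<lambda>z. \<zeta> z * H (u z))"
    by (rule integrable_mult_bounded[OF iu(1)]) (auto intro: B0)
  have i2: "integrable ?M (\<lambda>z. \<zeta> z * (H' (u z) * d e z))"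
    by (rule integrable_mult_bounded[OF iu(2)]) (auto intro: B0)
  have i3: "integrable ?M (\<lambda>z. frechet_derivative \<zeta> (at z) e * H (u z))"
    by (rule integrable_mult_bounded[OF iu(1)]) (auto intro: B1)
  show f: "integrable lebesgue f"
    using i1 unfolding f_def integrable_lebesgue_on_iff[OF Q(1)] by (simp add: mult.commute)
  show g: "integrable lebesgue g"
    using Bochner_Integration.integrable_add[OF i2 i3] unfolding g_def integrable_lebesgue_on_iff[OF Q(1)] by (simp add: ac_simps)
  have "(LINT y|lebesgue. bump_deriv \<delta> (z - y) e * f y) = - (LINT y|?M. H (u y) * \<zeta> y * (- bump_deriv \<delta> (z - y) e))"
    unfolding integral_lebesgue_on_eq[OF Q(1)] f_def by (simp add: ac_simps)
  also have "\<dots> = (LINT y|?M. (H' (u y) * d e y * \<zeta> y + H (u y) * frechet_derivative \<zeta> (at y) e) * bump \<delta> (z - y))"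
    using ch(3)[OF bump_reflect_C1(1)[OF \<delta>, of z]] unfolding bump_reflect_C1(2)[OF \<delta>] by simp
  also have "\<dots> = (LINT y|lebesgue. bump \<delta> (z - y) * g y)"
    unfolding integral_lebesgue_on_eq[OF Q(1)] g_def by (simp add: ac_simps)
  finally show "frechet_derivative (mollify \<delta> f) (at z) e = mollify \<delta> g z"
    unfolding frechet_derivative_mollify[OF \<delta> f] by (simp add: mollify_def mollifier_def)
qed

lemma mollify_C01:
  fixes Q :: "'b::euclidean_space set"
  assumes \<delta>: "0 < \<delta>" and f: "integrable lebesgue f" and Z: "compact Z" "\<And>z. z \<notin> Z \<Longrightarrow> f z = 0"
    and sub: "(\<Union>z\<in>Z. cball z \<delta>) \<subseteq> Q"
  shows "mollify \<delta> f \<in> C01 Q"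
proof (rule C01_I[OF mollify_C1[OF \<delta> f] compact_minkowski_sum_cball[OF Z(1)] sub])
  fix z assume z: "z \<notin> (\<Union>z\<in>Z. cball z \<delta>)"
  show "mollify \<delta> f z = 0"
  proof (rule mollify_zero[OF \<delta>])
    fix y assume "y \<in> ball z \<delta>"
    then have "y \<notin> Z" using z by (auto simp: dist_commute)
    then show "f y = 0" by (rule Z)
  qed
qed

lemma L1_tendsto_cong_AE:
  assumes L: "L1_tendsto M F f" and ae: "AE x in M. f x = g x" and g: "g \<in> borel_measurable M"
  shows "L1_tendsto M F g"
proof -
  note L = L1_tendstoD[OF L]
  have gi: "integrable M g" using L(2) ae g by (subst integrable_cong_AE[of _ _ f]) (auto elim!: eventually_mono)
  have "(LINT x|M. \<bar>F k x - g x\<bar>) = (LINT x|M. \<bar>F k x - f x\<bar>)" for k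
    by (rule integral_cong_AE) (use L(1)[of k] L(2) g ae in \<open>auto elim!: eventually_mono\<close>)
  then show ?thesis using L gi by (simp add: L1_tendsto_def)
qed

lemma L1_tendsto_AE_subseq_finite:
  assumes "finite I" "\<And>i. i \<in> I \<Longrightarrow> L1_tendsto M (F i) (f i)"
  obtains r :: "nat \<Rightarrow> nat" where "strict_mono r" "\<And>i. i \<in> I \<Longrightarrow> AE x in M. (\<lambda>k. F i (r k) x) \<longlonglongrightarrow> f i x"
proof -
  have "\<exists>r :: nat \<Rightarrow> nat. strict_mono r \<and> (\<forall>i\<in>I. AE x in M. (\<lambda>k. F i (r k) x) \<longlonglongrightarrow> f i x)"
    using assms
  proof (induction I rule: finite_induct)
    case empty
    show ?case by (auto intro: exI[of _ id] simp: strict_mono_def)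
  next
    case (insert i I)
    then obtain r :: "nat \<Rightarrow> nat" where r: "strict_mono r" "\<forall>i\<in>I. AE x in M. (\<lambda>k. F i (r k) x) \<longlonglongrightarrow> f i x" by auto
    from L1_tendsto_AE_subseq[OF L1_tendsto_subseq[OF insert.prems[of i] r(1)]]
    obtain s :: "nat \<Rightarrow> nat" where s: "strict_mono s" "AE x in M. (\<lambda>k. F i (r (s k)) x) \<longlonglongrightarrow> f i x" by auto
    have "AE x in M. (\<lambda>k. F j (r (s k)) x) \<longlonglongrightarrow> f j x" if "j \<in> I" for j
      using r(2)[rule_format, OF that]
      by eventually_elim (use LIMSEQ_subseq_LIMSEQ[OF _ s(1)] in \<open>force simp: o_def\<close>)
    then show ?case using s strict_mono_o[OF r(1) s(1)]
      by (intro exI[of _ "r \<circ> s"]) (auto simp: o_def)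
  qed
  then show ?thesis using that by auto
qed

section \<open>Testing the equation with functions of the solution\<close>

lemma spatial_in_Basis: "b \<in> Basis \<Longrightarrow> (b, 0) \<in> (Basis :: ('a::euclidean_space \<times> real) set)"
  by (simp add: Basis_prod_def)

lemma powr_deriv_bound: "1 \<le> m \<Longrightarrow> 0 \<le> s \<Longrightarrow> s \<le> M \<Longrightarrow> \<bar>powr_deriv m s\<bar> \<le> 1 + m * M powr (m - 1)"
  by (auto simp: powr_deriv_def abs_mult intro!: add_increasing mult_left_mono powr_mono2)

text \<open>Where \<open>v = 0\<close> both sides vanish, since \<open>0 powr r = 0\<close>.\<close>

lemma powr_two_inner:
  fixes v :: "'a::real_inner"
  shows "norm v powr (r - 2) * (v \<bullet> v) = norm v powr r"
proof (cases "v = 0")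
  case False
  then show ?thesis using powr_add[of "norm v" "r - 2" 2]
    by (simp add: power2_norm_eq_inner[symmetric] powr_numeral)
qed simp

lemma powr_flux_bound:
  fixes v b :: "'a::real_inner"
  assumes "norm b = 1"
  shows "norm v powr (r - 2) * \<bar>v \<bullet> b\<bar> \<le> norm v powr (r - 1)"
proof (cases "v = 0")
  case False
  have "norm v powr (r - 2) * \<bar>v \<bullet> b\<bar> \<le> norm v powr (r - 2) * norm v"
    using Cauchy_Schwarz_ineq2[of v b] assms by (intro mult_left_mono) auto
  also have "\<dots> = norm v powr (r - 1)" using False powr_add[of "norm v" "r - 2" 1] by simp
  finally show ?thesis .
qed simp

lemma powr_le_one_plus:
  fixes x r :: real
  assumes "0 \<le> x" "1 \<le> r"
  shows "x powr (r - 1) \<le> 1 + x powr r"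
  using powr_young[of x 1 r] assms by simp

text \<open>The analytic content of a weak solution on \<open>Q\<close>: \<open>Du\<close> and \<open>ut\<close> are its weak derivatives in space and
  in time, combined into one family of directional derivatives for the approximants \<open>\<psi>\<close>; \<open>q\<close> is the
  exponent as a function on \<open>Q\<close>, with log-Hoelder constant \<open>C\<close>.\<close>

locale degenerate_equation =
  fixes Q :: "('a::euclidean_space \<times> real) set" and q :: "'a \<times> real \<Rightarrow> real"
    and u ut :: "'a \<times> real \<Rightarrow> real" and Du :: "'a \<times> real \<Rightarrow> 'a"
    and \<psi> :: "nat \<Rightarrow> 'a \<times> real \<Rightarrow> real" and m M q_plus C :: real
  assumes Q: "open Q" "bounded Q"
    and W: "W11_approx Q \<psi> u (\<lambda>e z. Du z \<bullet> fst e + ut z * snd e)"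
    and u_nonneg: "\<And>z. z \<in> Q \<Longrightarrow> 0 \<le> u z" and u_le: "AE z in lebesgue_on Q. u z \<le> M"
    and M: "0 < M" and m: "1 \<le> m"
    and q_measurable [measurable]: "q \<in> borel_measurable (lebesgue_on Q)"
    and q: "\<And>z. z \<in> Q \<Longrightarrow> 1 \<le> q z" "\<And>z. z \<in> Q \<Longrightarrow> q z \<le> q_plus"
    and C: "0 \<le> C"
    and q_log: "\<And>y z. \<lbrakk>y \<in> Q; z \<in> Q; y \<noteq> z\<rbrakk> \<Longrightarrow> \<bar>q y - q z\<bar> \<le> C / ln (exp 1 + 1 / dist y z)"
    and Du_integrable: "integrable (lebesgue_on Q) (\<lambda>z. norm (Du z) powr q z)"
    and weak: "\<And>\<phi>. \<phi> \<in> C01 Q \<Longrightarrow>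
       (LINT z|lebesgue_on Q. ut z * \<phi> z) +
       (LINT z|lebesgue_on Q. (norm (Du z) powr (q z - 2) *\<^sub>R Du z) \<bullet>
          space_grad Q (\<lambda>y. u y powr m * \<phi> y) z) = 0"
begin

abbreviation LQ :: "('a \<times> real) measure" where "LQ \<equiv> lebesgue_on Q"

abbreviation space_deriv :: "('a \<times> real \<Rightarrow> real) \<Rightarrow> 'a \<times> real \<Rightarrow> 'a \<Rightarrow> real" where
  "space_deriv \<phi> z b \<equiv> frechet_derivative \<phi> (at z) (b, 0)"

text \<open>The component in the direction \<open>b\<close> of \<open>u\<^sup>m |Du|\<^sup>q\<^sup>-\<^sup>2 Du\<close>.\<close>

definition flux :: "'a \<Rightarrow> 'a \<times> real \<Rightarrow> real" where
  "flux b z = u z powr m * (norm (Du z) powr (q z - 2) * (Du z \<bullet> b))"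

text \<open>The terms of the equation that are left undifferentiated when \<open>D(u\<^sup>m \<phi>)\<close> is expanded.\<close>

definition source :: "'a \<times> real \<Rightarrow> real" where
  "source z = ut z + powr_deriv m (u z) * norm (Du z) powr q z"

lemma u_integrable: "integrable LQ u"
  using L1_tendstoD(2)[OF W11_approxD(2)[OF W]] .

lemma ut_integrable: "integrable LQ ut"
  using L1_tendstoD(2)[OF W11_approxD(3)[OF W, of "(0, 1)"]] by (simp add: Basis_prod_def)

lemma Du_inner_integrable: "b \<in> Basis \<Longrightarrow> integrable LQ (\<lambda>z. Du z \<bullet> b)"
  using L1_tendstoD(2)[OF W11_approxD(3)[OF W, OF spatial_in_Basis]] by simp

lemma u_measurable [measurable]: "u \<in> borel_measurable LQ"
  using u_integrable by auto

lemma ut_measurable [measurable]: "ut \<in> borel_measurable LQ"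
  using ut_integrable by auto

lemma Du_measurable [measurable]: "Du \<in> borel_measurable LQ"
  using Du_inner_integrable by (subst borel_measurable_euclidean_space) auto

lemma powr_deriv_measurable [measurable]: "powr_deriv m \<in> borel_measurable borel"
  unfolding powr_deriv_def[abs_def] by measurable

lemmas integrable_const_Q = integrable_const_on_bounded[OF Q]

lemma flux_bound: "b \<in> Basis \<Longrightarrow> AE z in LQ. \<bar>flux b z\<bar> \<le> M powr m * norm (Du z) powr (q z - 1)"
  using u_le AE_space
proof eventually_elim
  case (elim z)
  then have "0 \<le> u z" using u_nonneg by simp
  then have "u z powr m \<le> M powr m" using elim m by (intro powr_mono2) auto
  then show ?case
    using powr_flux_bound[of b "Du z" "q z"] elim
    unfolding flux_def abs_mult by (intro mult_mono) auto
qed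

lemma flux_measurable [measurable]: "flux b \<in> borel_measurable LQ"
  unfolding flux_def[abs_def] by measurable

lemma flux_integrable: "b \<in> Basis \<Longrightarrow> integrable LQ (flux b)"
proof (rule Bochner_Integration.integrable_bound)
  assume b: "b \<in> Basis"
  show "integrable LQ (\<lambda>z. M powr m * (1 + norm (Du z) powr q z))"
    by (intro integrable_mult_right Bochner_Integration.integrable_add integrable_const_Q Du_integrable)
  show "AE z in LQ. norm (flux b z) \<le> norm (M powr m * (1 + norm (Du z) powr q z))"
    using flux_bound[OF b] AE_space
  proof eventually_elim
    case (elim z)
    then have "M powr m * norm (Du z) powr (q z - 1) \<le> M powr m * (1 + norm (Du z) powr q z)"
      using q(1)[of z] by (intro mult_left_mono powr_le_one_plus) auto
    then show ?case using elim by simp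
  qed
qed auto

lemma powr_deriv_u_bound: "AE z in LQ. \<bar>powr_deriv m (u z)\<bar> \<le> 1 + m * M powr (m - 1)"
  using u_le AE_space by eventually_elim (auto intro!: powr_deriv_bound m u_nonneg)

lemma source_integrable: "integrable LQ source"
  unfolding source_def[abs_def]
  by (intro Bochner_Integration.integrable_add ut_integrable integrable_mult_bounded[OF Du_integrable _ powr_deriv_u_bound]) measurable

text \<open>The gradient of \<open>u\<^sup>m \<phi>\<close> is given by an arbitrary choice among weak gradients. The product rule
  provides one, so the choice is not vacuous, and uniqueness identifies it almost everywhere.\<close>

lemma space_grad_power_mult:
  assumes \<phi>: "\<phi> \<in> C01 Q"
  shows "space_grad Q (\<lambda>y. u y powr m * \<phi> y) \<in> borel_measurable LQ"
    "AE z in LQ. space_grad Q (\<lambda>y. u y powr m * \<phi> y) z =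
     (\<Sum>b\<in>Basis. (powr_deriv m (u z) * (Du z \<bullet> b) * \<phi> z + u z powr m * space_deriv \<phi> z b) *\<^sub>R b)"
proof -
  let ?w = "\<lambda>y. u y powr m * \<phi> y"
  let ?g = "\<lambda>b z. powr_deriv m (u z) * (Du z \<bullet> b) * \<phi> z + u z powr m * space_deriv \<phi> z b"
  have wd: "has_weak_deriv Q (b, 0) ?w (?g b)" if b: "b \<in> Basis" for b
    using has_weak_deriv_power_mult[OF Q W spatial_in_Basis[OF b] u_nonneg u_le M m \<phi>] by simp
  have "has_space_grad Q ?w (\<lambda>z. \<Sum>b\<in>Basis. ?g b z *\<^sub>R b)"
    unfolding has_space_grad_def using wd by simp
  then have SG: "has_space_grad Q ?w (space_grad Q ?w)"
    unfolding space_grad_def by (rule someI[of "has_space_grad Q ?w"])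
  have "AE z in LQ. \<forall>b\<in>Basis. space_grad Q ?w z \<bullet> b = ?g b z"
  proof (rule AE_finite_allI)
    fix b :: 'a assume b: "b \<in> Basis"
    show "AE z in LQ. space_grad Q ?w z \<bullet> b = ?g b z"
      by (rule weak_deriv_unique[OF Q(1) _ wd[OF b]]) (use SG b in \<open>simp add: has_space_grad_def\<close>)
  qed simp
  then show "AE z in LQ. space_grad Q ?w z = (\<Sum>b\<in>Basis. ?g b z *\<^sub>R b)"
    by eventually_elim (rule euclidean_eqI, simp)
  show "space_grad Q ?w \<in> borel_measurable LQ"
    using SG by (subst borel_measurable_euclidean_space)
      (auto simp: has_space_grad_def has_weak_deriv_def intro!: locally_integrable_measurable[OF Q(1)])
qed

lemma weak_split:
  assumes \<phi>: "\<phi> \<in> C01 Q"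
  shows "(LINT z|LQ. source z * \<phi> z) + (\<Sum>b\<in>Basis. LINT z|LQ. flux b z * space_deriv \<phi> z b) = 0"
proof -
  let ?A = "\<lambda>z. norm (Du z) powr (q z - 2) *\<^sub>R Du z"
  let ?w = "\<lambda>y. u y powr m * \<phi> y"
  obtain B0 where B0: "\<And>z. \<bar>\<phi> z\<bar> \<le> B0" using C01_bounded[OF \<phi>] by blast
  have \<phi>m [measurable]: "\<phi> \<in> borel_measurable LQ" "\<And>b. (\<lambda>z. space_deriv \<phi> z b) \<in> borel_measurable LQ"
    by (intro measurable_lebesgue_onI C1_fun_measurable C1_fun_measurable_deriv C01_D[OF \<phi>])+
  have i1: "integrable LQ (\<lambda>z. \<phi> z * ut z)"
    by (rule integrable_mult_bounded[OF ut_integrable \<phi>m(1)]) (auto intro: B0)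
  have i2: "integrable LQ (\<lambda>z. \<phi> z * (powr_deriv m (u z) * norm (Du z) powr q z))"
    by (intro integrable_mult_bounded[OF _ \<phi>m(1)] integrable_mult_bounded[OF Du_integrable _ powr_deriv_u_bound]) (auto intro: B0)
  have i3: "integrable LQ (\<lambda>z. space_deriv \<phi> z b * flux b z)" if b: "b \<in> Basis" for b
  proof -
    obtain B1 where B1: "\<And>z. \<bar>space_deriv \<phi> z b\<bar> \<le> B1" using C01_deriv_bounded[OF \<phi>] by blast
    show ?thesis by (rule integrable_mult_bounded[OF flux_integrable[OF b] \<phi>m(2)]) (auto intro: B1)
  qed
  let ?R = "\<lambda>z. \<phi> z * (powr_deriv m (u z) * norm (Du z) powr q z) + (\<Sum>b\<in>Basis. space_deriv \<phi> z b * flux b z)"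
  have ae: "AE z in LQ. ?A z \<bullet> space_grad Q ?w z = ?R z"
    using space_grad_power_mult(2)[OF \<phi>]
  proof eventually_elim
    case (elim z)
    have "?A z \<bullet> space_grad Q ?w z
      = (\<Sum>b\<in>Basis. norm (Du z) powr (q z - 2) * (Du z \<bullet> b) * (powr_deriv m (u z) * (Du z \<bullet> b) * \<phi> z + u z powr m * space_deriv \<phi> z b))"
      unfolding elim by (simp add: inner_sum_right sum_distrib_left ac_simps)
    also have "\<dots> = (\<Sum>b\<in>Basis. \<phi> z * powr_deriv m (u z) * (norm (Du z) powr (q z - 2) * ((Du z \<bullet> b) * (Du z \<bullet> b))) + space_deriv \<phi> z b * flux b z)"
      by (intro sum.cong refl) (simp add: flux_def algebra_simps)
    also have "\<dots> = \<phi> z * powr_deriv m (u z) * (norm (Du z) powr (q z - 2) * (\<Sum>b\<in>Basis. (Du z \<bullet> b) * (Du z \<bullet> b))) + (\<Sum>b\<in>Basis. space_deriv \<phi> z b * flux b z)"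
      by (simp add: sum.distrib sum_distrib_left)
    also have "(\<Sum>b\<in>Basis. (Du z \<bullet> b) * (Du z \<bullet> b)) = Du z \<bullet> Du z"
      by (rule euclidean_inner[symmetric])
    finally show ?case by (simp add: powr_two_inner mult.assoc)
  qed
  have iR: "integrable LQ ?R"
    using i2 i3 by (intro Bochner_Integration.integrable_add Bochner_Integration.integrable_sum) auto
  have "(LINT z|LQ. ?A z \<bullet> space_grad Q ?w z) = (LINT z|LQ. ?R z)"
  proof -
    have "(\<lambda>z. ?A z \<bullet> space_grad Q ?w z) \<in> borel_measurable LQ"
      using space_grad_power_mult(1)[OF \<phi>] by measurable
    then show ?thesis using iR ae by (intro integral_cong_AE) auto
  qed
  also have "\<dots> = (LINT z|LQ. \<phi> z * (powr_deriv m (u z) * norm (Du z) powr q z)) + (\<Sum>b\<in>Basis. LINT z|LQ. space_deriv \<phi> z b * flux b z)"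
    using i2 i3 by (simp add: Bochner_Integration.integral_add Bochner_Integration.integral_sum Bochner_Integration.integrable_sum)
  finally have "(LINT z|LQ. ut z * \<phi> z) + ((LINT z|LQ. \<phi> z * (powr_deriv m (u z) * norm (Du z) powr q z)) + (\<Sum>b\<in>Basis. LINT z|LQ. space_deriv \<phi> z b * flux b z)) = 0"
    using weak[OF \<phi>] by simp
  moreover have "(LINT z|LQ. source z * \<phi> z) = (LINT z|LQ. \<phi> z * ut z) + (LINT z|LQ. \<phi> z * (powr_deriv m (u z) * norm (Du z) powr q z))"
    using i1 i2 by (simp add: source_def algebra_simps)
  ultimately show ?thesis by (simp add: mult.commute)
qed

end

lemma powr_affine_bound:
  fixes x B r r' :: real
  assumes "0 \<le> x" "1 \<le> B" "1 \<le> r" "r \<le> r'"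
  shows "(B * (x + 1)) powr r \<le> B powr r' * 2 powr r' * (x powr r + 1)"
proof -
  have "(x + 1) powr r \<le> (2 * max x 1) powr r" using assms by (intro powr_mono2) auto
  also have "\<dots> = 2 powr r * max x 1 powr r" using assms by (simp add: powr_mult)
  also have "max x 1 powr r \<le> x powr r + 1" using assms by (auto simp: max_def)
  finally have 1: "(x + 1) powr r \<le> 2 powr r * (x powr r + 1)" by (simp add: mult_left_mono)
  have "(B * (x + 1)) powr r = B powr r * (x + 1) powr r" using assms by (simp add: powr_mult)
  also have "\<dots> \<le> B powr r' * (2 powr r' * (x powr r + 1))"
  proof (intro mult_mono)
    show "B powr r \<le> B powr r'" using assms by (intro powr_mono) auto
    have "2 powr r * (x powr r + 1) \<le> 2 powr r' * (x powr r + 1)"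
      using assms by (intro mult_right_mono powr_mono) auto
    then show "(x + 1) powr r \<le> 2 powr r' * (x powr r + 1)" using 1 by linarith
  qed auto
  finally show ?thesis by (simp add: mult.assoc)
qed

context degenerate_equation
begin

text \<open>The equation says that the flux has the divergence \<open>source\<close>, tested against functions of class
  \<open>C\<^sup>1\<close>. It may be tested with \<open>g(u) \<zeta>\<close>: its mollifications are admissible, and their gradients are
  the mollified weak gradient, whose pairing with the flux converges.\<close>

lemma tested_identity:
  assumes g: "\<And>s. (g has_real_derivative g' s) (at s)" "continuous_on UNIV g'" "\<And>s. \<bar>g' s\<bar> \<le> B'"
    and gB: "\<And>s. \<bar>g s\<bar> \<le> B0"
    and \<zeta>: "\<zeta> \<in> C01 Q"
  shows "integrable LQ (\<lambda>z. source z * (g (u z) * \<zeta> z))"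
    "\<And>b. b \<in> Basis \<Longrightarrow> integrable LQ (\<lambda>z. flux b z * (g' (u z) * (Du z \<bullet> b) * \<zeta> z + g (u z) * space_deriv \<zeta> z b))"
    "(LINT z|LQ. source z * (g (u z) * \<zeta> z)) +
     (\<Sum>b\<in>Basis. LINT z|LQ. flux b z * (g' (u z) * (Du z \<bullet> b) * \<zeta> z + g (u z) * space_deriv \<zeta> z b)) = 0"
proof -
  define f where "f z = indicator Q z * (g (u z) * \<zeta> z)" for z
  define F where "F b z = indicator Q z * (g' (u z) * (Du z \<bullet> b) * \<zeta> z + g (u z) * space_deriv \<zeta> z b)" for b z
  have mc: "integrable lebesgue f" "integrable lebesgue (F b)" "0 < \<delta> \<Longrightarrow> space_deriv (mollify \<delta> f) z b = mollify \<delta> (F b) z"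
    if b: "b \<in> Basis" for \<delta> z b
    using mollify_chain(1,2)[OF Q W spatial_in_Basis[OF b] g \<zeta>, of 1] mollify_chain(3)[OF Q W spatial_in_Basis[OF b] g \<zeta>, of \<delta> z]
    unfolding f_def[abs_def] F_def[abs_def] by simp_all
  have fi: "integrable lebesgue f" using mc(1)[OF SOME_Basis] .
  obtain Z where Z: "compact Z" "Z \<subseteq> Q" and \<zeta>0: "\<And>z. z \<notin> Z \<Longrightarrow> \<zeta> z = 0"
    using C01_support[OF \<zeta>] by metis
  have f0: "f z = 0" if "z \<notin> Z" for z using \<zeta>0[OF that] by (simp add: f_def)
  obtain \<epsilon> where \<epsilon>: "0 < \<epsilon>" "(\<Union>z\<in>Z. cball z \<epsilon>) \<subseteq> Q"
    using compact_subset_open_imp_cball_epsilon_subset[OF Z(1) Q(1) Z(2)] by blast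
  \<comment> \<open>With radii of at most \<open>\<epsilon>\<close> all mollifications are supported in \<open>Q\<close>.\<close>
  define \<delta>' where "\<delta>' k = min 1 \<epsilon> * (1 / real (Suc k))" for k
  have d': "0 < \<delta>' k" "\<delta>' k \<le> min 1 \<epsilon>" for k
    using \<epsilon> mult_left_mono[of "1 / real (Suc k)" 1 "min 1 \<epsilon>"] by (auto simp: \<delta>'_def)
  have d'0: "\<delta>' \<longlonglongrightarrow> 0"
    unfolding \<delta>'_def using tendsto_mult_left[OF LIMSEQ_Suc[OF lim_1_over_n], of "min 1 \<epsilon>"] by simp
  \<comment> \<open>One subsequence has to serve \<open>f\<close> and all of its partial derivatives; \<open>None\<close> stands for \<open>f\<close>.\<close>
  define G where "G i = (case i of None \<Rightarrow> f | Some b \<Rightarrow> F b)" for i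
  have GI: "L1_tendsto lebesgue (\<lambda>k. mollify (\<delta>' k) (G i)) (G i)" if "i \<in> insert None (Some ` Basis)" for i
    using that fi mc(2) by (intro mollify_L1_tendsto d' d'0) (auto simp: G_def)
  obtain r :: "nat \<Rightarrow> nat" where r: "strict_mono r"
    "\<And>i. i \<in> insert None (Some ` Basis) \<Longrightarrow> AE x in lebesgue. (\<lambda>k. mollify (\<delta>' (r k)) (G i) x) \<longlonglongrightarrow> G i x"
    by (rule L1_tendsto_AE_subseq_finite[of "insert None (Some ` Basis)" lebesgue "\<lambda>i k. mollify (\<delta>' k) (G i)" G])
       (auto intro: GI)
  define \<delta> where "\<delta> j = \<delta>' (r j)" for j
  have d: "0 < \<delta> j" "\<delta> j \<le> 1" "\<delta> j \<le> \<epsilon>" for j using d'[of "r j"] by (auto simp: \<delta>_def)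
  have d0: "\<delta> \<longlonglongrightarrow> 0" using LIMSEQ_subseq_LIMSEQ[OF d'0 r(1)] by (simp add: \<delta>_def[abs_def] o_def)
  have aef: "AE x in LQ. (\<lambda>j. mollify (\<delta> j) f x) \<longlonglongrightarrow> f x"
    unfolding AE_lebesgue_on_iff[OF Q(1)] using r(2)[of None] by (auto simp: G_def \<delta>_def elim!: eventually_mono)
  have aeF: "AE x in LQ. (\<lambda>j. mollify (\<delta> j) (F b) x) \<longlonglongrightarrow> F b x" if "b \<in> Basis" for b
    unfolding AE_lebesgue_on_iff[OF Q(1)] using r(2)[of "Some b"] that by (auto simp: G_def \<delta>_def elim!: eventually_mono)
  obtain B\<zeta> where B\<zeta>: "0 \<le> B\<zeta>" "\<And>z. \<bar>\<zeta> z\<bar> \<le> B\<zeta>" using C01_bounded[OF \<zeta>] by blast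
  have B00: "0 \<le> B0" using gB[of 0] by simp
  have fB: "\<bar>f z\<bar> \<le> B0 * B\<zeta>" for z
    unfolding f_def abs_mult using mult_mono[OF gB[of "u z"] B\<zeta>(2)[of z]] B00 B\<zeta> by (auto simp: indicator_def)
  have mem: "mollify (\<delta> j) f \<in> C01 Q" for j
  proof (rule mollify_C01[OF d(1) fi Z(1) f0])
    have "cball z (\<delta> j) \<subseteq> cball z \<epsilon>" for z by (rule subset_cball[OF d(3)])
    then show "(\<Union>z\<in>Z. cball z (\<delta> j)) \<subseteq> Q" using \<epsilon>(2) by blast
  qed
  have L1: "L1_tendsto LQ (\<lambda>j z. mollify (\<delta> j) f z * source z) (\<lambda>z. f z * source z)"
  proof (rule L1_tendsto_mult_bounded[OF L1_tendsto_const[OF source_integrable] _ _ aef])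
    show "mollify (\<delta> j) f \<in> borel_measurable LQ" for j
      by (intro measurable_lebesgue_onI measurable_mollify d(1) fi)
    show "f \<in> borel_measurable LQ" using fi by (intro measurable_restrict_space1) auto
    show "AE z in LQ. \<bar>mollify (\<delta> j) f z\<bar> \<le> B0 * B\<zeta>" for j
      using mollify_close[OF d(1) fi, of _ j 0 "B0 * B\<zeta>"] fB by (intro AE_I2) simp
  qed
  have L2: "L1_tendsto LQ (\<lambda>j z. flux b z * mollify (\<delta> j) (F b) z) (\<lambda>z. flux b z * F b z)" if b: "b \<in> Basis" for b
  proof (rule mollify_pairing_L1_tendsto[OF Q q C q_log mc(2)[OF b] _ _ flux_measurable flux_bound[OF b] _ _ Du_integrable d(1,2) d0 aeF[OF b]])
    show "F b z = 0" if "z \<notin> Q" for z using that by (simp add: F_def)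
    obtain BD where BD: "0 \<le> BD" "\<And>z. \<bar>space_deriv \<zeta> z b\<bar> \<le> BD" using C01_deriv_bounded[OF \<zeta>] by blast
    define B where "B = B' * B\<zeta> + B0 * BD + 1"
    have B'0: "0 \<le> B'" using g(3)[of 0] by simp
    have B: "1 \<le> B" using B'0 B\<zeta> B00 BD by (simp add: B_def)
    have FB: "\<bar>F b z\<bar> \<le> B * (norm (Du z) + 1)" for z
    proof -
      have "\<bar>F b z\<bar> \<le> \<bar>g' (u z) * (Du z \<bullet> b) * \<zeta> z\<bar> + \<bar>g (u z) * space_deriv \<zeta> z b\<bar>"
        unfolding F_def by (auto simp: indicator_def intro: abs_triangle_ineq)
      also have "\<dots> \<le> B' * norm (Du z) * B\<zeta> + B0 * BD"
        unfolding abs_mult using g(3) gB B\<zeta> BD B'0 B00 b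
        by (intro add_mono mult_mono) (auto intro: Basis_le_norm)
      also have "\<dots> \<le> B * (norm (Du z) + 1)"
        using B'0 B\<zeta>(1) B00 BD(1) by (simp add: B_def algebra_simps)
      finally show ?thesis .
    qed
    have Fm: "F b \<in> borel_measurable LQ" using mc(2)[OF b] by (intro measurable_restrict_space1) auto
    note [measurable] = Fm
    have "integrable LQ (\<lambda>y. \<bar>F b y\<bar> powr q y)"
    proof (rule Bochner_Integration.integrable_bound)
      show "integrable LQ (\<lambda>z. B powr q_plus * 2 powr q_plus * (norm (Du z) powr q z + 1))"
        by (intro integrable_mult_right Bochner_Integration.integrable_add integrable_const_Q Du_integrable)
      show "(\<lambda>y. \<bar>F b y\<bar> powr q y) \<in> borel_measurable LQ" by measurable
      show "AE z in LQ. norm (\<bar>F b z\<bar> powr q z) \<le> norm (B powr q_plus * 2 powr q_plus * (norm (Du z) powr q z + 1))"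
      proof (rule AE_I2)
        fix z assume "z \<in> space LQ"
        then have z: "z \<in> Q" by simp
        have "\<bar>F b z\<bar> powr q z \<le> (B * (norm (Du z) + 1)) powr q z"
          using FB q(1)[OF z] by (intro powr_mono2) auto
        also have "\<dots> \<le> B powr q_plus * 2 powr q_plus * (norm (Du z) powr q z + 1)"
          by (rule powr_affine_bound) (use B q[OF z] in auto)
        finally show "norm (\<bar>F b z\<bar> powr q z) \<le> norm (B powr q_plus * 2 powr q_plus * (norm (Du z) powr q z + 1))" by simp
      qed
    qed
    then have "integrable lebesgue (\<lambda>y. indicator Q y * \<bar>F b y\<bar> powr q y)"
      by (simp add: integrable_lebesgue_on_iff[OF Q(1)])
    also have "(\<lambda>y. indicator Q y * \<bar>F b y\<bar> powr q y) = (\<lambda>y. \<bar>F b y\<bar> powr q y)"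
      by (auto simp: fun_eq_iff F_def indicator_def)
    finally show "integrable lebesgue (\<lambda>y. \<bar>F b y\<bar> powr q y)" .
  qed auto
  have eqf: "f z * source z = source z * (g (u z) * \<zeta> z)" if "z \<in> space LQ" for z using that by (simp add: f_def)
  have eqF: "flux b z * F b z = flux b z * (g' (u z) * (Du z \<bullet> b) * \<zeta> z + g (u z) * space_deriv \<zeta> z b)" if "z \<in> space LQ" for z b
    using that by (simp add: F_def)
  show "integrable LQ (\<lambda>z. source z * (g (u z) * \<zeta> z))"
    using L1_tendstoD(2)[OF L1] by (subst Bochner_Integration.integrable_cong[OF refl eqf[symmetric]])
  show "integrable LQ (\<lambda>z. flux b z * (g' (u z) * (Du z \<bullet> b) * \<zeta> z + g (u z) * space_deriv \<zeta> z b))" if "b \<in> Basis" for b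
    using L1_tendstoD(2)[OF L2[OF that]] by (subst Bochner_Integration.integrable_cong[OF refl eqF[symmetric]])
  have "(LINT z|LQ. mollify (\<delta> j) f z * source z) + (\<Sum>b\<in>Basis. LINT z|LQ. flux b z * mollify (\<delta> j) (F b) z) = 0" for j
    using weak_split[OF mem[of j]] mc(3)[OF _ d(1)] by (simp add: mult.commute)
  moreover have "(\<lambda>j. (LINT z|LQ. mollify (\<delta> j) f z * source z) + (\<Sum>b\<in>Basis. LINT z|LQ. flux b z * mollify (\<delta> j) (F b) z))
    \<longlonglongrightarrow> (LINT z|LQ. f z * source z) + (\<Sum>b\<in>Basis. LINT z|LQ. flux b z * F b z)"
    by (intro tendsto_add tendsto_sum L1_tendsto_integral L1 L2)
  ultimately have "(LINT z|LQ. f z * source z) + (\<Sum>b\<in>Basis. LINT z|LQ. flux b z * F b z) = 0"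
    by (simp add: LIMSEQ_const_iff)
  also have "(LINT z|LQ. f z * source z) = (LINT z|LQ. source z * (g (u z) * \<zeta> z))"
    by (rule Bochner_Integration.integral_cong[OF refl eqf])
  also have "(\<Sum>b\<in>Basis. LINT z|LQ. flux b z * F b z)
    = (\<Sum>b\<in>Basis. LINT z|LQ. flux b z * (g' (u z) * (Du z \<bullet> b) * \<zeta> z + g (u z) * space_deriv \<zeta> z b))"
    by (intro sum.cong refl Bochner_Integration.integral_cong eqF)
  finally show "(LINT z|LQ. source z * (g (u z) * \<zeta> z)) +
     (\<Sum>b\<in>Basis. LINT z|LQ. flux b z * (g' (u z) * (Du z \<bullet> b) * \<zeta> z + g (u z) * space_deriv \<zeta> z b)) = 0" .
qed

end

section \<open>The energy estimate\<close>

text \<open>As \<open>\<epsilon>\<close> tends to \<open>0\<close>, the primitive of \<open>log_weight \<epsilon>\<close> that vanishes at \<open>0\<close> tends to infinity at every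
  \<open>s > 0\<close>, while \<open>s\<^sup>m\<close> times the weight stays bounded on bounded intervals because \<open>m \<ge> 1\<close>.\<close>

definition log_weight :: "real \<Rightarrow> real \<Rightarrow> real" where "log_weight \<epsilon> s = s / (s\<^sup>2 + \<epsilon>)"
definition log_weight_deriv :: "real \<Rightarrow> real \<Rightarrow> real" where "log_weight_deriv \<epsilon> s = (\<epsilon> - s\<^sup>2) / (s\<^sup>2 + \<epsilon>)\<^sup>2"
definition log_primitive :: "real \<Rightarrow> real \<Rightarrow> real" where "log_primitive \<epsilon> s = ln ((s\<^sup>2 + \<epsilon>) / \<epsilon>) / 2"

lemma log_weight_has_derivative: "0 < \<epsilon> \<Longrightarrow> (log_weight \<epsilon> has_real_derivative log_weight_deriv \<epsilon> s) (at s)"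
  unfolding log_weight_def[abs_def] log_weight_deriv_def
  by (rule derivative_eq_intros refl | simp add: add_nonneg_pos less_imp_neq[symmetric])+
     (simp add: power2_eq_square)

lemma sq_plus_pos: "0 < \<epsilon> \<Longrightarrow> 0 < s\<^sup>2 + (\<epsilon>::real)"
  by (simp add: add_nonneg_pos)

lemma log_weight_deriv_continuous: "0 < \<epsilon> \<Longrightarrow> continuous_on UNIV (log_weight_deriv \<epsilon>)"
proof -
  assume "0 < \<epsilon>"
  then have "(s\<^sup>2 + \<epsilon>)\<^sup>2 \<noteq> 0" for s
    using zero_less_power[OF sq_plus_pos[of \<epsilon> s], of 2] by (metis less_irrefl)
  then show "continuous_on UNIV (log_weight_deriv \<epsilon>)"
    unfolding log_weight_deriv_def[abs_def] by (intro continuous_on_divide) (auto intro!: continuous_intros)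
qed

lemma log_weight_deriv_bound: assumes e: "0 < \<epsilon>" shows "\<bar>log_weight_deriv \<epsilon> s\<bar> \<le> 1 / \<epsilon>"
proof -
  note p = sq_plus_pos[OF e, of s]
  have "\<bar>log_weight_deriv \<epsilon> s\<bar> \<le> (s\<^sup>2 + \<epsilon>) / (s\<^sup>2 + \<epsilon>)\<^sup>2"
    unfolding log_weight_deriv_def abs_divide using e p by (intro divide_mono) (auto simp: abs_le_iff)
  also have "\<dots> = 1 / (s\<^sup>2 + \<epsilon>)" using p by (simp add: power2_eq_square)
  also have "\<dots> \<le> 1 / \<epsilon>" using e p by (intro divide_left_mono) auto
  finally show ?thesis .
qed

lemma log_weight_bound: assumes e: "0 < \<epsilon>" shows "\<bar>log_weight \<epsilon> s\<bar> \<le> 1 + 1 / \<epsilon>"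
proof -
  note p = sq_plus_pos[OF e, of s]
  have "\<bar>s\<bar> \<le> s\<^sup>2 + 1"
    using zero_le_power2[of "\<bar>s\<bar> - 1/2"] by (simp add: power2_eq_square algebra_simps)
  also have "\<dots> \<le> (1 + 1 / \<epsilon>) * (s\<^sup>2 + \<epsilon>)" using e by (simp add: algebra_simps)
  finally show ?thesis using p e by (simp add: log_weight_def abs_divide field_simps)
qed

lemma log_primitive_has_derivative: "0 < \<epsilon> \<Longrightarrow> (log_primitive \<epsilon> has_real_derivative log_weight \<epsilon> s) (at s)"
  unfolding log_primitive_def[abs_def] log_weight_def
  using sq_plus_pos[of \<epsilon> s]
  by (auto intro!: derivative_eq_intros simp: field_simps)

lemma log_weight_continuous: "0 < \<epsilon> \<Longrightarrow> continuous_on UNIV (log_weight \<epsilon>)"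
  using log_weight_has_derivative by (meson DERIV_isCont continuous_at_imp_continuous_on)

text \<open>The expression is the derivative of \<open>s\<^sup>m s / (s\<^sup>2 + \<epsilon>)\<close>, which increases for \<open>m \<ge> 1\<close>.\<close>

lemma powr_times_log_weight_mono:
  assumes e: "0 < \<epsilon>" and m: "1 \<le> m" and s: "0 \<le> s"
  shows "0 \<le> powr_deriv m s * log_weight \<epsilon> s + s powr m * log_weight_deriv \<epsilon> s"
proof (cases "s = 0")
  case True then show ?thesis using m by (simp add: log_weight_def)
next
  case False
  note p = sq_plus_pos[OF e, of s]
  have s0: "0 < s" using s False by simp
  have "powr_deriv m s * s = m * s powr m"
    using s0 powr_add[of s "m - 1" 1] by (auto simp: powr_deriv_def)
  then have "powr_deriv m s * log_weight \<epsilon> s = s powr m * (m * (s\<^sup>2 + \<epsilon>) / (s\<^sup>2 + \<epsilon>)\<^sup>2)"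
    using p by (simp add: log_weight_def power2_eq_square)
  then have "powr_deriv m s * log_weight \<epsilon> s + s powr m * log_weight_deriv \<epsilon> s
      = s powr m * ((m * (s\<^sup>2 + \<epsilon>) + (\<epsilon> - s\<^sup>2)) / (s\<^sup>2 + \<epsilon>)\<^sup>2)"
    unfolding log_weight_deriv_def by (simp only: add_divide_distrib distrib_left)
  also have "\<dots> \<ge> 0"
  proof -
    define D where "D = s\<^sup>2 + \<epsilon>"
    have "1 * D \<le> m * D" using p m unfolding D_def by (intro mult_right_mono) auto
    moreover have "\<epsilon> - s\<^sup>2 = 2 * \<epsilon> - D" by (simp add: D_def)
    ultimately have "0 \<le> m * D + (\<epsilon> - s\<^sup>2)" using e by linarith
    then have "0 \<le> m * (s\<^sup>2 + \<epsilon>) + (\<epsilon> - s\<^sup>2)" unfolding D_def .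
    then show ?thesis by simp
  qed
  finally show ?thesis .
qed

lemma powr_times_log_weight_bound:
  assumes e: "0 < \<epsilon>" and m: "1 \<le> m" and s: "0 \<le> s" "s \<le> M"
  shows "0 \<le> s powr m * log_weight \<epsilon> s" "s powr m * log_weight \<epsilon> s \<le> M powr (m - 1)"
proof -
  note p = sq_plus_pos[OF e, of s]
  show "0 \<le> s powr m * log_weight \<epsilon> s" using s p by (simp add: log_weight_def)
  show "s powr m * log_weight \<epsilon> s \<le> M powr (m - 1)"
  proof (cases "s = 0")
    case False
    then have s0: "0 < s" using s by simp
    have "s powr m * log_weight \<epsilon> s = s powr (m - 1) * (s * s / (s\<^sup>2 + \<epsilon>))"
      using s0 powr_add[of s "m - 1" 1] by (simp add: log_weight_def)
    also have "\<dots> \<le> M powr (m - 1) * 1"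
      using s s0 m p e by (intro mult_mono powr_mono2) (auto simp: power2_eq_square)
    finally show ?thesis by simp
  qed (use m in simp)
qed

context degenerate_equation
begin

definition energy :: real where
  "energy = (LINT z|LQ. 1 + norm (Du z) powr q z)"

lemma ut_test_integrable:
  assumes e: "0 < \<epsilon>" and \<zeta>: "\<zeta> \<in> borel_measurable LQ" "\<And>z. z \<in> Q \<Longrightarrow> \<bar>\<zeta> z\<bar> \<le> B"
  shows "integrable LQ (\<lambda>z. ut z * (log_weight \<epsilon> (u z) * \<zeta> z))"
proof -
  have [measurable]: "log_weight \<epsilon> \<in> borel_measurable borel" by (rule borel_measurable_continuous_onI[OF log_weight_continuous[OF e]])
  note [measurable] = \<zeta>(1)
  have "integrable LQ (\<lambda>z. (log_weight \<epsilon> (u z) * \<zeta> z) * ut z)"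
  proof (rule integrable_mult_bounded[OF ut_integrable])
    show "AE z in LQ. \<bar>log_weight \<epsilon> (u z) * \<zeta> z\<bar> \<le> (1 + 1 / \<epsilon>) * B"
      unfolding abs_mult using log_weight_bound[OF e] \<zeta>(2) e by (intro AE_I2 mult_mono) auto
  qed measurable
  then show ?thesis by (simp add: mult.commute)
qed

text \<open>In the equation tested with \<open>log_weight \<epsilon> u * \<zeta>\<close>, the terms carrying \<open>|Du|\<^sup>q\<close> without a derivative
  of \<open>\<zeta>\<close> combine to \<open>|Du|\<^sup>q \<zeta>\<close> times the derivative of \<open>s\<^sup>m log_weight \<epsilon> s\<close> at \<open>u\<close>, which is
  nonnegative. The remaining flux term is controlled by \<open>u\<^sup>m log_weight \<epsilon> u \<le> M\<^sup>m\<^sup>-\<^sup>1\<close>. The point is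
  that the bound does not depend on \<open>\<epsilon>\<close>.\<close>

lemma energy_estimate:
  assumes e: "0 < \<epsilon>" and \<zeta>: "\<zeta> \<in> C01 Q" and \<zeta>0: "\<And>z. 0 \<le> \<zeta> z"
    and L: "\<And>z b. b \<in> Basis \<Longrightarrow> \<bar>space_deriv \<zeta> z b\<bar> \<le> L"
  shows "(LINT z|LQ. ut z * (log_weight \<epsilon> (u z) * \<zeta> z)) \<le> real DIM('a) * M powr (m - 1) * L * energy"
proof -
  note id = tested_identity[OF log_weight_has_derivative[OF e] log_weight_deriv_continuous[OF e] log_weight_deriv_bound[OF e] log_weight_bound[OF e] \<zeta>]
  obtain B where B: "\<And>z. \<bar>\<zeta> z\<bar> \<le> B" using C01_bounded[OF \<zeta>] by blast
  have iut: "integrable LQ (\<lambda>z. ut z * (log_weight \<epsilon> (u z) * \<zeta> z))"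
    by (rule ut_test_integrable[OF e _ B]) (intro measurable_lebesgue_onI C1_fun_measurable C01_D[OF \<zeta>])
  let ?E = "\<lambda>z. real DIM('a) * M powr (m - 1) * L * (1 + norm (Du z) powr q z)"
  have iE: "integrable LQ ?E"
    by (intro integrable_mult_right Bochner_Integration.integrable_add integrable_const_Q Du_integrable)
  let ?X = "\<lambda>b z. flux b z * (log_weight_deriv \<epsilon> (u z) * (Du z \<bullet> b) * \<zeta> z + log_weight \<epsilon> (u z) * space_deriv \<zeta> z b)"
  let ?I = "\<lambda>z. source z * (log_weight \<epsilon> (u z) * \<zeta> z) + (\<Sum>b\<in>Basis. ?X b z)"
  have iI: "integrable LQ ?I"
    using id(1,2) by (intro Bochner_Integration.integrable_add Bochner_Integration.integrable_sum)
  have I0: "(LINT z|LQ. ?I z) = 0"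
    using id by (simp add: Bochner_Integration.integral_add Bochner_Integration.integral_sum Bochner_Integration.integrable_sum)
  have ae: "AE z in LQ. ut z * (log_weight \<epsilon> (u z) * \<zeta> z) - ?E z \<le> ?I z"
    using u_le AE_space
  proof eventually_elim
    case (elim z)
    then have z: "z \<in> Q" by simp
    note u0 = u_nonneg[OF z]
    let ?k = "norm (Du z) powr (q z - 2)"
    let ?P = "norm (Du z) powr q z"
    have X: "?X b z = ?k * ((Du z \<bullet> b) * (Du z \<bullet> b)) * (u z powr m * log_weight_deriv \<epsilon> (u z) * \<zeta> z) + flux b z * log_weight \<epsilon> (u z) * space_deriv \<zeta> z b" for b
      by (simp add: flux_def algebra_simps)
    have "(\<Sum>b\<in>Basis. ?X b z) = ?k * (\<Sum>b\<in>Basis. (Du z \<bullet> b) * (Du z \<bullet> b)) * (u z powr m * log_weight_deriv \<epsilon> (u z) * \<zeta> z)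
        + (\<Sum>b\<in>Basis. flux b z * log_weight \<epsilon> (u z) * space_deriv \<zeta> z b)"
      unfolding X by (simp add: sum.distrib sum_distrib_left sum_distrib_right)
    also have "?k * (\<Sum>b\<in>Basis. (Du z \<bullet> b) * (Du z \<bullet> b)) = ?P"
      by (simp add: euclidean_inner[of "Du z" "Du z", symmetric] powr_two_inner)
    finally have S: "(\<Sum>b\<in>Basis. ?X b z) = ?P * (u z powr m * log_weight_deriv \<epsilon> (u z) * \<zeta> z)
        + (\<Sum>b\<in>Basis. flux b z * log_weight \<epsilon> (u z) * space_deriv \<zeta> z b)" .
    have "- (flux b z * log_weight \<epsilon> (u z) * space_deriv \<zeta> z b) \<le> M powr (m - 1) * L * (1 + ?P)" if b: "b \<in> Basis" for b
    proof -
      note pg = powr_times_log_weight_bound[OF e m u0 elim(1)]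
      have "\<bar>flux b z * log_weight \<epsilon> (u z) * space_deriv \<zeta> z b\<bar>
          = \<bar>u z powr m * log_weight \<epsilon> (u z)\<bar> * (?k * \<bar>Du z \<bullet> b\<bar>) * \<bar>space_deriv \<zeta> z b\<bar>"
        by (simp add: flux_def abs_mult)
      also have "\<dots> \<le> M powr (m - 1) * (1 + ?P) * L"
      proof (intro mult_mono)
        show "?k * \<bar>Du z \<bullet> b\<bar> \<le> 1 + ?P"
          using powr_flux_bound[of b "Du z" "q z"] powr_le_one_plus[of "norm (Du z)" "q z"] q(1)[OF z] b by simp
      qed (use pg L[OF b] in auto)
      finally show ?thesis by (simp add: ac_simps)
    qed
    then have "(\<Sum>b\<in>Basis. - (flux b z * log_weight \<epsilon> (u z) * space_deriv \<zeta> z b)) \<le> (\<Sum>b\<in>(Basis :: 'a set). M powr (m - 1) * L * (1 + ?P))"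
      by (rule sum_mono)
    then have 1: "- (\<Sum>b\<in>Basis. flux b z * log_weight \<epsilon> (u z) * space_deriv \<zeta> z b) \<le> ?E z"
      by (simp add: sum_negf algebra_simps)
    have "0 \<le> ?P * \<zeta> z * (powr_deriv m (u z) * log_weight \<epsilon> (u z) + u z powr m * log_weight_deriv \<epsilon> (u z))"
      using \<zeta>0[of z] powr_times_log_weight_mono[OF e m u0] by simp
    then have 2: "0 \<le> powr_deriv m (u z) * ?P * (log_weight \<epsilon> (u z) * \<zeta> z) + ?P * (u z powr m * log_weight_deriv \<epsilon> (u z) * \<zeta> z)"
      by (simp add: algebra_simps)
    show ?case unfolding S source_def using 1 2 by (simp add: algebra_simps)
  qed
  have "(LINT z|LQ. ut z * (log_weight \<epsilon> (u z) * \<zeta> z) - ?E z) \<le> (LINT z|LQ. ?I z)"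
    by (rule integral_mono_AE[OF Bochner_Integration.integrable_diff[OF iut iE] iI ae])
  then have "(LINT z|LQ. ut z * (log_weight \<epsilon> (u z) * \<zeta> z)) - (LINT z|LQ. ?E z) \<le> 0"
    unfolding I0 using iut iE by simp
  then show ?thesis by (simp add: energy_def)
qed

end

section \<open>Cutoff functions in time\<close>

lemma C1_fun_fst:
  fixes \<eta> :: "'a::euclidean_space \<Rightarrow> real"
  assumes "C1_fun \<eta>"
  shows "C1_fun (\<lambda>z::'a \<times> 'b::euclidean_space. \<eta> (fst z))"
    "frechet_derivative (\<lambda>z::'a \<times> 'b. \<eta> (fst z)) (at z) e = frechet_derivative \<eta> (at (fst z)) (fst e)"
proof -
  have d: "((\<lambda>z::'a \<times> 'b. \<eta> (fst z)) has_derivative (\<lambda>e. frechet_derivative \<eta> (at (fst z)) (fst e))) (at z)" for z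
    by (rule has_derivative_compose[OF _ C1_fun_has_derivative[OF assms]]) (auto intro!: derivative_eq_intros)
  have c: "continuous_on UNIV (\<lambda>z::'a \<times> 'b. frechet_derivative \<eta> (at (fst z)) (fst e))" for e :: "'a \<times> 'b"
    by (rule continuous_on_compose2[OF C1_fun_continuous_deriv[OF assms, of UNIV]]) (auto intro!: continuous_intros)
  show "C1_fun (\<lambda>z::'a \<times> 'b. \<eta> (fst z))" by (rule C1_funI(1)[OF d c])
  show "frechet_derivative (\<lambda>z::'a \<times> 'b. \<eta> (fst z)) (at z) e = frechet_derivative \<eta> (at (fst z)) (fst e)"
    by (rule C1_funI(2)[OF d c])
qed

lemma C1_fun_time:
  assumes H: "\<And>s. (h has_real_derivative h' s) (at s)" "continuous_on UNIV h'"
  shows "C1_fun (\<lambda>z::'a::euclidean_space \<times> real. h (snd z))"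
    "frechet_derivative (\<lambda>z::'a \<times> real. h (snd z)) (at z) e = h' (snd z) * snd e"
proof -
  have d: "((\<lambda>z::'a \<times> real. snd z) has_derivative snd) (at z)" for z
    by (auto intro!: derivative_eq_intros)
  have "C1_fun (\<lambda>z::'a \<times> real. snd z)" "frechet_derivative (\<lambda>z::'a \<times> real. snd z) (at z) e = snd e"
    by (rule C1_funI[OF d], auto)+
  from C1_fun_compose[OF this(1) H] this(2)
  show "C1_fun (\<lambda>z::'a \<times> real. h (snd z))"
    "frechet_derivative (\<lambda>z::'a \<times> real. h (snd z)) (at z) e = h' (snd z) * snd e" by auto
qed

text \<open>Vanishes for \<open>s \<le> 1\<close> and tends to \<open>1\<close> at infinity.\<close>

definition smooth_cutoff :: "real \<Rightarrow> real" where
  "smooth_cutoff s = (max 0 (s - 1))\<^sup>2 / (1 + (max 0 (s - 1))\<^sup>2)"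

definition smooth_cutoff_deriv :: "real \<Rightarrow> real" where
  "smooth_cutoff_deriv s = 2 * max 0 (s - 1) / (1 + (max 0 (s - 1))\<^sup>2)\<^sup>2"

lemma sqr_pos_part_has_derivative:
  "((\<lambda>s. (max 0 (s - 1))\<^sup>2) has_real_derivative 2 * max 0 (s - 1)) (at (s::real))"
  unfolding has_field_derivative_def has_derivative_at_alt
proof (intro conjI allI impI bounded_linear_mult_right)
  fix e :: real assume e: "0 < e"
  show "\<exists>d>0. \<forall>y. norm (y - s) < d \<longrightarrow> norm ((max 0 (y - 1))\<^sup>2 - (max 0 (s - 1))\<^sup>2 - 2 * max 0 (s - 1) * (y - s)) \<le> e * norm (y - s)"
  proof (intro exI[of _ e] conjI allI impI e)
    fix y assume y: "norm (y - s) < e"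
    have "\<bar>(max 0 (y - 1))\<^sup>2 - (max 0 (s - 1))\<^sup>2 - 2 * max 0 (s - 1) * ((y - 1) - (s - 1))\<bar> \<le> ((y - 1) - (s - 1))\<^sup>2"
      by (rule sqr_pos_part_remainder)
    also have "((y - 1) - (s - 1))\<^sup>2 = \<bar>y - s\<bar> * \<bar>y - s\<bar>" by (simp add: power2_eq_square)
    also have "\<dots> \<le> e * \<bar>y - s\<bar>" using y by (intro mult_right_mono) auto
    finally show "norm ((max 0 (y - 1))\<^sup>2 - (max 0 (s - 1))\<^sup>2 - 2 * max 0 (s - 1) * (y - s)) \<le> e * norm (y - s)" by simp
  qed
qed

lemma smooth_cutoff_has_derivative: "(smooth_cutoff has_real_derivative smooth_cutoff_deriv s) (at s)"
proof -
  have p: "1 + (max 0 (s - 1))\<^sup>2 \<noteq> 0" using zero_le_power2[of "max 0 (s - 1)"] by linarith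
  show ?thesis unfolding smooth_cutoff_def[abs_def] smooth_cutoff_deriv_def
    by (rule DERIV_cong[OF DERIV_divide[OF sqr_pos_part_has_derivative DERIV_add[OF DERIV_const sqr_pos_part_has_derivative] p]])
       (use p in \<open>simp add: field_simps power2_eq_square\<close>)
qed

lemma smooth_cutoff_deriv_continuous: "continuous_on UNIV smooth_cutoff_deriv"
proof -
  have p: "1 + (max 0 (s - 1))\<^sup>2 \<noteq> 0" for s :: real using zero_le_power2[of "max 0 (s - 1)"] by linarith
  show ?thesis unfolding smooth_cutoff_deriv_def[abs_def]
    by (intro continuous_on_divide continuous_intros) (use p in auto)
qed

lemma smooth_cutoff_bounds: "0 \<le> smooth_cutoff s" "smooth_cutoff s \<le> 1"
proof -
  have *: "0 \<le> x / (1 + x)" "x / (1 + x) \<le> 1" if "0 \<le> x" for x :: real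
    using that by (auto simp: divide_le_eq_1)
  show "0 \<le> smooth_cutoff s" "smooth_cutoff s \<le> 1" unfolding smooth_cutoff_def by (rule *, simp)+
qed

lemma smooth_cutoff_zero: "s \<le> 1 \<Longrightarrow> smooth_cutoff s = 0"
  by (simp add: smooth_cutoff_def)

lemma smooth_cutoff_tendsto: "(smooth_cutoff \<longlongrightarrow> 1) at_top"
proof -
  have eq: "smooth_cutoff = (\<lambda>s. 1 - inverse (1 + (max 0 (s - 1))\<^sup>2))"
  proof (rule ext)
    fix s :: real
    have "1 + (max 0 (s - 1))\<^sup>2 \<noteq> 0" using zero_le_power2[of "max 0 (s - 1)"] by linarith
    then show "smooth_cutoff s = 1 - inverse (1 + (max 0 (s - 1))\<^sup>2)" by (simp add: smooth_cutoff_def field_simps)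
  qed
  have "filterlim (\<lambda>s::real. 1 + (max 0 (s - 1))\<^sup>2) at_top at_top"
  proof (rule filterlim_at_top_mono[OF filterlim_ident])
    show "\<forall>\<^sub>F s::real in at_top. s \<le> 1 + (max 0 (s - 1))\<^sup>2"
      using eventually_ge_at_top[of "2::real"]
    proof eventually_elim
      case (elim s)
      have "(s - 1) * 1 \<le> (s - 1) * (s - 1)" using elim by (intro mult_left_mono) auto
      moreover have "(max 0 (s - 1))\<^sup>2 = (s - 1) * (s - 1)" using elim by (simp add: power2_eq_square)
      ultimately have "s - 1 \<le> (max 0 (s - 1))\<^sup>2" by simp
      then show ?case by linarith
    qed
  qed
  then have "((\<lambda>s::real. 1 - inverse (1 + (max 0 (s - 1))\<^sup>2)) \<longlongrightarrow> 1 - 0) at_top"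
    by (intro tendsto_diff tendsto_const tendsto_inverse_0_at_top)
  then show ?thesis unfolding eq by simp
qed

text \<open>Functions with compact support in \<open>(0, T)\<close> that approach the weight \<open>T - t\<close>. This weight vanishes at
  the final time but not at the initial time, so it brings in the initial value and integrates the rest
  over time.\<close>

definition ramp :: "real \<Rightarrow> nat \<Rightarrow> real \<Rightarrow> real" where
  "ramp T j t = (T - t) * (smooth_cutoff (real (Suc j) * t) * smooth_cutoff (real (Suc j) * (T - t)))"

definition ramp_deriv :: "real \<Rightarrow> nat \<Rightarrow> real \<Rightarrow> real" where
  "ramp_deriv T j t = (T - t) * (smooth_cutoff (real (Suc j) * t) * (- real (Suc j) * smooth_cutoff_deriv (real (Suc j) * (T - t)))
     + real (Suc j) * smooth_cutoff_deriv (real (Suc j) * t) * smooth_cutoff (real (Suc j) * (T - t)))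
     - smooth_cutoff (real (Suc j) * t) * smooth_cutoff (real (Suc j) * (T - t))"

lemma ramp_has_derivative: "(ramp T j has_real_derivative ramp_deriv T j t) (at t)"
proof -
  let ?k = "real (Suc j)"
  have 1: "((\<lambda>t. smooth_cutoff (?k * t)) has_real_derivative smooth_cutoff_deriv (?k * t) * ?k) (at t)"
    by (rule DERIV_chain2[OF smooth_cutoff_has_derivative]) (rule DERIV_cmult_Id)
  have "((\<lambda>t. ?k * (T - t)) has_real_derivative ?k * (0 - 1)) (at t)"
    by (intro DERIV_cmult DERIV_diff DERIV_const DERIV_ident)
  then have 2: "((\<lambda>t. smooth_cutoff (?k * (T - t))) has_real_derivative smooth_cutoff_deriv (?k * (T - t)) * (?k * (0 - 1))) (at t)"
    by (rule DERIV_chain2[OF smooth_cutoff_has_derivative])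
  have 3: "((\<lambda>t. T - t) has_real_derivative 0 - 1) (at t)"
    by (intro DERIV_diff DERIV_const DERIV_ident)
  show ?thesis unfolding ramp_def[abs_def] ramp_deriv_def
    by (rule DERIV_cong[OF DERIV_mult[OF 3 DERIV_mult[OF 1 2]]]) (simp add: algebra_simps del: of_nat_Suc)
qed

lemma ramp_deriv_continuous: "continuous_on UNIV (ramp_deriv T j)"
proof -
  have s: "continuous_on UNIV smooth_cutoff"
    using smooth_cutoff_has_derivative by (meson DERIV_isCont continuous_at_imp_continuous_on)
  show ?thesis unfolding ramp_deriv_def[abs_def]
    by (intro continuous_intros continuous_on_compose2[OF s] continuous_on_compose2[OF smooth_cutoff_deriv_continuous]) auto
qed

lemma ramp_zero: "t \<le> 1 / real (Suc j) \<or> T - 1 / real (Suc j) \<le> t \<Longrightarrow> ramp T j t = 0"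
proof (elim disjE)
  assume "t \<le> 1 / real (Suc j)"
  then have "real (Suc j) * t \<le> 1" by (simp add: field_simps)
  then show ?thesis by (simp add: ramp_def smooth_cutoff_zero)
next
  assume "T - 1 / real (Suc j) \<le> t"
  then have "T - t \<le> 1 / real (Suc j)" by linarith
  then have "real (Suc j) * (T - t) \<le> 1" by (simp only: pos_le_divide_eq of_nat_0_less_iff zero_less_Suc mult.commute)
  then show ?thesis by (simp add: ramp_def smooth_cutoff_zero)
qed

lemma ramp_bounds: "0 < T \<Longrightarrow> 0 \<le> ramp T j t" "0 < T \<Longrightarrow> ramp T j t \<le> T"
proof -
  assume T: "0 < T"
  show "0 \<le> ramp T j t"
  proof (cases "t \<le> T")
    case True then show ?thesis by (simp add: ramp_def smooth_cutoff_bounds)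
  next
    case False
    moreover have "0 < 1 / real (Suc j)" by simp
    ultimately have "ramp T j t = 0" by (intro ramp_zero disjI2) linarith
    then show ?thesis by simp
  qed
  show "ramp T j t \<le> T"
  proof (cases "0 \<le> t \<and> t \<le> T")
    case True
    have "smooth_cutoff (real (Suc j) * t) * smooth_cutoff (real (Suc j) * (T - t)) \<le> 1 * 1"
      by (intro mult_mono smooth_cutoff_bounds) auto
    then have "ramp T j t \<le> (T - t) * 1" unfolding ramp_def using True by (intro mult_left_mono) auto
    then show ?thesis using True by simp
  next
    case False
    have "0 < 1 / real (Suc j)" by simp
    with False have "t \<le> 1 / real (Suc j) \<or> T - 1 / real (Suc j) \<le> t" by linarith
    then have "ramp T j t = 0" by (rule ramp_zero)
    then show ?thesis using T by simp
  qed
qed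

lemma ramp_tendsto:
  assumes "0 < t" "t < T"
  shows "(\<lambda>j. ramp T j t) \<longlonglongrightarrow> T - t"
proof -
  have f: "filterlim (\<lambda>j. real (Suc j) * c) at_top sequentially" if "0 < c" for c
    using filterlim_tendsto_pos_mult_at_top[OF tendsto_const that filterlim_compose[OF filterlim_real_sequentially filterlim_Suc]]
    by (simp only: mult.commute)
  have "(\<lambda>j. (T - t) * (smooth_cutoff (real (Suc j) * t) * smooth_cutoff (real (Suc j) * (T - t)))) \<longlonglongrightarrow> (T - t) * (1 * 1)"
    using assms by (intro tendsto_intros filterlim_compose[OF smooth_cutoff_tendsto] f) auto
  then show ?thesis by (simp add: ramp_def)
qed

section \<open>Vanishing away from the initial support\<close>

text \<open>Fubini's theorem and the fundamental theorem of calculus on the time interval.\<close>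

lemma integral_time_deriv:
  fixes \<Phi> :: "'a::euclidean_space \<times> real \<Rightarrow> real"
  assumes \<Phi>: "C1_fun \<Phi>" and K: "compact K" "K \<subseteq> \<Omega>" and z: "\<And>x t. x \<notin> K \<Longrightarrow> \<Phi> (x, t) = 0"
    and \<Omega>: "open \<Omega>" and T: "0 < T"
  shows "(LINT z|lebesgue_on (cylinder \<Omega> T). frechet_derivative \<Phi> (at z) (0, 1)) =
    (LINT x|lebesgue_on \<Omega>. \<Phi> (x, T) - \<Phi> (x, 0))"
proof -
  define D where "D z = frechet_derivative \<Phi> (at z) (0, 1)" for z
  have Q: "open (cylinder \<Omega> T)" using \<Omega> by (intro open_Times) auto
  have Dc: "continuous_on UNIV D" unfolding D_def by (rule C1_fun_continuous_deriv[OF \<Phi>])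
  have line: "((\<lambda>s. \<Phi> (x, s)) has_real_derivative D (x, t)) (at t)" for x t
  proof -
    interpret bounded_linear "frechet_derivative \<Phi> (at (x, t))"
      by (rule has_derivative_bounded_linear[OF C1_fun_has_derivative[OF \<Phi>]])
    have "((\<lambda>s. \<Phi> (x, s)) has_derivative (\<lambda>k. frechet_derivative \<Phi> (at (x, t)) (0, k))) (at t)"
      by (rule has_derivative_compose[OF _ C1_fun_has_derivative[OF \<Phi>]]) (auto intro!: derivative_eq_intros)
    moreover have "frechet_derivative \<Phi> (at (x, t)) (0, k) = D (x, t) * k" for k
      using scaleR[of k "(0, 1)"] by (simp add: D_def)
    ultimately show ?thesis by (simp add: has_field_derivative_def)
  qed
  have D0: "D (x, t) = 0" if "x \<notin> K" for x t
  proof -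
    have "(\<lambda>s. \<Phi> (x, s)) = (\<lambda>s. 0)" using z[OF that] by auto
    then have "((\<lambda>s. \<Phi> (x, s)) has_real_derivative 0) (at t)" by simp
    then show ?thesis using DERIV_unique[OF line] by blast
  qed
  define h where "h z = indicator (K \<times> {0..T}) z * D z" for z
  have hi: "integrable lborel h"
    using borel_integrable_compact[of "K \<times> {0..T}" D] K Dc
    by (auto simp: h_def[abs_def] compact_Times continuous_on_subset)
  have "(LINT z|lebesgue_on (cylinder \<Omega> T). D z) = (LINT z|lebesgue. indicator (cylinder \<Omega> T) z * D z)"
    by (rule integral_lebesgue_on_eq[OF Q])
  also have "\<dots> = (LINT z|lebesgue. h z)"
  proof (rule integral_cong_AE)
    have Dm: "D \<in> borel_measurable lebesgue"
      by (intro borel_measurable_lebesgueI borel_measurable_continuous_onI Dc)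
    have "cylinder \<Omega> T \<in> sets lebesgue" using Q by auto
    then show "(\<lambda>z. indicator (cylinder \<Omega> T) z * D z) \<in> borel_measurable lebesgue"
      using Dm by (intro borel_measurable_times borel_measurable_indicator)
    show "h \<in> borel_measurable lebesgue"
      using hi by (intro borel_measurable_lebesgueI) auto
    have b: "((0::'a), 1::real) \<in> Basis" by (simp add: Basis_prod_def)
    have "AE z :: 'a \<times> real in lebesgue. snd z \<noteq> c" for c :: real
    proof -
      have "negligible {z :: 'a \<times> real. z \<bullet> (0, 1) = c}" by (rule negligible_standard_hyperplane[OF b])
      then show ?thesis unfolding AE_lebesgue_iff by (rule negligible_subset) (auto simp: inner_prod_def)
    qed
    from this[of 0] this[of T] show "AE z in lebesgue. indicator (cylinder \<Omega> T) z * D z = h z"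
    proof eventually_elim
      case (elim z)
      show ?case using elim D0[of "fst z" "snd z"] K
        by (cases z, cases "fst z \<in> K") (auto simp: h_def indicator_def)
    qed
  qed
  also have "\<dots> = (LINT z|lborel. h z)"
    using hi by (intro integral_completion) auto
  also have "\<dots> = (LINT x|lborel. LINT t|lborel. h (x, t))"
    using hi by (subst lborel_pair.integral_fst') (auto simp: lborel_prod)
  also have "\<dots> = (LINT x|lborel. \<Phi> (x, T) - \<Phi> (x, 0))"
  proof (rule Bochner_Integration.integral_cong[OF refl])
    fix x
    show "(LINT t|lborel. h (x, t)) = \<Phi> (x, T) - \<Phi> (x, 0)"
    proof (cases "x \<in> K")
      case True
      have "(LINT t|lborel. D (x, t) * indicator {0..T} t) = \<Phi> (x, T) - \<Phi> (x, 0)"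
      proof (rule integral_FTC_Icc_real)
        have "continuous_on UNIV (\<lambda>t. D (x, t))"
          by (rule continuous_on_compose2[OF Dc]) (auto intro!: continuous_intros)
        then show "isCont (\<lambda>t. D (x, t)) t" for t by (simp add: continuous_on_eq_continuous_at)
      qed (use T line in auto)
      then show ?thesis using True by (simp add: h_def indicator_times mult.commute)
    next
      case False
      then show ?thesis using z by (simp add: h_def)
    qed
  qed
  also have "\<dots> = (LINT x|lebesgue. \<Phi> (x, T) - \<Phi> (x, 0))"
  proof (rule integral_completion[symmetric])
    have "continuous_on UNIV (\<lambda>x. \<Phi> (x, T) - \<Phi> (x, 0))"
      by (intro continuous_intros continuous_on_compose2[OF C1_fun_continuous[OF \<Phi>, of UNIV]]) auto
    then show "(\<lambda>x. \<Phi> (x, T) - \<Phi> (x, 0)) \<in> borel_measurable lborel"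
      using borel_measurable_continuous_onI by simp
  qed
  also have "\<dots> = (LINT x|lebesgue. indicator \<Omega> x * (\<Phi> (x, T) - \<Phi> (x, 0)))"
  proof (intro Bochner_Integration.integral_cong refl)
    fix x
    show "\<Phi> (x, T) - \<Phi> (x, 0) = indicator \<Omega> x * (\<Phi> (x, T) - \<Phi> (x, 0))"
    proof (cases "x \<in> \<Omega>")
      case False
      then have "x \<notin> K" using K by blast
      then show ?thesis using z[of x] by simp
    qed simp
  qed
  also have "\<dots> = (LINT x|lebesgue_on \<Omega>. \<Phi> (x, T) - \<Phi> (x, 0))"
    by (rule integral_lebesgue_on_eq[OF \<Omega>, symmetric])
  finally show ?thesis by (simp add: D_def)
qed

lemma log_primitive_nonneg: "0 < \<epsilon> \<Longrightarrow> 0 \<le> log_primitive \<epsilon> s"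
  unfolding log_primitive_def by (simp add: le_divide_eq)

lemma log_primitive_zero: "0 < \<epsilon> \<Longrightarrow> log_primitive \<epsilon> 0 = 0"
  by (simp add: log_primitive_def)

lemma log_primitive_tendsto_infinity:
  assumes s: "0 < s"
  shows "filterlim (\<lambda>n. log_primitive (1 / real (Suc n)) s) at_top sequentially"
proof -
  have "filterlim (\<lambda>n. s\<^sup>2 * real (Suc n)) at_top sequentially"
    by (rule filterlim_tendsto_pos_mult_at_top[OF tendsto_const _ filterlim_compose[OF filterlim_real_sequentially filterlim_Suc]])
       (use s in simp)
  then have "filterlim (\<lambda>n. ln (s\<^sup>2 * real (Suc n))) at_top sequentially"
    by (rule filterlim_compose[OF ln_at_top])
  then have 1: "filterlim (\<lambda>n. (1/2) * ln (s\<^sup>2 * real (Suc n))) at_top sequentially"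
    by (rule filterlim_tendsto_pos_mult_at_top[OF tendsto_const, rotated]) simp
  show ?thesis
  proof (rule filterlim_at_top_mono[OF 1], intro always_eventually allI)
    fix n
    have "(s\<^sup>2 + 1 / real (Suc n)) / (1 / real (Suc n)) = s\<^sup>2 * real (Suc n) + 1"
      by (simp add: field_simps del: of_nat_Suc)
    moreover have "0 < s\<^sup>2 * real (Suc n)" using s by (intro mult_pos_pos) auto
    ultimately show "(1/2) * ln (s\<^sup>2 * real (Suc n)) \<le> log_primitive (1 / real (Suc n)) s"
      unfolding log_primitive_def by (simp del: of_nat_Suc)
  qed
qed

text \<open>The values at time \<open>0\<close> of the same approximants converge to the initial value.\<close>

locale degenerate_cauchy_problem = degenerate_equation "cylinder \<Omega> T" q u ut Du \<psi> m M q_plus C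
  for \<Omega> :: "'a::euclidean_space set" and T :: real and q u ut Du \<psi> m M q_plus C +
  fixes u0 :: "'a \<Rightarrow> real"
  assumes \<Omega>: "open \<Omega>" "bounded \<Omega>" and T: "0 < T"
    and initial: "L1_tendsto (lebesgue_on \<Omega>) (\<lambda>k x. \<psi> k (x, 0)) u0"
begin

lemma cutoff_measurable: "\<eta> \<in> C01 \<Omega> \<Longrightarrow> (\<lambda>z. \<eta> (fst z)) \<in> borel_measurable LQ"
  by (intro measurable_lebesgue_onI C1_fun_measurable C1_fun_fst C01_D)

lemma weighted_cutoff_measurable:
  assumes "\<eta> \<in> C01 \<Omega>"
  shows "(\<lambda>z. \<eta> (fst z) * (T - snd z)) \<in> borel_measurable LQ"
proof -
  have "(\<lambda>z. T - snd z) \<in> borel_measurable LQ"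
    by (intro measurable_lebesgue_onI borel_measurable_continuous_onI continuous_intros)
  then show ?thesis using cutoff_measurable[OF assms] by measurable
qed

text \<open>For the approximants, \<open>\<eta> (T - t) log_weight \<epsilon> \<psi> D\<^sub>t\<psi>\<close> is the time derivative of
  \<open>\<eta> (T - t) log_primitive \<epsilon> \<psi>\<close> up to the term without \<open>T - t\<close>. The boundary term at \<open>t = T\<close> is
  killed by the weight, and the one at \<open>t = 0\<close> tends to \<open>0\<close> because \<open>u0\<close> vanishes where \<open>\<eta>\<close> does
  not.\<close>

lemma time_identity:
  assumes e: "0 < \<epsilon>" and \<eta>: "\<eta> \<in> C01 \<Omega>" and zero: "AE x in lebesgue_on \<Omega>. \<eta> x \<noteq> 0 \<longrightarrow> u0 x = 0"
  shows "integrable LQ (\<lambda>z. \<eta> (fst z) * log_primitive \<epsilon> (u z))"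
    "(LINT z|LQ. \<eta> (fst z) * log_primitive \<epsilon> (u z)) =
     (LINT z|LQ. ut z * (log_weight \<epsilon> (u z) * (\<eta> (fst z) * (T - snd z))))"
proof -
  obtain B where B: "\<And>x. \<bar>\<eta> x\<bar> \<le> B" using C01_bounded[OF \<eta>] by blast
  note C\<eta> = C01_D(1)[OF \<eta>]
  obtain K where K: "compact K" "K \<subseteq> \<Omega>" and \<eta>0: "\<And>x. x \<notin> K \<Longrightarrow> \<eta> x = 0"
    using C01_support[OF \<eta>] by metis
  note WW = W11_approxD[OF W]
  have t: "((0::'a), 1::real) \<in> Basis" by (simp add: Basis_prod_def)
  have LG: "L1_tendsto LQ (\<lambda>k z. log_primitive \<epsilon> (\<psi> k z)) (\<lambda>z. log_primitive \<epsilon> (u z))"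
    by (rule compose_L1_tendsto[OF Q WW(2) log_primitive_has_derivative[OF e] log_weight_bound[OF e]])
  have L1: "L1_tendsto LQ (\<lambda>k z. \<eta> (fst z) * log_primitive \<epsilon> (\<psi> k z)) (\<lambda>z. \<eta> (fst z) * log_primitive \<epsilon> (u z))"
    by (rule L1_tendsto_mult_bounded_const[OF LG cutoff_measurable[OF \<eta>], of B]) (simp add: B)
  have gm [measurable]: "log_weight \<epsilon> \<in> borel_measurable borel" by (rule borel_measurable_continuous_onI[OF log_weight_continuous[OF e]])
  have \<psi>m [measurable]: "\<psi> k \<in> borel_measurable LQ" for k using L1_tendstoD(1)[OF WW(2)] by auto
  have Lt: "L1_tendsto LQ (\<lambda>k z. frechet_derivative (\<psi> k) (at z) (0, 1)) ut"
    using WW(3)[OF t] by simp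
  have Lg: "L1_tendsto LQ (\<lambda>k z. log_weight \<epsilon> (\<psi> k z) * frechet_derivative (\<psi> k) (at z) (0, 1)) (\<lambda>z. log_weight \<epsilon> (u z) * ut z)"
  proof (rule L1_tendsto_mult_bounded[OF Lt, where K="1 + 1 / \<epsilon>"])
    show "AE z in LQ. (\<lambda>k. log_weight \<epsilon> (\<psi> k z)) \<longlonglongrightarrow> log_weight \<epsilon> (u z)"
      using WW(4) by eventually_elim (auto intro: continuous_on_tendsto_compose[OF log_weight_continuous[OF e]])
  qed (auto simp: log_weight_bound[OF e])
  note \<eta>Tm = weighted_cutoff_measurable[OF \<eta>]
  have L2: "L1_tendsto LQ (\<lambda>k z. (\<eta> (fst z) * (T - snd z)) * (log_weight \<epsilon> (\<psi> k z) * frechet_derivative (\<psi> k) (at z) (0, 1)))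
     (\<lambda>z. (\<eta> (fst z) * (T - snd z)) * (log_weight \<epsilon> (u z) * ut z))"
  proof (rule L1_tendsto_mult_bounded_const[OF Lg \<eta>Tm, of "B * T"])
    show "AE z in LQ. \<bar>\<eta> (fst z) * (T - snd z)\<bar> \<le> B * T"
    proof (rule AE_I2)
      fix z assume "z \<in> space LQ"
      then have "0 < snd z" "snd z < T" by (auto simp: mem_Times_iff)
      then show "\<bar>\<eta> (fst z) * (T - snd z)\<bar> \<le> B * T"
        unfolding abs_mult using B[of "fst z"] by (intro mult_mono) auto
    qed
  qed
  have L3: "L1_tendsto (lebesgue_on \<Omega>) (\<lambda>k x. \<eta> x * log_primitive \<epsilon> (\<psi> k (x, 0))) (\<lambda>x. \<eta> x * log_primitive \<epsilon> (u0 x))"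
  proof (rule L1_tendsto_mult_bounded_const[where K=B])
    show "L1_tendsto (lebesgue_on \<Omega>) (\<lambda>k x. log_primitive \<epsilon> (\<psi> k (x, 0))) (\<lambda>x. log_primitive \<epsilon> (u0 x))"
      by (rule compose_L1_tendsto[OF \<Omega> initial log_primitive_has_derivative[OF e] log_weight_bound[OF e]])
    show "\<eta> \<in> borel_measurable (lebesgue_on \<Omega>)" by (intro measurable_lebesgue_onI C1_fun_measurable C\<eta>)
  qed (simp add: B)
  show "integrable LQ (\<lambda>z. \<eta> (fst z) * log_primitive \<epsilon> (u z))" by (rule L1_tendstoD(2)[OF L1])
  have parts: "(LINT z|LQ. (\<eta> (fst z) * (T - snd z)) * (log_weight \<epsilon> (\<psi> k z) * frechet_derivative (\<psi> k) (at z) (0, 1)))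
      - (LINT z|LQ. \<eta> (fst z) * log_primitive \<epsilon> (\<psi> k z)) = - T * (LINT x|lebesgue_on \<Omega>. \<eta> x * log_primitive \<epsilon> (\<psi> k (x, 0)))" for k
  proof -
    note cG = C1_fun_compose[OF WW(1)[of k] log_primitive_has_derivative[OF e] log_weight_continuous[OF e]]
    have dT: "((\<lambda>s. T - s) has_real_derivative - 1) (at s)" for s by (auto intro!: derivative_eq_intros)
    note cT = C1_fun_time[of "\<lambda>s. T - s" "\<lambda>s. - 1", OF dT continuous_on_const]
    note c1 = C1_fun_mult[OF C1_fun_fst(1)[OF C\<eta>] cT(1)]
    note c2 = C1_fun_mult[OF c1(1) cG(1)]
    let ?\<Phi> = "\<lambda>z. \<eta> (fst z) * (T - snd z) * log_primitive \<epsilon> (\<psi> k z)"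
    have lin: "frechet_derivative \<eta> (at x) 0 = 0" for x
      by (rule linear_0[OF has_derivative_linear[OF C1_fun_has_derivative[OF C\<eta>]]])
    have d: "frechet_derivative ?\<Phi> (at z) (0, 1) = (\<eta> (fst z) * (T - snd z)) * (log_weight \<epsilon> (\<psi> k z) * frechet_derivative (\<psi> k) (at z) (0, 1))
        - \<eta> (fst z) * log_primitive \<epsilon> (\<psi> k z)" for z
      unfolding c2(2) c1(2) cG(2) cT(2) C1_fun_fst(2)[OF C\<eta>] by (simp add: lin algebra_simps)
    have "(LINT z|LQ. frechet_derivative ?\<Phi> (at z) (0, 1)) = (LINT x|lebesgue_on \<Omega>. ?\<Phi> (x, T) - ?\<Phi> (x, 0))"
      by (rule integral_time_deriv[OF c2(1) K _ \<Omega>(1) T]) (simp add: \<eta>0)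
    also have "\<dots> = (LINT x|lebesgue_on \<Omega>. - T * (\<eta> x * log_primitive \<epsilon> (\<psi> k (x, 0))))"
      by (intro Bochner_Integration.integral_cong refl) simp
    also have "\<dots> = - T * (LINT x|lebesgue_on \<Omega>. \<eta> x * log_primitive \<epsilon> (\<psi> k (x, 0)))" by (rule integral_mult_right_zero)
    finally show ?thesis
      unfolding d using L1_tendstoD(1)[OF L1, of k] L1_tendstoD(1)[OF L2, of k] by simp
  qed
  have "(LINT z|LQ. (\<eta> (fst z) * (T - snd z)) * (log_weight \<epsilon> (u z) * ut z)) - (LINT z|LQ. \<eta> (fst z) * log_primitive \<epsilon> (u z))
      = - T * (LINT x|lebesgue_on \<Omega>. \<eta> x * log_primitive \<epsilon> (u0 x))"
  proof (rule LIMSEQ_unique)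
    show "(\<lambda>k. - T * (LINT x|lebesgue_on \<Omega>. \<eta> x * log_primitive \<epsilon> (\<psi> k (x, 0)))) \<longlonglongrightarrow>
      (LINT z|LQ. (\<eta> (fst z) * (T - snd z)) * (log_weight \<epsilon> (u z) * ut z)) - (LINT z|LQ. \<eta> (fst z) * log_primitive \<epsilon> (u z))"
      unfolding parts[symmetric] by (intro tendsto_diff L1_tendsto_integral L1 L2)
    show "(\<lambda>k. - T * (LINT x|lebesgue_on \<Omega>. \<eta> x * log_primitive \<epsilon> (\<psi> k (x, 0)))) \<longlonglongrightarrow> - T * (LINT x|lebesgue_on \<Omega>. \<eta> x * log_primitive \<epsilon> (u0 x))"
      by (intro tendsto_mult tendsto_const L1_tendsto_integral L3)
  qed
  also have "(LINT x|lebesgue_on \<Omega>. \<eta> x * log_primitive \<epsilon> (u0 x)) = 0"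
  proof -
    have "AE x in lebesgue_on \<Omega>. \<eta> x * log_primitive \<epsilon> (u0 x) = 0"
      using zero by eventually_elim (auto simp: log_primitive_zero[OF e])
    then have "(LINT x|lebesgue_on \<Omega>. \<eta> x * log_primitive \<epsilon> (u0 x)) = (LINT x|lebesgue_on \<Omega>. 0)"
      using L1_tendstoD(2)[OF L3] by (intro integral_cong_AE) auto
    then show ?thesis by simp
  qed
  finally show "(LINT z|LQ. \<eta> (fst z) * log_primitive \<epsilon> (u z)) =
     (LINT z|LQ. ut z * (log_weight \<epsilon> (u z) * (\<eta> (fst z) * (T - snd z))))"
    by (simp add: ac_simps)
qed

lemma ramp_cutoff:
  assumes \<eta>: "\<eta> \<in> C01 \<Omega>"
  shows "(\<lambda>z. \<eta> (fst z) * ramp T j (snd z)) \<in> C01 (cylinder \<Omega> T)"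
    "space_deriv (\<lambda>z. \<eta> (fst z) * ramp T j (snd z)) z b = frechet_derivative \<eta> (at (fst z)) b * ramp T j (snd z)"
proof -
  note C\<eta> = C01_D(1)[OF \<eta>]
  note cT = C1_fun_time[OF ramp_has_derivative[of T j] ramp_deriv_continuous]
  note c = C1_fun_mult[OF C1_fun_fst(1)[OF C\<eta>] cT(1)]
  show "space_deriv (\<lambda>z. \<eta> (fst z) * ramp T j (snd z)) z b = frechet_derivative \<eta> (at (fst z)) b * ramp T j (snd z)"
    unfolding c(2) cT(2) C1_fun_fst(2)[OF C\<eta>] by simp
  obtain K where K: "compact K" "K \<subseteq> \<Omega>" and \<eta>0: "\<And>x. x \<notin> K \<Longrightarrow> \<eta> x = 0"
    using C01_support[OF \<eta>] by metis
  define a where "a = 1 / real (Suc j)"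
  have a: "0 < a" by (simp add: a_def)
  show "(\<lambda>z. \<eta> (fst z) * ramp T j (snd z)) \<in> C01 (cylinder \<Omega> T)"
  proof (rule C01_I[OF c(1), of "K \<times> {a..T - a}"])
    show "compact (K \<times> {a..T - a})" using K by (intro compact_Times) auto
    show "K \<times> {a..T - a} \<subseteq> cylinder \<Omega> T" using K a by auto
    fix z assume z: "z \<notin> K \<times> {a..T - a}"
    show "\<eta> (fst z) * ramp T j (snd z) = 0"
    proof (cases "fst z \<in> K")
      case True
      then have "snd z \<le> a \<or> T - a \<le> snd z" using z by (cases z) auto
      then show ?thesis unfolding a_def by (simp add: ramp_zero)
    qed (simp add: \<eta>0)
  qed
qed

text \<open>The integral of \<open>\<eta> * log_primitive \<epsilon> u\<close> is bounded by the energy estimate, uniformly in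
  \<open>\<epsilon>\<close>, while the integrand tends to infinity where \<open>\<eta> u > 0\<close>. By Fatou's lemma this set is null.\<close>

lemma vanishes_off_initial_support:
  assumes \<eta>: "\<eta> \<in> C01 \<Omega>" and \<eta>0: "\<And>x. 0 \<le> \<eta> x" and zero: "AE x in lebesgue_on \<Omega>. \<eta> x \<noteq> 0 \<longrightarrow> u0 x = 0"
  shows "AE z in LQ. \<eta> (fst z) \<noteq> 0 \<longrightarrow> u z = 0"
proof -
  obtain B where B: "0 \<le> B" "\<And>x. \<bar>\<eta> x\<bar> \<le> B" using C01_bounded[OF \<eta>] by blast
  have "\<exists>L. \<forall>x. \<bar>frechet_derivative \<eta> (at x) b\<bar> \<le> L" for b
    using C01_deriv_bounded[OF \<eta>, of b] by metis
  then obtain Lb where Lb: "\<And>b x. \<bar>frechet_derivative \<eta> (at x) b\<bar> \<le> Lb b" by metis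
  define L where "L = (\<Sum>b\<in>(Basis::'a set). Lb b)"
  have Lb0: "0 \<le> Lb b" for b using Lb[of 0 b] by linarith
  have L: "\<bar>frechet_derivative \<eta> (at x) b\<bar> \<le> L" if "b \<in> Basis" for b x
    unfolding L_def using Lb[of x b] member_le_sum[OF that, of Lb] Lb0 by fastforce
  define E where "E = real DIM('a) * M powr (m - 1) * (L * T) * energy"
  have bound: "(LINT z|LQ. \<eta> (fst z) * log_primitive \<epsilon> (u z)) \<le> E" if e: "0 < \<epsilon>" for \<epsilon>
  proof -
    have gm [measurable]: "log_weight \<epsilon> \<in> borel_measurable borel" by (rule borel_measurable_continuous_onI[OF log_weight_continuous[OF e]])
    have rm: "(\<lambda>z. \<eta> (fst z) * ramp T j (snd z)) \<in> borel_measurable LQ" for j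
      by (intro measurable_lebesgue_onI C1_fun_measurable C01_D[OF ramp_cutoff(1)[OF \<eta>]])
    note \<eta>Tm = weighted_cutoff_measurable[OF \<eta>]
      note [measurable] = rm \<eta>Tm
    have rB: "\<bar>\<eta> (fst z) * ramp T j (snd z)\<bar> \<le> B * T" for z j
      unfolding abs_mult using B ramp_bounds[OF T, of j "snd z"] by (intro mult_mono) auto
    \<comment> \<open>The weight \<open>T - t\<close> itself is not an admissible cutoff function.\<close>
    have est: "(LINT z|LQ. ut z * (log_weight \<epsilon> (u z) * (\<eta> (fst z) * ramp T j (snd z)))) \<le> E" for j
      unfolding E_def
    proof (rule energy_estimate[OF e ramp_cutoff(1)[OF \<eta>]])
      show "0 \<le> \<eta> (fst z) * ramp T j (snd z)" for z using \<eta>0 ramp_bounds[OF T] by simp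
      show "\<bar>space_deriv (\<lambda>z. \<eta> (fst z) * ramp T j (snd z)) z b\<bar> \<le> L * T" if b: "b \<in> Basis" for z b
        unfolding ramp_cutoff(2)[OF \<eta>] abs_mult
        using L[OF b, of "fst z"] ramp_bounds[OF T, of j "snd z"] by (intro mult_mono) auto
    qed
    have "(\<lambda>j. LINT z|LQ. ut z * (log_weight \<epsilon> (u z) * (\<eta> (fst z) * ramp T j (snd z)))) \<longlonglongrightarrow>
        (LINT z|LQ. ut z * (log_weight \<epsilon> (u z) * (\<eta> (fst z) * (T - snd z))))"
    proof (rule integral_dominated_convergence[where w="\<lambda>z. (1 + 1 / \<epsilon>) * (B * T) * \<bar>ut z\<bar>"])
      show "AE z in LQ. (\<lambda>j. ut z * (log_weight \<epsilon> (u z) * (\<eta> (fst z) * ramp T j (snd z)))) \<longlonglongrightarrow> ut z * (log_weight \<epsilon> (u z) * (\<eta> (fst z) * (T - snd z)))"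
      proof (rule AE_I2)
        fix z assume "z \<in> space LQ"
        then have "0 < snd z" "snd z < T" by (auto simp: mem_Times_iff)
        then show "(\<lambda>j. ut z * (log_weight \<epsilon> (u z) * (\<eta> (fst z) * ramp T j (snd z)))) \<longlonglongrightarrow> ut z * (log_weight \<epsilon> (u z) * (\<eta> (fst z) * (T - snd z)))"
          by (intro tendsto_mult tendsto_const ramp_tendsto)
      qed
      show "AE z in LQ. norm (ut z * (log_weight \<epsilon> (u z) * (\<eta> (fst z) * ramp T j (snd z)))) \<le> (1 + 1 / \<epsilon>) * (B * T) * \<bar>ut z\<bar>" for j
      proof (rule AE_I2)
        fix z
        have "\<bar>log_weight \<epsilon> (u z)\<bar> * \<bar>\<eta> (fst z) * ramp T j (snd z)\<bar> \<le> (1 + 1 / \<epsilon>) * (B * T)"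
          using log_weight_bound[OF e, of "u z"] rB[of z j] e by (intro mult_mono) auto
        from mult_right_mono[OF this abs_ge_zero[of "ut z"]]
        show "norm (ut z * (log_weight \<epsilon> (u z) * (\<eta> (fst z) * ramp T j (snd z)))) \<le> (1 + 1 / \<epsilon>) * (B * T) * \<bar>ut z\<bar>"
          by (simp add: abs_mult ac_simps)
      qed
      show "integrable LQ (\<lambda>z. (1 + 1 / \<epsilon>) * (B * T) * \<bar>ut z\<bar>)"
        using ut_integrable by (intro integrable_mult_right integrable_abs)
    qed measurable
    then have "(LINT z|LQ. ut z * (log_weight \<epsilon> (u z) * (\<eta> (fst z) * (T - snd z)))) \<le> E"
      by (rule LIMSEQ_le_const2) (use est in auto)
    then show ?thesis using time_identity(2)[OF e \<eta> zero] by simp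
  qed
  define X where "X n z = ennreal (\<eta> (fst z) * log_primitive (1 / real (Suc n)) (u z))" for n z
  have en: "0 < 1 / real (Suc n)" for n by simp
  note ti = time_identity(1)[OF en \<eta> zero]
  have Xm: "X n \<in> borel_measurable LQ" for n
    unfolding X_def using ti[of n] by measurable
  have XE: "(\<integral>\<^sup>+z. X n z \<partial>LQ) \<le> ennreal E" for n
  proof -
    have "(\<integral>\<^sup>+z. X n z \<partial>LQ) = ennreal (LINT z|LQ. \<eta> (fst z) * log_primitive (1 / real (Suc n)) (u z))"
      unfolding X_def
      by (rule nn_integral_eq_integral[OF ti]) (intro AE_I2 mult_nonneg_nonneg \<eta>0 log_primitive_nonneg en)
    also have "\<dots> \<le> ennreal E" by (intro ennreal_leI bound en)
    finally show ?thesis .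
  qed
  have "(\<integral>\<^sup>+z. liminf (\<lambda>n. X n z) \<partial>LQ) \<le> liminf (\<lambda>n. \<integral>\<^sup>+z. X n z \<partial>LQ)"
    by (rule nn_integral_liminf[OF Xm])
  also have "\<dots> \<le> ennreal E"
    by (rule Liminf_le) (use XE in \<open>auto intro!: always_eventually\<close>)
  finally have "(\<integral>\<^sup>+z. liminf (\<lambda>n. X n z) \<partial>LQ) \<noteq> \<infinity>"
    using ennreal_less_top[of E] by (metis infinity_ennreal_def neq_top_trans ennreal_neq_top)
  moreover have "(\<lambda>z. liminf (\<lambda>n. X n z)) \<in> borel_measurable LQ"
    using Xm by (intro borel_measurable_liminf)
  ultimately have "AE z in LQ. liminf (\<lambda>n. X n z) \<noteq> \<infinity>"
    by (intro nn_integral_PInf_AE)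
  then show ?thesis
    using AE_space
  proof eventually_elim
    case (elim z)
    show ?case
    proof (rule impI, rule ccontr)
      assume h: "\<eta> (fst z) \<noteq> 0" "u z \<noteq> 0"
      have "0 < \<eta> (fst z)" "0 < u z" using h \<eta>0[of "fst z"] u_nonneg[of z] elim by auto
      then have "filterlim (\<lambda>n. \<eta> (fst z) * log_primitive (1 / real (Suc n)) (u z)) at_top sequentially"
        by (intro filterlim_tendsto_pos_mult_at_top[OF tendsto_const] log_primitive_tendsto_infinity)
      then have "(\<lambda>n. X n z) \<longlonglongrightarrow> \<infinity>"
        unfolding X_def by (simp add: ennreal_tendsto_top_eq_at_top)
      then have "liminf (\<lambda>n. X n z) = \<infinity>" by (intro lim_imp_Liminf) auto
      with elim show False by simp
    qed
  qed
qed

end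

section \<open>Lebesgue's density theorem\<close>

text \<open>Inside an open set \<open>U\<close> around \<open>S\<close>, Vitali's covering theorem covers almost all of \<open>S\<close> by disjoint balls in
  which \<open>F\<close> has proportion at most \<open>c\<close>. Since \<open>S \<subseteq> F\<close>, this covers \<open>S\<close> by a set of measure at most
  \<open>c\<close> times that of \<open>U\<close>. Hence the outer measure of \<open>S\<close> is at most \<open>c < 1\<close> times itself. The
  outer measure is finite because \<open>F\<close> has finite measure.\<close>

lemma negligible_low_density:
  fixes F S :: "'a::euclidean_space set"
  assumes F: "F \<in> lmeasurable" and S: "S \<subseteq> F" and c: "0 \<le> c" "c < 1"
    and low: "\<And>x \<rho>. x \<in> S \<Longrightarrow> 0 < \<rho> \<Longrightarrow>
       \<exists>r. 0 < r \<and> r < \<rho> \<and> measure lebesgue (F \<inter> cball x r) \<le> c * measure lebesgue (cball x r)"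
  shows "negligible S"
proof -
  let ?\<mu> = "measure (lebesgue :: 'a measure)"
  have shrink: "\<exists>T. S \<subseteq> T \<and> T \<in> lmeasurable \<and> ?\<mu> T \<le> c * ?\<mu> U"
    if U: "open U" "U \<in> lmeasurable" "S \<subseteq> U" for U
  proof -
    define K where "K = {(x, r). x \<in> S \<and> 0 < r \<and> cball x r \<subseteq> U \<and> ?\<mu> (F \<inter> cball x r) \<le> c * ?\<mu> (cball x r)}"
    have cov: "\<exists>i. i \<in> K \<and> x \<in> cball (fst i) (snd i) \<and> snd i < d" if x: "x \<in> S" "0 < d" for x d
    proof -
      obtain \<rho> where \<rho>: "0 < \<rho>" "cball x \<rho> \<subseteq> U" using U x open_contains_cball by blast
      have min_pos: "0 < min d \<rho>" using x \<rho> by simp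
      obtain r where r: "0 < r" "r < min d \<rho>" "?\<mu> (F \<inter> cball x r) \<le> c * ?\<mu> (cball x r)"
        using low[OF x(1) min_pos] by blast
      have "cball x r \<subseteq> cball x \<rho>" using r by (intro subset_cball) auto
      then show ?thesis using x r \<rho> by (intro exI[of _ "(x, r)"]) (auto simp: K_def)
    qed
    have Kpos: "0 < snd i" if "i \<in> K" for i using that by (auto simp: K_def)
    obtain D where D: "countable D" "D \<subseteq> K"
      "pairwise (\<lambda>i j. disjnt (cball (fst i) (snd i)) (cball (fst j) (snd j))) D"
      "negligible (S - (\<Union>i\<in>D. cball (fst i) (snd i)))"
      by (rule Vitali_covering_theorem_cballs[of K snd S fst, OF Kpos cov])
    define B where "B i = cball (fst i) (snd i)" for i :: "'a \<times> real"
    have Bm: "B i \<in> lmeasurable" for i by (simp add: B_def)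
    have FBm: "F \<inter> B i \<in> lmeasurable" for i using F Bm by (intro fmeasurable.Int) auto
    have fin: "?\<mu> (\<Union>i\<in>I. F \<inter> B i) \<le> c * ?\<mu> U" if I: "I \<subseteq> D" "finite I" for I
    proof -
      have "?\<mu> (\<Union>i\<in>I. F \<inter> B i) \<le> (\<Sum>i\<in>I. ?\<mu> (F \<inter> B i))"
        using I FBm by (intro measure_UNION_le) auto
      also have "\<dots> \<le> (\<Sum>i\<in>I. c * ?\<mu> (B i))"
        using I D by (intro sum_mono) (auto simp: K_def B_def)
      also have "\<dots> = c * (\<Sum>i\<in>I. ?\<mu> (B i))" by (simp add: sum_distrib_left)
      also have "(\<Sum>i\<in>I. ?\<mu> (B i)) = ?\<mu> (\<Union>i\<in>I. B i)"
        using I Bm pairwise_subset[OF D(3) I(1)] by (subst measure_UNION') (auto simp: B_def)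
      also have "c * \<dots> \<le> c * ?\<mu> U"
      proof (intro mult_left_mono measure_mono_fmeasurable c)
        have "B i \<subseteq> U" if "i \<in> D" for i
        proof -
          have "i \<in> K" using that D(2) by blast
          then show ?thesis by (simp add: K_def B_def case_prod_beta)
        qed
        then show "(\<Union>i\<in>I. B i) \<subseteq> U" using I by blast
        show "(\<Union>i\<in>I. B i) \<in> sets lebesgue" using I Bm by (intro sets.finite_UN) auto
      qed (use U in auto)
      finally show ?thesis .
    qed
    have UN: "(\<Union>i\<in>D. F \<inter> B i) \<in> lmeasurable" "?\<mu> (\<Union>i\<in>D. F \<inter> B i) \<le> c * ?\<mu> U"
      by (rule fmeasurable_UN_bound[OF D(1) FBm fin] measure_UN_bound[OF D(1) FBm fin]; assumption)+
    define N where "N = S - (\<Union>i\<in>D. B i)"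
    have N: "negligible N" using D(4) by (simp add: N_def B_def)
    show ?thesis
    proof (intro exI conjI)
      show "S \<subseteq> N \<union> (\<Union>i\<in>D. F \<inter> B i)" using S by (auto simp: N_def)
      show "N \<union> (\<Union>i\<in>D. F \<inter> B i) \<in> lmeasurable"
        by (rule fmeasurable.Un[OF negligible_imp_measurable[OF N] UN(1)])
      have "?\<mu> (N \<union> (\<Union>i\<in>D. F \<inter> B i)) \<le> ?\<mu> N + ?\<mu> (\<Union>i\<in>D. F \<inter> B i)"
        using negligible_imp_measurable[OF N] UN by (intro measure_Un_le) auto
      then show "?\<mu> (N \<union> (\<Union>i\<in>D. F \<inter> B i)) \<le> c * ?\<mu> U"
        using UN negligible_imp_measure0[OF N] by simp
    qed
  qed
  define \<A> where "\<A> = ?\<mu> ` {T. S \<subseteq> T \<and> T \<in> lmeasurable}"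
  have ne: "\<A> \<noteq> {}" using F S by (auto simp: \<A>_def)
  have bd: "bdd_below \<A>" by (rule bdd_belowI[of _ 0]) (auto simp: \<A>_def)
  have le: "Inf \<A> \<le> ?\<mu> T" if "S \<subseteq> T" "T \<in> lmeasurable" for T
    using that by (intro cInf_lower bd) (auto simp: \<A>_def)
  have inf0: "Inf \<A> \<le> 0"
  proof (rule ccontr)
    assume "\<not> Inf \<A> \<le> 0"
    then have pos: "0 < Inf \<A>" by simp
    \<comment> \<open>Half of the gap between \<open>Inf \<A>\<close> and \<open>c * Inf \<A>\<close>.\<close>
    define e where "e = (1 - c) * Inf \<A> / 2"
    have e: "0 < e" using pos c by (simp add: e_def)
    obtain T where T: "S \<subseteq> T" "T \<in> lmeasurable" "?\<mu> T < Inf \<A> + e / 2"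
      using cInf_lessD[OF ne, of "Inf \<A> + e / 2"] e by (auto simp: \<A>_def)
    obtain U where U: "open U" "T \<subseteq> U" "U - T \<in> lmeasurable" "emeasure lebesgue (U - T) < ennreal (e / 2)"
      using sets_lebesgue_outer_open[of T "e / 2"] T e by (auto simp: fmeasurableD)
    have Um: "U \<in> lmeasurable"
      using fmeasurable.Un[OF T(2) U(3)] U(2) by (simp add: Un_absorb1)
    have "?\<mu> U \<le> ?\<mu> T + ?\<mu> (U - T)"
      using measure_Un_le[of T lebesgue "U - T"] T U by (auto simp: Un_absorb1 fmeasurableD)
    moreover have "?\<mu> (U - T) < e / 2"
      using U(3,4) e by (simp add: emeasure_eq_measure2 ennreal_less_iff)
    ultimately have "?\<mu> U < Inf \<A> + e" using T by simp
    moreover obtain T' where T': "S \<subseteq> T'" "T' \<in> lmeasurable" "?\<mu> T' \<le> c * ?\<mu> U"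
      using shrink[OF U(1) Um] T U by blast
    ultimately have "Inf \<A> \<le> c * (Inf \<A> + e)"
      using le[OF T'(1,2)] c mult_left_mono[of "?\<mu> U" "Inf \<A> + e" c] by linarith
    also have "\<dots> \<le> c * Inf \<A> + e" using c e mult_right_mono[of c 1 e] by (simp add: algebra_simps)
    also have "\<dots> < Inf \<A>"
    proof -
      have "c * Inf \<A> < Inf \<A>" using mult_strict_right_mono[OF c(2) pos] by simp
      moreover have "e = (Inf \<A> - c * Inf \<A>) / 2" by (simp add: e_def left_diff_distrib)
      moreover have "x + (y - x) / 2 < y" if "x < y" for x y :: real using that by (simp add: field_simps)
      ultimately show ?thesis by metis
    qed
    finally show False by simp
  qed
  show ?thesis unfolding negligible_outer_le
  proof (intro allI impI)
    fix e :: real assume "0 < e"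
    then have "Inf \<A> < e" using inf0 by simp
    then obtain T where "S \<subseteq> T" "T \<in> lmeasurable" "?\<mu> T < e"
      using cInf_lessD[OF ne] by (auto simp: \<A>_def)
    then show "\<exists>T. S \<subseteq> T \<and> T \<in> lmeasurable \<and> ?\<mu> T \<le> e" by (auto intro: less_imp_le)
  qed
qed

text \<open>At a point of \<open>F\<close> without density \<open>1\<close> the proportion of \<open>F\<close> is at most \<open>1 - 1 / real (Suc n)\<close> in
  arbitrarily small balls, for some \<open>n\<close>.\<close>

theorem lebesgue_density:
  fixes F :: "'a::euclidean_space set"
  assumes F: "F \<in> lmeasurable"
  shows "negligible {x \<in> F. \<not> ((\<lambda>r. measure lebesgue (F \<inter> cball x r) / measure lebesgue (cball x r)) \<longlongrightarrow> 1) (at_right 0)}"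
proof -
  let ?\<mu> = "measure (lebesgue :: 'a measure)"
  define S where "S n = {x \<in> F. \<forall>\<rho>>0. \<exists>r. 0 < r \<and> r < \<rho> \<and> ?\<mu> (F \<inter> cball x r) \<le> (1 - 1 / real (Suc n)) * ?\<mu> (cball x r)}" for n
  have "negligible (S n)" for n
    by (rule negligible_low_density[OF F, of _ "1 - 1 / real (Suc n)"]) (auto simp: S_def)
  then have "negligible (\<Union>n. S n)" by (rule negligible_Union_nat)
  then show ?thesis
  proof (rule negligible_subset, intro subsetI, clarify)
    fix x assume x: "x \<in> F" and nt: "\<not> ((\<lambda>r. ?\<mu> (F \<inter> cball x r) / ?\<mu> (cball x r)) \<longlongrightarrow> 1) (at_right 0)"
    have le1: "?\<mu> (F \<inter> cball x r) / ?\<mu> (cball x r) \<le> 1" for r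
    proof (cases "?\<mu> (cball x r) = 0")
      case False
      then have "0 < ?\<mu> (cball x r)" by (metis measure_nonneg less_eq_real_def)
      moreover have "?\<mu> (F \<inter> cball x r) \<le> ?\<mu> (cball x r)"
        using F by (intro measure_mono_fmeasurable sets.Int) (auto simp: fmeasurableD)
      ultimately show ?thesis by simp
    next
      case True
      show ?thesis unfolding True by simp
    qed
    show "x \<in> (\<Union>n. S n)"
    proof (rule ccontr)
      assume notin: "x \<notin> (\<Union>n. S n)"
      have "((\<lambda>r. ?\<mu> (F \<inter> cball x r) / ?\<mu> (cball x r)) \<longlongrightarrow> 1) (at_right 0)"
      proof (rule order_tendstoI)
        fix a :: real assume "1 < a"
        then show "\<forall>\<^sub>F r in at_right 0. ?\<mu> (F \<inter> cball x r) / ?\<mu> (cball x r) < a"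
          using le1 by (intro always_eventually allI) (rule le_less_trans)
      next
        fix a :: real assume "a < 1"
        then obtain n where n: "1 / real (Suc n) < 1 - a"
          using nat_approx_posE[of "1 - a"] by (auto simp: )
        from notin x obtain \<rho> where \<rho>: "0 < \<rho>" "\<And>r. 0 < r \<Longrightarrow> r < \<rho> \<Longrightarrow> (1 - 1 / real (Suc n)) * ?\<mu> (cball x r) < ?\<mu> (F \<inter> cball x r)"
          by (auto simp: S_def not_le) (metis)
        show "\<forall>\<^sub>F r in at_right 0. a < ?\<mu> (F \<inter> cball x r) / ?\<mu> (cball x r)"
          unfolding eventually_at_right_field
        proof (intro exI[of _ \<rho>] conjI allI impI \<rho>(1))
          fix r :: real assume r: "0 < r" "r < \<rho>"
          have p: "0 < ?\<mu> (cball x r)" using r by (simp add: content_cball_pos)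
          have "a * ?\<mu> (cball x r) \<le> (1 - 1 / real (Suc n)) * ?\<mu> (cball x r)"
            using n p by (intro mult_right_mono) auto
          also have "\<dots> < ?\<mu> (F \<inter> cball x r)" by (rule \<rho>(2)[OF r])
          finally show "a < ?\<mu> (F \<inter> cball x r) / ?\<mu> (cball x r)" using p by (simp add: less_divide_eq)
        qed
      qed
      with nt show False by simp
    qed
  qed
qed

section \<open>The support of the solution\<close>

lemma L1_tendsto_nn_integral:
  assumes F: "\<And>k. integrable M (F k)" and f: "f \<in> borel_measurable M"
    and lim: "(\<lambda>k. \<integral>\<^sup>+x. ennreal \<bar>F k x - f x\<bar> \<partial>M) \<longlonglongrightarrow> 0"
  shows "L1_tendsto M F f"
proof -
  have Fm: "F k \<in> borel_measurable M" for k using F by auto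
  note [measurable] = f Fm
  obtain k where k: "(\<integral>\<^sup>+x. ennreal \<bar>F k x - f x\<bar> \<partial>M) < 1"
    using order_tendstoD(2)[OF lim, of 1] by (auto simp: eventually_sequentially)
  have "integrable M (\<lambda>x. F k x - f x)"
  proof (rule integrableI_bounded)
    have "(\<integral>\<^sup>+x. ennreal (norm (F k x - f x)) \<partial>M) < 1" using k by simp
    also have "(1::ennreal) < \<infinity>" by simp
    finally show "(\<integral>\<^sup>+x. ennreal (norm (F k x - f x)) \<partial>M) < \<infinity>" .
  qed measurable
  from Bochner_Integration.integrable_diff[OF F[of k] this] have fi: "integrable M f" by simp
  have "(\<integral>\<^sup>+x. ennreal \<bar>F k x - f x\<bar> \<partial>M) = ennreal (LINT x|M. \<bar>F k x - f x\<bar>)" for k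
    using F fi by (intro nn_integral_eq_integral) auto
  with lim have "(\<lambda>k. ennreal (LINT x|M. \<bar>F k x - f x\<bar>)) \<longlonglongrightarrow> ennreal 0" by simp
  then have "(\<lambda>k. LINT x|M. \<bar>F k x - f x\<bar>) \<longlonglongrightarrow> 0"
    by (subst (asm) tendsto_ennreal_iff) auto
  then show ?thesis using F fi by (simp add: L1_tendsto_def)
qed

lemma continuous_integrable_on_bounded:
  fixes g :: "'b::euclidean_space \<Rightarrow> real"
  assumes g: "continuous_on UNIV g" and Q: "open Q" "bounded Q"
  shows "integrable (lebesgue_on Q) g"
proof -
  obtain R where R: "Q \<subseteq> cball 0 R" using Q(2) by (auto simp: bounded_iff subset_iff)
  have "integrable lborel (\<lambda>z. indicator (cball 0 R) z *\<^sub>R g z)"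
    by (rule borel_integrable_compact[OF compact_cball continuous_on_subset[OF g]]) auto
  then have "integrable lebesgue (\<lambda>z. indicator (cball 0 R) z *\<^sub>R g z)"
    by (subst integrable_completion) auto
  then have "integrable lebesgue (\<lambda>z. indicator Q z *\<^sub>R (indicator (cball 0 R) z *\<^sub>R g z))"
    using Q by (intro integrable_mult_indicator[of Q lebesgue "\<lambda>z. indicator (cball 0 R) z *\<^sub>R g z"]) auto
  also have "(\<lambda>z. indicator Q z *\<^sub>R (indicator (cball 0 R) z *\<^sub>R g z)) = (\<lambda>z. indicator Q z * g z)"
    using R by (auto simp: fun_eq_iff indicator_def)
  finally show ?thesis by (simp add: integrable_lebesgue_on_iff[OF Q(1)])
qed

lemma log_hoelder_continuous:
  assumes "log_hoelder_on S p"
  shows "continuous_on S p"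
proof -
  obtain C where C: "0 < C" "\<And>x y. x \<in> S \<Longrightarrow> y \<in> S \<Longrightarrow> x \<noteq> y \<Longrightarrow> \<bar>p x - p y\<bar> \<le> C / ln (exp 1 + 1 / dist x y)"
    using assms by (auto simp: log_hoelder_on_def)
  show ?thesis unfolding continuous_on_iff
  proof (intro ballI allI impI)
    fix x and e :: real assume x: "x \<in> S" and e: "0 < e"
    show "\<exists>d>0. \<forall>y\<in>S. dist y x < d \<longrightarrow> dist (p y) (p x) < e"
    proof (intro exI[of _ "exp (- (C / e))"] conjI ballI impI)
      fix y assume y: "y \<in> S" "dist y x < exp (- (C / e))"
      show "dist (p y) (p x) < e"
      proof (cases "y = x")
        case False
        then have d: "0 < dist y x" by simp
        have "exp (C / e) < 1 / dist y x" using y(2) d by (simp add: exp_minus field_simps)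
        then have "exp (C / e) < exp 1 + 1 / dist y x" by (simp add: add_strict_increasing2 less_imp_le)
        then have "ln (exp (C / e)) < ln (exp 1 + 1 / dist y x)"
          by (intro ln_less_cancel_iff[THEN iffD2]) (auto intro: less_trans[OF exp_gt_zero])
        then have l: "C / e < ln (exp 1 + 1 / dist y x)" by simp
        have "0 < C / e" using C e by simp
        with l have l0: "0 < ln (exp 1 + 1 / dist y x)" by linarith
        have "\<bar>p y - p x\<bar> \<le> C / ln (exp 1 + 1 / dist y x)" by (rule C(2)[OF y(1) x False])
        also have "\<dots> < e" using l l0 e by (simp add: field_simps)
        finally show ?thesis by (simp add: dist_real_def)
      qed (use e in simp)
    qed simp
  qed
qed

text \<open>The null set is enlarged to a Borel set, to which Fubini's theorem for the product of the
  uncompleted measures applies.\<close>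

lemma AE_slices:
  fixes P :: "'a::euclidean_space \<times> real \<Rightarrow> bool"
  assumes "AE z in lebesgue. P z"
  shows "AE t in lebesgue. negligible {x. \<not> P (x, t)}"
proof -
  have "AE z in (lborel :: ('a \<times> real) measure). P z" using assms by (simp add: AE_completion_iff)
  then obtain N where N: "N \<in> null_sets (lborel :: ('a \<times> real) measure)" "{z. \<not> P z} \<subseteq> N"
    by (auto simp: eventually_ae_filter)
  have Nm: "N \<in> sets (lborel \<Otimes>\<^sub>M lborel)" unfolding lborel_prod using N(1) by auto
  have "AE z in (lborel \<Otimes>\<^sub>M lborel). z \<notin> N" unfolding lborel_prod by (rule AE_not_in[OF N(1)])
  then have "AE x in lborel. AE t in lborel. (x, t) \<notin> N" by (rule lborel_pair.AE_pair)
  then have "AE t in lborel. AE x in lborel. (x, t) \<notin> N"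
    using sets.compl_sets[OF Nm] by (subst (asm) lborel_pair.AE_commute) (simp_all add: set_diff_eq)
  then have "AE t in lborel. negligible {x. \<not> P (x, t)}"
  proof eventually_elim
    case (elim t)
    then have "AE x in lebesgue. (x, t) \<notin> N" by (rule AE_completion)
    then have "negligible {x. \<not> (x, t) \<notin> N}" by (simp only: AE_lebesgue_iff)
    then show ?case by (rule negligible_subset) (use N(2) in auto)
  qed
  then show ?thesis by (rule AE_completion)
qed

text \<open>The derivatives that occur in a trace are some weak derivatives of \<open>u\<close>; by uniqueness they are the
  given ones.\<close>

lemma W11_approx_from_traces:
  fixes Q :: "('a::euclidean_space \<times> real) set"
  assumes Q: "open Q" "bounded Q" and \<Omega>: "open \<Omega>" "bounded \<Omega>"
    and tr: "has_trace Q u (lebesgue_on \<Omega>) (\<lambda>x. (x, 0)) u0"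
    and um: "u \<in> borel_measurable (lebesgue_on Q)"
    and Du: "has_space_grad Q u Du" and ut: "has_weak_deriv Q (0, 1) u ut"
  obtains \<psi> where "W11_approx Q \<psi> u (\<lambda>e z. Du z \<bullet> fst e + ut z * snd e)"
    "L1_tendsto (lebesgue_on \<Omega>) (\<lambda>k x. \<psi> k (x, 0)) u0"
proof -
  let ?d = "\<lambda>e z. Du z \<bullet> fst e + ut z * snd e"
  from tr obtain \<psi> where u0m: "u0 \<in> borel_measurable (lebesgue_on \<Omega>)"
    and C1: "\<And>k. C1_fun (\<psi> k)"
    and l1: "(\<lambda>k. \<integral>\<^sup>+z. ennreal \<bar>\<psi> k z - u z\<bar> \<partial>lebesgue_on Q) \<longlonglongrightarrow> 0"
    and l2: "\<And>e. e \<in> Basis \<Longrightarrow> \<exists>d. has_weak_deriv Q e u d \<and>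
         (\<lambda>k. \<integral>\<^sup>+z. ennreal \<bar>frechet_derivative (\<psi> k) (at z) e - d z\<bar> \<partial>lebesgue_on Q) \<longlonglongrightarrow> 0"
    and l3: "(\<lambda>k. \<integral>\<^sup>+x. ennreal \<bar>\<psi> k (x, 0) - u0 x\<bar> \<partial>lebesgue_on \<Omega>) \<longlonglongrightarrow> 0"
    unfolding has_trace_def by blast
  have L1: "L1_tendsto (lebesgue_on Q) \<psi> u"
    by (rule L1_tendsto_nn_integral[OF _ um l1]) (intro continuous_integrable_on_bounded C1_fun_continuous C1 Q)
  have L3: "L1_tendsto (lebesgue_on \<Omega>) (\<lambda>k x. \<psi> k (x, 0)) u0"
  proof (rule L1_tendsto_nn_integral[OF _ u0m l3])
    have "continuous_on UNIV (\<lambda>x. \<psi> k (x, 0))" for k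
      by (rule continuous_on_compose2[OF C1_fun_continuous[OF C1[of k], of UNIV]]) (auto intro!: continuous_intros)
    then show "integrable (lebesgue_on \<Omega>) (\<lambda>x. \<psi> k (x, 0))" for k
      by (intro continuous_integrable_on_bounded \<Omega>)
  qed
  have L2: "L1_tendsto (lebesgue_on Q) (\<lambda>k z. frechet_derivative (\<psi> k) (at z) e) (?d e)" if e: "e \<in> Basis" for e
  proof -
    have wd: "has_weak_deriv Q e u (?d e)"
    proof (cases "snd e = 0")
      case True
      then obtain b where b: "b \<in> Basis" "e = (b, 0)" using e by (auto simp: Basis_prod_def)
      then show ?thesis using Du by (simp add: has_space_grad_def)
    next
      case False
      then have "e = (0, 1)" using e by (auto simp: Basis_prod_def)
      then show ?thesis using ut by simp
    qed
    obtain d where d: "has_weak_deriv Q e u d"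
      "(\<lambda>k. \<integral>\<^sup>+z. ennreal \<bar>frechet_derivative (\<psi> k) (at z) e - d z\<bar> \<partial>lebesgue_on Q) \<longlonglongrightarrow> 0"
      using l2[OF e] by blast
    have m: "d \<in> borel_measurable (lebesgue_on Q)" "?d e \<in> borel_measurable (lebesgue_on Q)"
      using d(1) wd by (auto simp: has_weak_deriv_def intro!: locally_integrable_measurable[OF Q(1)])
    have "L1_tendsto (lebesgue_on Q) (\<lambda>k z. frechet_derivative (\<psi> k) (at z) e) d"
      by (rule L1_tendsto_nn_integral[OF _ m(1) d(2)]) (intro continuous_integrable_on_bounded C1_fun_continuous_deriv C1 Q)
    then show ?thesis
      by (rule L1_tendsto_cong_AE[OF _ weak_deriv_unique[OF Q(1) d(1) wd] m(2)])
  qed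
  obtain r :: "nat \<Rightarrow> nat" where r: "strict_mono r" "AE z in lebesgue_on Q. (\<lambda>k. \<psi> (r k) z) \<longlonglongrightarrow> u z"
    using L1_tendsto_AE_subseq[OF L1] by blast
  show ?thesis
  proof (rule that[of "\<lambda>k. \<psi> (r k)"])
    show "W11_approx Q (\<lambda>k. \<psi> (r k)) u ?d"
      unfolding W11_approx_def
      using C1 r L1_tendsto_subseq[OF L1 r(1)] L1_tendsto_subseq[OF L2 r(1)] by auto
    show "L1_tendsto (lebesgue_on \<Omega>) (\<lambda>k x. \<psi> (r k) (x, 0)) u0"
      by (rule L1_tendsto_subseq[OF L3 r(1)])
  qed
qed

text \<open>Almost all points at which \<open>f\<close> is positive are points of density \<open>1\<close> of the set of these points, and
  these belong to the support.\<close>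

lemma AE_zero_off_msupp:
  assumes \<Omega>: "open \<Omega>" "bounded \<Omega>" and f: "f \<in> borel_measurable (lebesgue_on \<Omega>)"
    and nn: "\<And>x. x \<in> \<Omega> \<Longrightarrow> 0 \<le> f x"
  shows "AE x in lebesgue_on \<Omega>. x \<notin> msupp \<Omega> f \<longrightarrow> f x = 0"
proof -
  define F where "F = {x \<in> \<Omega>. f x > 0}"
  have "{x \<in> space (lebesgue_on \<Omega>). f x > 0} \<in> sets (lebesgue_on \<Omega>)" using f by measurable
  then have "F \<in> sets lebesgue"
    using \<Omega>(1) by (simp add: F_def sets_restrict_space_iff)
  then have F: "F \<in> lmeasurable"
    using bounded_set_imp_lmeasurable[of F] bounded_subset[OF \<Omega>(2)] by (auto simp: F_def)
  let ?\<rho> = "\<lambda>x r. measure lebesgue (F \<inter> cball x r) / measure lebesgue (cball x r)"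
  have "F - msupp \<Omega> f \<subseteq> {x \<in> F. \<not> (?\<rho> x \<longlongrightarrow> 1) (at_right 0)}"
  proof (intro subsetI, clarify)
    fix x assume x: "x \<in> F" "x \<notin> msupp \<Omega> f" "(?\<rho> x \<longlongrightarrow> 1) (at_right 0)"
    have "x \<in> {x \<in> F. \<exists>l>0. (?\<rho> x \<longlongrightarrow> l) (at_right 0)}"
      using x by (auto intro: exI[of _ 1])
    then have "x \<in> msupp \<Omega> f" unfolding msupp_def Let_def F_def[symmetric] by (rule subsetD[OF closure_subset])
    then show False using x by simp
  qed
  then have "negligible (F - msupp \<Omega> f)" by (rule negligible_subset[OF lebesgue_density[OF F]])
  moreover have "{x. \<not> (x \<in> \<Omega> \<longrightarrow> x \<notin> msupp \<Omega> f \<longrightarrow> f x = 0)} \<subseteq> F - msupp \<Omega> f"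
  proof (intro subsetI)
    fix x assume "x \<in> {x. \<not> (x \<in> \<Omega> \<longrightarrow> x \<notin> msupp \<Omega> f \<longrightarrow> f x = 0)}"
    then have x: "x \<in> \<Omega>" "x \<notin> msupp \<Omega> f" "f x \<noteq> 0" by auto
    then show "x \<in> F - msupp \<Omega> f" using nn[OF x(1)] by (simp add: F_def)
  qed
  ultimately have "negligible {x. \<not> (x \<in> \<Omega> \<longrightarrow> x \<notin> msupp \<Omega> f \<longrightarrow> f x = 0)}"
    by (rule negligible_subset)
  then show ?thesis unfolding AE_lebesgue_on_iff[OF \<Omega>(1)] AE_lebesgue_iff .
qed

text \<open>At a point of \<open>\<Omega>\<close> outside \<open>S\<close> the set where \<open>f\<close> is positive has density \<open>0\<close>.\<close>

lemma msupp_subset: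
  assumes \<Omega>: "open \<Omega>" and S: "closed S" and null: "negligible {x \<in> \<Omega> - S. f x \<noteq> 0}"
  shows "msupp \<Omega> f \<subseteq> S"
  unfolding msupp_def Let_def
proof (rule closure_minimal[OF _ S], intro subsetI, clarify)
  fix x and l :: real
  define F where "F = {x \<in> \<Omega>. f x > 0}"
  assume x: "x \<in> \<Omega>" "0 < l"
    and "((\<lambda>r. measure lebesgue ({x \<in> \<Omega>. f x > 0} \<inter> cball x r) / measure lebesgue (cball x r)) \<longlongrightarrow> l) (at_right 0)"
  then have lim: "((\<lambda>r. measure lebesgue (F \<inter> cball x r) / measure lebesgue (cball x r)) \<longlongrightarrow> l) (at_right 0)"
    by (simp add: F_def)
  show "x \<in> S"
  proof (rule ccontr)
    assume "x \<notin> S"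
    moreover have "open (\<Omega> - S)" using \<Omega> S by (rule open_Diff)
    ultimately obtain \<rho> where \<rho>: "0 < \<rho>" "cball x \<rho> \<subseteq> \<Omega> - S" using x open_contains_cball[of "\<Omega> - S"] by blast
    have "\<forall>\<^sub>F r in at_right 0. measure lebesgue (F \<inter> cball x r) / measure lebesgue (cball x r) = 0"
      unfolding eventually_at_right_field
    proof (intro exI[of _ \<rho>] conjI allI impI \<rho>(1))
      fix r :: real assume r: "0 < r" "r < \<rho>"
      have "cball x r \<subseteq> cball x \<rho>" using r by (intro subset_cball) auto
      then have "F \<inter> cball x r \<subseteq> {x \<in> \<Omega> - S. f x \<noteq> 0}" using \<rho>(2) by (auto simp: F_def)
      then have "negligible (F \<inter> cball x r)" by (rule negligible_subset[OF null])
      then show "measure lebesgue (F \<inter> cball x r) / measure lebesgue (cball x r) = 0"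
        by (simp add: negligible_imp_measure0)
    qed
    then have "((\<lambda>r. measure lebesgue (F \<inter> cball x r) / measure lebesgue (cball x r)) \<longlongrightarrow> 0) (at_right 0)"
      by (rule tendsto_eventually)
    from tendsto_unique[OF _ lim this] have "l = 0" by simp
    then show False using x by simp
  qed
qed

theorem theorem2:
  fixes \<Omega> :: "'a::euclidean_space set"
    and T m p_minus p_plus :: real
    and p u0 :: "'a \<Rightarrow> real"
    and u :: "'a \<times> real \<Rightarrow> real"
  assumes "open \<Omega>" and "connected \<Omega>" and "\<Omega> \<noteq> {}" and "bounded \<Omega>" and "lipschitz_boundary \<Omega>"
    and "0 < T"
    and "log_hoelder_on (closure \<Omega>) p"
    and "1 < p_minus" and "\<And>x. x \<in> closure \<Omega> \<Longrightarrow> p_minus \<le> p x \<and> p x \<le> p_plus"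
    and "1 \<le> m"
    and "\<And>x. x \<in> \<Omega> \<Longrightarrow> 0 \<le> u0 x" and "msupp \<Omega> u0 \<subset> \<Omega>"
    and "weak_solution \<Omega> T p m u0 u"
  shows "AE t in lebesgue_on {0<..T}. msupp \<Omega> (\<lambda>x. u (x, t)) \<subseteq> msupp \<Omega> u0"
proof -
  note \<Omega> = \<open>open \<Omega>\<close> \<open>bounded \<Omega>\<close>
  define Q where "Q = cylinder \<Omega> T"
  have Qo: "open Q" "bounded Q" using \<Omega> by (auto simp: Q_def open_Times bounded_Times)
  have fstQ: "z \<in> Q \<Longrightarrow> fst z \<in> closure \<Omega>" for z using closure_subset[of \<Omega>] by (auto simp: Q_def)
  from \<open>weak_solution \<Omega> T p m u0 u\<close> obtain ut where
    u0: "\<And>z. z \<in> Q \<Longrightarrow> 0 \<le> u z" and uU: "u \<in> U_space \<Omega> T p" and uL: "Linf_fun Q u"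
    and ut: "has_weak_deriv Q (0, 1) u ut"
    and weak: "\<And>\<phi>. \<phi> \<in> C01 Q \<Longrightarrow> (LINT z|lebesgue_on Q. ut z * \<phi> z) +
          (LINT z|lebesgue_on Q. (norm (space_grad Q u z) powr (p (fst z) - 2) *\<^sub>R space_grad Q u z) \<bullet>
             space_grad Q (\<lambda>y. u y powr m * \<phi> y) z) = 0"
    and tr: "initial_trace \<Omega> T u u0"
    unfolding weak_solution_def Let_def Q_def[symmetric] by blast
  define Du where "Du = space_grad Q u"
  have Du: "has_space_grad Q u Du"
  proof -
    have "\<exists>G. has_space_grad Q u G" using uU unfolding U_space_def Q_def[symmetric] by blast
    then show ?thesis unfolding Du_def space_grad_def by (rule someI_ex)
  qed
  have Di: "integrable (lebesgue_on Q) (\<lambda>z. norm (Du z) powr p (fst z))"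
    using uU unfolding U_space_def Du_def Q_def[symmetric] by auto
  have um: "u \<in> borel_measurable (lebesgue_on Q)" using uL by (simp add: Linf_fun_def)
  obtain M0 where M0: "AE z in lebesgue_on Q. \<bar>u z\<bar> \<le> M0" using uL by (auto simp: Linf_fun_def)
  define M where "M = max M0 1"
  have uM: "AE z in lebesgue_on Q. u z \<le> M" using M0 by eventually_elim (auto simp: M_def)
  have tr': "has_trace Q u (lebesgue_on \<Omega>) (\<lambda>x. (x, 0)) u0" using tr by (simp add: initial_trace_def Q_def)
  obtain \<psi> where W: "W11_approx Q \<psi> u (\<lambda>e z. Du z \<bullet> fst e + ut z * snd e)"
    and init: "L1_tendsto (lebesgue_on \<Omega>) (\<lambda>k x. \<psi> k (x, 0)) u0"
    using W11_approx_from_traces[OF Qo \<Omega> tr' um Du ut] by blast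
  obtain C where C: "0 < C" "\<And>x y. x \<in> closure \<Omega> \<Longrightarrow> y \<in> closure \<Omega> \<Longrightarrow> x \<noteq> y \<Longrightarrow> \<bar>p x - p y\<bar> \<le> C / ln (exp 1 + 1 / dist x y)"
    using \<open>log_hoelder_on (closure \<Omega>) p\<close> by (auto simp: log_hoelder_on_def)
  have pm: "(\<lambda>z. p (fst z)) \<in> borel_measurable (lebesgue_on Q)"
  proof (rule continuous_imp_measurable_on_sets_lebesgue)
    show "continuous_on Q (\<lambda>z. p (fst z))"
      by (rule continuous_on_compose2[OF log_hoelder_continuous[OF \<open>log_hoelder_on (closure \<Omega>) p\<close>]])
         (use fstQ in \<open>auto intro!: continuous_intros\<close>)
  qed (use Qo in auto)
  have p_log: "\<bar>p (fst y) - p (fst z)\<bar> \<le> C / ln (exp 1 + 1 / dist y z)" if yz: "y \<in> Q" "z \<in> Q" "y \<noteq> z" for y z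
  proof -
    have d: "0 < dist y z" using yz by simp
    have "(1::real) < exp 1" "0 < 1 / dist y z" using d by auto
    then have "1 < exp 1 + 1 / dist y z" by linarith
    then have l: "0 < ln (exp 1 + 1 / dist y z)" by (rule ln_gt_zero)
    show ?thesis
    proof (cases "fst y = fst z")
      case True
      then show ?thesis using C l by simp
    next
      case False
      then have d': "0 < dist (fst y) (fst z)" by simp
      have "\<bar>p (fst y) - p (fst z)\<bar> \<le> C / ln (exp 1 + 1 / dist (fst y) (fst z))"
        by (rule C(2)[OF fstQ fstQ False]) (use yz in auto)
      also have "\<dots> \<le> C / ln (exp 1 + 1 / dist y z)"
      proof (intro divide_left_mono)
        have "1 / dist y z \<le> 1 / dist (fst y) (fst z)" using d' dist_fst_le[of y z] by (intro divide_left_mono mult_pos_pos d) auto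
        then show "ln (exp 1 + 1 / dist y z) \<le> ln (exp 1 + 1 / dist (fst y) (fst z))"
          using d by (subst ln_le_cancel_iff) (auto intro!: add_pos_pos)
        then show "0 < ln (exp 1 + 1 / dist (fst y) (fst z)) * ln (exp 1 + 1 / dist y z)" using l by simp
      qed (use C in simp)
      finally show ?thesis .
    qed
  qed
  interpret degenerate_cauchy_problem \<Omega> T "\<lambda>z. p (fst z)" u ut Du \<psi> m M p_plus C u0
  proof (unfold_locales, unfold Q_def[symmetric])
    show "1 \<le> p (fst z)" if "z \<in> Q" for z using assms(9)[OF fstQ[OF that]] assms(8) by linarith
    show "p (fst z) \<le> p_plus" if "z \<in> Q" for z using assms(9)[OF fstQ[OF that]] by simp
    show "0 < M" "0 \<le> C" using C by (auto simp: M_def)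
  qed (use Qo W u0 uM \<open>1 \<le> m\<close> pm p_log Di weak \<Omega> \<open>0 < T\<close> init in \<open>auto simp: Du_def\<close>)
  define S where "S = msupp \<Omega> u0"
  have S: "closed S" by (simp add: S_def msupp_def Let_def)
  have O: "open (\<Omega> - S)" using \<Omega> S by (intro open_Diff)
  have u0z: "AE x in lebesgue_on \<Omega>. x \<notin> S \<longrightarrow> u0 x = 0"
    unfolding S_def
  proof (rule AE_zero_off_msupp[OF \<Omega>])
    show "u0 \<in> borel_measurable (lebesgue_on \<Omega>)" using tr' by (simp add: has_trace_def)
  qed (rule assms(11))
  have "AE z in lebesgue. z \<in> (\<Omega> - S) \<times> {0<..<T} \<longrightarrow> (z \<in> Q \<longrightarrow> u z = 0)"
  proof (rule AE_lebesgue_local)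
    fix z0 assume "z0 \<in> (\<Omega> - S) \<times> {0<..<T}"
    then have "fst z0 \<in> \<Omega> - S" by auto
    then obtain r where r: "0 < r" "cball (fst z0) r \<subseteq> \<Omega> - S" using O open_contains_cball by blast
    \<comment> \<open>A cutoff function supported in a ball that does not meet the support of the initial value.\<close>
    define \<eta> where "\<eta> x = bump r (fst z0 - x)" for x
    have \<eta>: "\<eta> \<in> C01 \<Omega>" unfolding \<eta>_def[abs_def] using r by (intro bump_C01) auto
    have \<eta>pos: "\<eta> x \<noteq> 0" if "x \<in> ball (fst z0) r" for x
      unfolding \<eta>_def by (rule bump_nonzero) (use that in \<open>simp add: dist_norm\<close>)
    have "AE x in lebesgue_on \<Omega>. \<eta> x \<noteq> 0 \<longrightarrow> u0 x = 0"
      using u0z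
    proof eventually_elim
      case (elim x)
      show ?case
      proof
        assume "\<eta> x \<noteq> 0"
        then have "x \<in> cball (fst z0) r" using r bump_zero[of r "fst z0 - x"] by (force simp: \<eta>_def dist_norm)
        then show "u0 x = 0" using elim r by auto
      qed
    qed
    then have "AE z in lebesgue_on Q. \<eta> (fst z) \<noteq> 0 \<longrightarrow> u z = 0"
      unfolding Q_def by (intro vanishes_off_initial_support \<eta>) (simp add: \<eta>_def bump_nonneg)
    then have "AE z in lebesgue. z \<in> Q \<longrightarrow> \<eta> (fst z) \<noteq> 0 \<longrightarrow> u z = 0"
      unfolding AE_lebesgue_on_iff[OF Qo(1)] .
    then have "AE z in lebesgue. z \<in> ball z0 r \<longrightarrow> z \<in> Q \<longrightarrow> u z = 0"
    proof eventually_elim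
      case (elim z)
      show ?case
      proof (intro impI)
        assume z: "z \<in> ball z0 r" "z \<in> Q"
        then have "fst z \<in> ball (fst z0) r" using dist_fst_le[of z0 z] by simp
        then show "u z = 0" using elim z \<eta>pos by blast
      qed
    qed
    then show "\<exists>r>0. AE y in lebesgue. y \<in> ball z0 r \<longrightarrow> y \<in> Q \<longrightarrow> u y = 0" using r by blast
  qed
  from AE_slices[OF this]
  have ae: "AE t in lebesgue. negligible {x. \<not> ((x, t) \<in> (\<Omega> - S) \<times> {0<..<T} \<longrightarrow> (x, t) \<in> Q \<longrightarrow> u (x, t) = 0)}" .
  have aeT: "AE t in lebesgue. t \<noteq> T" using AE_lborel_singleton[of T] by (rule AE_completion)
  have "AE t in lebesgue. t \<in> {0<..T} \<longrightarrow> msupp \<Omega> (\<lambda>x. u (x, t)) \<subseteq> S"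
    using ae aeT
  proof eventually_elim
    case (elim t)
    show ?case
    proof
      assume "t \<in> {0<..T}"
      then have t: "t \<in> {0<..<T}" using elim(2) by auto
      show "msupp \<Omega> (\<lambda>x. u (x, t)) \<subseteq> S"
      proof (rule msupp_subset[OF \<Omega>(1) S negligible_subset[OF elim(1)]])
        show "{x \<in> \<Omega> - S. u (x, t) \<noteq> 0} \<subseteq> {x. \<not> ((x, t) \<in> (\<Omega> - S) \<times> {0<..<T} \<longrightarrow> (x, t) \<in> Q \<longrightarrow> u (x, t) = 0)}"
          using t by (auto simp: Q_def)
      qed
    qed
  qed
  then show ?thesis by (subst AE_restrict_space_iff) (auto simp: S_def)
qed

end
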